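(* Let $(\tilde a_n)_{n\ge1}$ be a non-decreasing sequence of positive numbers (possibly diverging to $\infty$). Let $(X_1,Y_1),\dots,(X_n,Y_n)$ be i.i.d. copies of $O=(X,Y)$ with distribution $P_0$, where $X\in[0,1]^d$ and $Y\in\mathcal{Y}_n=[-\tilde a_n,\tilde a_n]$. Let $L$ be the square loss $L(\theta):(x,y)\mapsto(y-\theta(x))^2$, $\Theta_n=\{\theta\in\mathbb{D}([0,1]^d):\|\theta\|_v\le\tilde a_n\}$, $\theta_n=\arg\min_{\theta\in\Theta_n}P_0L(\theta)$, and let $\hat\theta_n=\arg\min_{\theta\in\Theta_n}P_nL(\theta)$ be the least-squares estimator over $\Theta_n$. Set $a_n=4\tilde a_n$. Then $$\|\hat\theta_n-\theta_n\|_{P_0,2}=O_P\left(a_n\,n^{-1/3}(\log n)^{2(d-1)/3}\right).$$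
   Context: $\mathbb{D}([0,1]^d)$ is the set of real-valued càdlàg functions on $[0,1]^d$ (continuous from the upper-right quadrant at each point, with limits from all quadrants). For $\emptyset\ne s\subseteq[d]=\{1,\dots,d\}$ and $x\in[0,1]^d$ write $x_s=(x_j:j\in s)$, $x_{-s}=(x_j:j\notin s)$, and let $f_s:x_s\mapsto f(x_s,0_{-s})$ be the $s$-section of $f$. The sectional variation norm is $\|f\|_v=|f(0)|+\sum_{\emptyset\neq s\subseteq[d]}\int|f_s(dx_s)|$, where $f_s(dx_s)$ is the signed measure on $(0_s,1_s]$ generated by $f_s$ and $|f_s(dx_s)|$ its total variation measure. $P_0g=E_{P_0}[g(O)]$, $P_ng=n^{-1}\sum_{i=1}^ng(X_i,Y_i)$, and $\|f\|_{P_0,2}=(E_{P_0}[f(X)^2])^{1/2}$ for functions $f$ on $[0,1]^d$. The minimizers are assumed to exist; $O_P$ is as $n\to\infty$. *)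

theory Defs
  imports "HOL-Probability.Probability"
begin

text \<open>Points of \<open>[0,1]\<^sup>d\<close> have type \<^typ>\<open>real ^ 'd\<close>, so \<open>d = CARD('d) \<ge> 1\<close>. A function on the cube is a
  function on the whole type whose values outside \<open>unit_cube\<close> are never used.\<close>

definition unit_cube :: "(real ^ 'd) set" where
  "unit_cube = {x. \<forall>j. 0 \<le> x $ j \<and> x $ j \<le> 1}"

text \<open>The quadrants at \<open>x\<close> are half-open, with strict inequality exactly in the coordinates in \<open>s\<close>;
  \<open>s = {}\<close> is the (closed) upper-right quadrant. Quadrants not accumulating at \<open>x\<close> give a trivial
  filter and hence no condition. Left continuity at the upper boundary is not required.\<close>

definition quadrant :: "real ^ 'd \<Rightarrow> 'd set \<Rightarrow> (real ^ 'd) set" where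
  "quadrant x s = {y \<in> unit_cube. \<forall>j. if j \<in> s then y $ j < x $ j else x $ j \<le> y $ j}"

definition cadlag :: "(real ^ 'd \<Rightarrow> real) \<Rightarrow> bool" where
  "cadlag f \<longleftrightarrow> (\<forall>x\<in>unit_cube. continuous (at x within quadrant x {}) f \<and>
     (\<forall>s. \<exists>l. (f \<longlongrightarrow> l) (at x within quadrant x s)))"

definition signed_measure :: "'a measure \<Rightarrow> ('a set \<Rightarrow> real) \<Rightarrow> bool" where
  "signed_measure M \<nu> \<longleftrightarrow> \<nu> {} = 0 \<and>
     (\<forall>A. range A \<subseteq> sets M \<longrightarrow> disjoint_family A \<longrightarrow> (\<lambda>i::nat. \<nu> (A i)) sums \<nu> (\<Union>i. A i))"

definition total_variation :: "'a measure \<Rightarrow> ('a set \<Rightarrow> real) \<Rightarrow> 'a set \<Rightarrow> ennreal" where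
  "total_variation M \<nu> A =
     (SUP \<P>\<in>{\<P>. finite \<P> \<and> \<P> \<subseteq> sets M \<and> disjoint \<P> \<and> \<Union>\<P> = A}. \<Sum>E\<in>\<P>. ennreal \<bar>\<nu> E\<bar>)"

definition section_fun :: "'d set \<Rightarrow> (real ^ 'd \<Rightarrow> real) \<Rightarrow> real ^ 'd \<Rightarrow> real" where
  "section_fun s f x = f (\<chi> j. if j \<in> s then x $ j else 0)"

text \<open>The cube \<open>(0\<^sub>s, 1\<^sub>s]\<close>, embedded by \<open>x\<^sub>s \<mapsto> (x\<^sub>s, 0\<^sub>-\<^sub>s)\<close>.\<close>

definition face :: "'d set \<Rightarrow> (real ^ 'd) set" where
  "face s = {x. \<forall>j. if j \<in> s then 0 < x $ j \<and> x $ j \<le> 1 else x $ j = 0}"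

text \<open>\<open>\<nu>\<close> is generated by \<open>f\<^sub>s\<close> if it assigns to each box \<open>(a\<^sub>s, b\<^sub>s]\<close> the alternating sum of \<open>f\<^sub>s\<close> over
  its vertices.\<close>

definition generated_by_section ::
    "'d set \<Rightarrow> (real ^ 'd \<Rightarrow> real) \<Rightarrow> ((real ^ 'd) set \<Rightarrow> real) \<Rightarrow> bool" where
  "generated_by_section s f \<nu> \<longleftrightarrow> signed_measure (restrict_space borel (face s)) \<nu> \<and>
     (\<forall>a\<in>unit_cube. \<forall>b\<in>unit_cube. (\<forall>j. a $ j \<le> b $ j) \<longrightarrow>
        \<nu> {x \<in> face s. \<forall>j\<in>s. a $ j < x $ j \<and> x $ j \<le> b $ j} =
        (\<Sum>t\<in>Pow s. (-1) ^ card t * section_fun s f (\<chi> j. if j \<in> t then a $ j else b $ j)))"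

text \<open>The boxes are an intersection-stable generator, so \<open>f\<^sub>s\<close> generates at most one signed measure on
  Borel sets. The infimum is therefore its total variation, or \<open>\<infinity>\<close> if \<open>f\<^sub>s\<close> generates none.\<close>

definition section_variation :: "'d set \<Rightarrow> (real ^ 'd \<Rightarrow> real) \<Rightarrow> ennreal" where
  "section_variation s f = (INF \<nu>\<in>{\<nu>. generated_by_section s f \<nu>}.
     total_variation (restrict_space borel (face s)) \<nu> (face s))"

definition sectional_variation_norm :: "(real ^ 'd \<Rightarrow> real) \<Rightarrow> ennreal" where
  "sectional_variation_norm f = ennreal \<bar>f 0\<bar> + (\<Sum>s\<in>UNIV - {{}}. section_variation s f)"

definition cadlag_ball :: "real \<Rightarrow> (real ^ 'd \<Rightarrow> real) set" where
  "cadlag_ball r = {\<theta>. cadlag \<theta> \<and> sectional_variation_norm \<theta> \<le> ennreal r}"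

definition obs_space :: "real \<Rightarrow> ((real ^ 'd) \<times> real) measure" where
  "obs_space r = restrict_space borel (unit_cube \<times> {- r..r})"

definition square_loss :: "(real ^ 'd \<Rightarrow> real) \<Rightarrow> (real ^ 'd) \<times> real \<Rightarrow> real" where
  "square_loss \<theta> = (\<lambda>(x, y). (y - \<theta> x)\<^sup>2)"

definition empirical_mean :: "nat \<Rightarrow> (nat \<Rightarrow> 'o) \<Rightarrow> ('o \<Rightarrow> real) \<Rightarrow> real" where
  "empirical_mean n obs g = (\<Sum>i=1..n. g (obs i)) / real n"

definition L2_norm_X :: "((real ^ 'd) \<times> real) measure \<Rightarrow> (real ^ 'd \<Rightarrow> real) \<Rightarrow> real" where
  "L2_norm_X P f = sqrt (\<integral>(x, y). (f x)\<^sup>2 \<partial>P)"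

text \<open>Boundedness in probability relative to \<open>r\<close>, where the \<open>n\<close>-th variable lives on the \<open>n\<close>-th probability
  space. Outer probability is used so that \<open>Z n\<close> need not be measurable; if it is, this is the
  usual notion.\<close>

definition big_O_P :: "(nat \<Rightarrow> 'w measure) \<Rightarrow> (nat \<Rightarrow> 'w \<Rightarrow> real) \<Rightarrow> (nat \<Rightarrow> real) \<Rightarrow> bool" where
  "big_O_P \<Omega> Z r \<longleftrightarrow> (\<forall>\<epsilon>>0. \<exists>C>0. \<forall>\<^sub>F n in sequentially.
     outer_measure_of (\<Omega> n) {\<omega> \<in> space (\<Omega> n). \<bar>Z n \<omega>\<bar> > C * r n} \<le> ennreal \<epsilon>)"

end

theory Submission
  imports Defs "HOL-Real_Asymp.Real_Asymp"
begin

text \<open>Divide all functions by \<open>a'\<^sub>n\<close>. A function of sectional variation at most 1 is a mixture, of total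
  weight at most 1, of indicators of orthants \<open>{x. p \<le> x}\<close>. By convexity of the ball the estimation
  error \<open>h\<close> can be shrunk to norm exactly \<open>R\<close> and then satisfies \<open>R\<^sup>2 \<le> 2 (P\<^sub>n - P)(e h) - (P\<^sub>n - P) h\<^sup>2\<close>
  with \<open>e = y - \<theta>\<^sub>n(x)\<close>, so a bound of order \<open>n\<^sup>-\<^sup>1\<^sup>/\<^sup>2 R\<^sup>1\<^sup>/\<^sup>2 (log n)\<^sup>d\<^sup>-\<^sup>1\<close> for the localized empirical process
  gives the rate.

  That bound holds for every \<open>P\<close>. After symmetrization the sample points are fixed, and the
  vector of signs is split as \<open>u + v\<close>: an error of small empirical norm is paired with \<open>u\<close> by
  Cauchy-Schwarz, and \<open>v\<close> is uniformly small on orthants. If \<open>d = 1\<close>, then \<open>u\<close> and \<open>v\<close> come from soft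
  thresholding of the Haar coefficients. If \<open>d \<ge> 2\<close>, an orthant is a disjoint union of cells, at most
  one for each of \<open>O((log n)\<^sup>d\<^sup>-\<^sup>1)\<close> shapes and each dyadic size, and \<open>u\<close> is the projection to the span
  of the large cells. No entropy bound or chaining is needed.\<close>

section \<open>Rademacher averages\<close>

text \<open>The exponent is a matter of balance. For errors of empirical norm about
  \<open>sqrt n * R\<close>, the parts \<open>u\<close> and \<open>v\<close> cost
  \<open>sqrt n * R * A\<close> and \<open>B\<close>. A border between small and large cells at
  about \<open>n * R\<close> points makes both of order \<open>m * sqrt (n * R)\<close>, with
  \<open>m = (ln n) ^ (d - 1)\<close>. Against the quadratic gain \<open>n * R^2\<close> this asks
  for \<open>m \<le> sqrt n * R^(3/2)\<close>, that is \<open>R = n^(-1/3) * m^(2/3)\<close>. The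
  case distinction comes from logarithms: a maximum over all cells costs \<open>sqrt (ln n)\<close>,
  for which the rate has no room if \<open>d = 1\<close>. If \<open>d \<ge> 2\<close>, the bound for
  \<open>u\<close> is better than required by a factor \<open>sqrt m \<ge> sqrt (ln n)\<close>, and
  lowering the border to \<open>n * R / ln n\<close> spends it. The law of the points is arbitrary,
  so cells are built from ranks and the natural norm is the empirical one. It is tied to the
  population norm by a self-bounding argument on the class of squares, which are again mixtures of
  orthants. The minimizers may fail to be measurable, so suprema run over finite classes, which then
  exhaust a countable one.\<close>

definition signs :: "'i set \<Rightarrow> ('i \<Rightarrow> real) set" where
  "signs I = PiE I (\<lambda>_. {-1, 1})"

text \<open>A finite mean in place of an expectation: once the sample is fixed, averaging over signs
  raises no question of measurability.\<close>

definition rad_mean :: "'i set \<Rightarrow> (('i \<Rightarrow> real) \<Rightarrow> real) \<Rightarrow> real" where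
  "rad_mean I F = (\<Sum>\<epsilon>\<in>signs I. F \<epsilon>) / 2 ^ card I"

lemma card_signs: "finite I \<Longrightarrow> card (signs I) = 2 ^ card I"
  unfolding signs_def by (simp add: card_PiE numeral_2_eq_2)

lemma signs_sq: "\<epsilon> \<in> signs I \<Longrightarrow> i \<in> I \<Longrightarrow> \<epsilon> i = 1 \<or> \<epsilon> i = - 1"
  unfolding signs_def by (auto simp: PiE_iff)

lemma rad_mean_mono:
  "(\<And>\<epsilon>. \<epsilon> \<in> signs I \<Longrightarrow> F \<epsilon> \<le> G \<epsilon>) \<Longrightarrow> rad_mean I F \<le> rad_mean I G"
  unfolding rad_mean_def by (intro divide_right_mono sum_mono) auto

lemma rad_mean_add: "rad_mean I (\<lambda>\<epsilon>. F \<epsilon> + G \<epsilon>) = rad_mean I F + rad_mean I G"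
  unfolding rad_mean_def by (simp add: sum.distrib add_divide_distrib)

lemma rad_mean_cmult: "rad_mean I (\<lambda>\<epsilon>. c * F \<epsilon>) = c * rad_mean I F"
  unfolding rad_mean_def by (simp add: sum_distrib_left)

lemma rad_mean_const: "finite I \<Longrightarrow> rad_mean I (\<lambda>_. c) = c"
  unfolding rad_mean_def by (simp add: card_signs)

lemma rad_mean_sum: "rad_mean I (\<lambda>\<epsilon>. \<Sum>j\<in>J. F j \<epsilon>) = (\<Sum>j\<in>J. rad_mean I (F j))"
  unfolding rad_mean_def by (subst sum.swap) (simp add: sum_divide_distrib)

lemma rad_mean_jensen_sq:
  assumes "finite I"
  shows "(rad_mean I F)\<^sup>2 \<le> rad_mean I (\<lambda>\<epsilon>. (F \<epsilon>)\<^sup>2)"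
proof -
  have "(\<Sum>\<epsilon>\<in>signs I. F \<epsilon>)\<^sup>2 \<le> (\<Sum>\<epsilon>\<in>signs I. (F \<epsilon>)\<^sup>2) * card (signs I)"
    using sum_squared_le_sum_of_squares[of F "signs I"] by simp
  hence "(\<Sum>\<epsilon>\<in>signs I. F \<epsilon>)\<^sup>2 \<le> (\<Sum>\<epsilon>\<in>signs I. (F \<epsilon>)\<^sup>2) * 2 ^ card I"
    using assms by (simp add: card_signs)
  thus ?thesis
    unfolding rad_mean_def by (simp add: power_divide field_simps power2_eq_square)
qed

lemma rad_mean_sqrt_le:
  assumes "finite I" "\<And>\<epsilon>. \<epsilon> \<in> signs I \<Longrightarrow> 0 \<le> F \<epsilon>" "rad_mean I F \<le> B"
  shows "rad_mean I (\<lambda>\<epsilon>. sqrt (F \<epsilon>)) \<le> sqrt B"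
proof -
  have "(rad_mean I (\<lambda>\<epsilon>. sqrt (F \<epsilon>)))\<^sup>2 \<le> rad_mean I (\<lambda>\<epsilon>. (sqrt (F \<epsilon>))\<^sup>2)"
    by (rule rad_mean_jensen_sq[OF assms(1)])
  also have "\<dots> \<le> rad_mean I F" by (rule rad_mean_mono) (simp add: assms(2))
  finally show ?thesis using assms(3) real_le_rsqrt by fastforce
qed

section \<open>Subgaussian moments of Rademacher sums\<close>

lemma fact_double_ge: "2 ^ n * fact n \<le> (fact (2 * n) :: real)"
proof (induction n)
  case (Suc n)
  have "2 ^ Suc n * fact (Suc n) = (2 * real (Suc n)) * (2 ^ n * fact n)" by simp
  also have "\<dots> \<le> (real (2 * n + 2) * real (2 * n + 1)) * fact (2 * n)"
  proof (rule mult_mono)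
    have "2 * real (Suc n) * 1 \<le> 2 * real (Suc n) * real (2 * n + 1)"
      by (rule mult_left_mono) auto
    thus "2 * real (Suc n) \<le> real (2 * n + 2) * real (2 * n + 1)" by simp
  qed (use Suc in auto)
  also have "\<dots> = fact (2 * Suc n)" by (simp add: algebra_simps)
  finally show ?case .
qed simp

text \<open>Termwise comparison of the two power series, with \<open>fact_double_ge\<close> for the
  denominators.\<close>

lemma cosh_le_exp_half_sq: "cosh x \<le> exp (x\<^sup>2 / 2)" for x :: real
proof (rule sums_le)
  have "(\<lambda>n. if even n then x ^ n /\<^sub>R fact n else 0) sums cosh x" by (rule cosh_converges)
  thus "(\<lambda>n. x ^ (2 * n) /\<^sub>R fact (2 * n)) sums cosh x"
    by (subst (asm) sums_mono_reindex[of "\<lambda>n. 2 * n", symmetric])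
       (auto simp: strict_mono_def elim!: evenE)
  show "(\<lambda>n. (x\<^sup>2 / 2) ^ n /\<^sub>R fact n) sums exp (x\<^sup>2 / 2)" by (rule exp_converges)
  fix n
  have "x ^ (2 * n) / fact (2 * n) \<le> x ^ (2 * n) / (2 ^ n * fact n)"
    by (intro divide_left_mono fact_double_ge mult_pos_pos) auto
  thus "x ^ (2 * n) /\<^sub>R fact (2 * n) \<le> (x\<^sup>2 / 2) ^ n /\<^sub>R fact n"
    by (simp add: power_divide flip: power_mult) (simp add: field_simps)
qed

text \<open>Multiplying out over the coordinates turns the average of products into the product of
  the averages \<open>cosh (c i)\<close>.\<close>

lemma rad_mean_exp_le:
  assumes "finite I"
  shows "rad_mean I (\<lambda>\<epsilon>. exp (\<Sum>i\<in>I. \<epsilon> i * c i)) \<le> exp ((\<Sum>i\<in>I. (c i)\<^sup>2) / 2)"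
proof -
  have "(\<Sum>\<epsilon>\<in>signs I. exp (\<Sum>i\<in>I. \<epsilon> i * c i)) = (\<Sum>\<epsilon>\<in>signs I. \<Prod>i\<in>I. exp (\<epsilon> i * c i))"
    using assms by (simp add: exp_sum)
  also have "\<dots> = (\<Prod>i\<in>I. \<Sum>e\<in>{-1, 1}. exp (e * c i))"
    unfolding signs_def by (subst prod_sum_PiE) (use assms in auto)
  also have "\<dots> = (\<Prod>i\<in>I. 2 * cosh (c i))"
    by (rule prod.cong) (auto simp: cosh_def)
  also have "\<dots> = 2 ^ card I * (\<Prod>i\<in>I. cosh (c i))" by (simp add: prod.distrib)
  finally have "rad_mean I (\<lambda>\<epsilon>. exp (\<Sum>i\<in>I. \<epsilon> i * c i)) = (\<Prod>i\<in>I. cosh (c i))"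
    unfolding rad_mean_def by simp
  also have "\<dots> \<le> (\<Prod>i\<in>I. exp ((c i)\<^sup>2 / 2))"
    by (intro prod_mono) (auto simp: cosh_le_exp_half_sq)
  also have "\<dots> = exp ((\<Sum>i\<in>I. (c i)\<^sup>2) / 2)"
    using assms by (simp add: exp_sum sum_divide_distrib)
  finally show ?thesis .
qed

lemma rad_mean_exp_abs_le:
  assumes "finite I" "(\<Sum>i\<in>I. (c i)\<^sup>2) \<le> \<tau>\<^sup>2" "0 \<le> l"
  shows "rad_mean I (\<lambda>\<epsilon>. exp (l * \<bar>\<Sum>i\<in>I. \<epsilon> i * c i\<bar>)) \<le> 2 * exp (l\<^sup>2 * \<tau>\<^sup>2 / 2)"
proof -
  have *: "rad_mean I (\<lambda>\<epsilon>. exp (k * (\<Sum>i\<in>I. \<epsilon> i * c i))) \<le> exp (l\<^sup>2 * \<tau>\<^sup>2 / 2)" if "k\<^sup>2 = l\<^sup>2" for k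
  proof -
    have "rad_mean I (\<lambda>\<epsilon>. exp (\<Sum>i\<in>I. \<epsilon> i * (k * c i))) \<le> exp ((\<Sum>i\<in>I. (k * c i)\<^sup>2) / 2)"
      by (rule rad_mean_exp_le[OF assms(1)])
    also have "(\<Sum>i\<in>I. (k * c i)\<^sup>2) = l\<^sup>2 * (\<Sum>i\<in>I. (c i)\<^sup>2)"
      by (simp add: power_mult_distrib that sum_distrib_left)
    also have "\<dots> \<le> l\<^sup>2 * \<tau>\<^sup>2" by (intro mult_left_mono assms) auto
    finally show ?thesis by (simp add: sum_distrib_left algebra_simps)
  qed
  have "rad_mean I (\<lambda>\<epsilon>. exp (l * \<bar>\<Sum>i\<in>I. \<epsilon> i * c i\<bar>))
      \<le> rad_mean I (\<lambda>\<epsilon>. exp (l * (\<Sum>i\<in>I. \<epsilon> i * c i)) + exp ((- l) * (\<Sum>i\<in>I. \<epsilon> i * c i)))"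
    by (rule rad_mean_mono) (auto simp: abs_if)
  also have "\<dots> \<le> exp (l\<^sup>2 * \<tau>\<^sup>2 / 2) + exp (l\<^sup>2 * \<tau>\<^sup>2 / 2)"
    unfolding rad_mean_add by (intro add_mono *) auto
  finally show ?thesis by simp
qed

lemma sq_le_2_exp: "x\<^sup>2 \<le> 2 * exp x" if "0 \<le> x" for x :: real
proof -
  have "1 + x + x\<^sup>2 / 2 \<le> exp x" by (rule exp_lower_Taylor_quadratic[OF that])
  thus ?thesis using that by simp
qed

lemma exp_half_le: "exp (1/2 :: real) \<le> 7/4"
proof -
  have "(exp (1/2 :: real))\<^sup>2 = exp 1" by (simp add: power2_eq_square flip: exp_add)
  also have "\<dots> \<le> 3" by (rule exp_le)
  also have "\<dots> \<le> (7/4)\<^sup>2" by (simp add: power2_eq_square)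
  finally show ?thesis by (rule power2_le_imp_le) simp
qed

text \<open>Exponential moments control the overshoot above a threshold \<open>t\<close>, which removes the
  logarithm that a maximum over all cells of one scale would cost.\<close>

lemma rad_mean_overshoot:
  assumes "finite I" "(\<Sum>i\<in>I. (c i)\<^sup>2) \<le> \<tau>\<^sup>2" "0 < \<tau>"
  shows "rad_mean I (\<lambda>\<epsilon>. (max 0 (\<bar>\<Sum>i\<in>I. \<epsilon> i * c i\<bar> - t))\<^sup>2) \<le> 7 * \<tau>\<^sup>2 * exp (- t / \<tau>)"
proof -
  have "rad_mean I (\<lambda>\<epsilon>. (max 0 (\<bar>\<Sum>i\<in>I. \<epsilon> i * c i\<bar> - t))\<^sup>2)
      \<le> rad_mean I (\<lambda>\<epsilon>. (2 * \<tau>\<^sup>2 * exp (- t / \<tau>)) * exp ((1 / \<tau>) * \<bar>\<Sum>i\<in>I. \<epsilon> i * c i\<bar>))"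
  proof (rule rad_mean_mono)
    fix \<epsilon>
    let ?z = "\<bar>\<Sum>i\<in>I. \<epsilon> i * c i\<bar>"
    show "(max 0 (?z - t))\<^sup>2 \<le> (2 * \<tau>\<^sup>2 * exp (- t / \<tau>)) * exp ((1 / \<tau>) * ?z)"
    proof (cases "?z \<le> t")
      case False
      have "((?z - t) / \<tau>)\<^sup>2 \<le> 2 * exp ((?z - t) / \<tau>)"
        by (rule sq_le_2_exp) (use False assms in auto)
      moreover have "exp ((?z - t) / \<tau>) = exp (- t / \<tau>) * exp ((1 / \<tau>) * ?z)"
        by (simp add: exp_add[symmetric] diff_divide_distrib)
      ultimately show ?thesis
        using False assms(3) by (simp add: power_divide divide_le_eq algebra_simps)
    qed simp
  qed
  also have "\<dots> \<le> (2 * \<tau>\<^sup>2 * exp (- t / \<tau>)) * (2 * exp ((1/\<tau>)\<^sup>2 * \<tau>\<^sup>2 / 2))"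
    unfolding rad_mean_cmult
    by (intro mult_left_mono rad_mean_exp_abs_le assms) (use assms(3) in auto)
  \<comment> \<open>The choice \<open>l = 1 / \<tau>\<close> makes the exponent 1/2; then 2 * 2 *
    7/4 is the constant 7.\<close>
  also have "(1/\<tau>)\<^sup>2 * \<tau>\<^sup>2 / 2 = 1/2" using assms(3) by (simp add: power_divide)
  also have "(2 * \<tau>\<^sup>2 * exp (- t / \<tau>)) * (2 * exp (1/2)) \<le> (2 * \<tau>\<^sup>2 * exp (- t / \<tau>)) * (2 * (7/4))"
    by (intro mult_left_mono exp_half_le) auto
  finally show ?thesis by simp
qed

lemma rad_mean_sq_le:
  assumes "finite I" "(\<Sum>i\<in>I. (c i)\<^sup>2) \<le> \<tau>\<^sup>2" "0 < \<tau>"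
  shows "rad_mean I (\<lambda>\<epsilon>. (\<Sum>i\<in>I. \<epsilon> i * c i)\<^sup>2) \<le> 7 * \<tau>\<^sup>2"
  using rad_mean_overshoot[OF assms, of 0] by simp

text \<open>The maximum is compared with the logarithm of a sum of exponentials at
  \<open>l = sqrt (ln (2 * N)) / \<tau>\<close>. \<open>N\<close> only bounds the number of sums, so
  one logarithm can serve cells of every level.\<close>

lemma rad_mean_Max_le:
  assumes "finite I" "finite J" "J \<noteq> {}" "0 < \<tau>" "real (card J) \<le> N" "2 \<le> N"
    and c: "\<And>j. j \<in> J \<Longrightarrow> (\<Sum>i\<in>I. (c j i)\<^sup>2) \<le> \<tau>\<^sup>2"
  shows "rad_mean I (\<lambda>\<epsilon>. MAX j\<in>J. \<bar>\<Sum>i\<in>I. \<epsilon> i * c j i\<bar>) \<le> 2 * \<tau> * sqrt (ln (2 * N))"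
proof -
  define q where "q = sqrt (ln (2 * N))"
  have q: "q > 0" "q\<^sup>2 = ln (2 * N)" using assms by (auto simp: q_def)
  define l where "l = q / \<tau>"
  have l: "l > 0" using q assms by (auto simp: l_def)
  define S where "S \<epsilon> = (\<Sum>j\<in>J. exp (l * \<bar>\<Sum>i\<in>I. \<epsilon> i * c j i\<bar>))" for \<epsilon>
  define y where "y = 2 * N * exp (q\<^sup>2 / 2)"
  have y: "y > 0" using assms by (auto simp: y_def)
  have S: "rad_mean I S \<le> y"
  proof -
    have "rad_mean I S \<le> (\<Sum>j\<in>J. 2 * exp (l\<^sup>2 * \<tau>\<^sup>2 / 2))"
      unfolding S_def rad_mean_sum
      by (intro sum_mono rad_mean_exp_abs_le) (use assms l c in auto)
    also have "\<dots> \<le> N * (2 * exp (l\<^sup>2 * \<tau>\<^sup>2 / 2))" using assms by simp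
    also have "\<dots> = y" using assms by (simp add: y_def l_def power_divide)
    finally show ?thesis .
  qed
  have "l * (MAX j\<in>J. \<bar>\<Sum>i\<in>I. \<epsilon> i * c j i\<bar>) \<le> S \<epsilon> / y - 1 + ln y" for \<epsilon>
  proof -
    have "(MAX j\<in>J. \<bar>\<Sum>i\<in>I. \<epsilon> i * c j i\<bar>) \<in> (\<lambda>j. \<bar>\<Sum>i\<in>I. \<epsilon> i * c j i\<bar>) ` J"
      using assms by (intro Max_in) auto
    then obtain j where j: "j \<in> J" "(MAX j\<in>J. \<bar>\<Sum>i\<in>I. \<epsilon> i * c j i\<bar>) = \<bar>\<Sum>i\<in>I. \<epsilon> i * c j i\<bar>" by auto
    have "exp (l * \<bar>\<Sum>i\<in>I. \<epsilon> i * c j i\<bar>) \<le> S \<epsilon>"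
      unfolding S_def using j assms by (intro member_le_sum) auto
    moreover from this have "S \<epsilon> > 0" by (smt (verit) exp_gt_zero)
    ultimately have "l * \<bar>\<Sum>i\<in>I. \<epsilon> i * c j i\<bar> \<le> ln (S \<epsilon>)" by (simp add: ln_ge_iff)
    also have "\<dots> = ln (S \<epsilon> / y) + ln y" using \<open>S \<epsilon> > 0\<close> y by (simp add: ln_div)
    \<comment> \<open>The tangent of \<open>ln\<close> at \<open>y\<close>, the bound for the mean
      of \<open>S\<close>, does the work of Jensen's inequality for the concave logarithm.\<close>
    also have "\<dots> \<le> (S \<epsilon> / y - 1) + ln y"
      using \<open>S \<epsilon> > 0\<close> y by (intro add_mono ln_le_minus_one) auto
    finally show ?thesis using j by simp
  qed
  hence "rad_mean I (\<lambda>\<epsilon>. l * (MAX j\<in>J. \<bar>\<Sum>i\<in>I. \<epsilon> i * c j i\<bar>)) \<le> rad_mean I (\<lambda>\<epsilon>. (1 / y) * S \<epsilon> + (- 1 + ln y))"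
    by (intro rad_mean_mono) (simp add: algebra_simps)
  also have "\<dots> = (1 / y) * rad_mean I S + (- 1 + ln y)"
    unfolding rad_mean_add rad_mean_cmult rad_mean_const[OF assms(1)] by simp
  also have "\<dots> \<le> ln y" using S y by simp
  also have "ln y = ln (2 * N) + q\<^sup>2 / 2" using assms by (simp add: y_def ln_mult)
  also have "\<dots> \<le> 2 * q\<^sup>2" unfolding q(2)[symmetric] by simp
  finally have "l * rad_mean I (\<lambda>\<epsilon>. MAX j\<in>J. \<bar>\<Sum>i\<in>I. \<epsilon> i * c j i\<bar>) \<le> 2 * q\<^sup>2"
    unfolding rad_mean_cmult .
  hence "rad_mean I (\<lambda>\<epsilon>. MAX j\<in>J. \<bar>\<Sum>i\<in>I. \<epsilon> i * c j i\<bar>) \<le> 2 * \<tau> * q"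
    using q(1) assms(4) unfolding l_def by (simp add: field_simps power2_eq_square)
  thus ?thesis unfolding q_def .
qed

section \<open>Haar decomposition of the signs in dimension one\<close>

definition soft :: "real \<Rightarrow> real \<Rightarrow> real" where
  "soft t y = sgn y * max 0 (\<bar>y\<bar> - t)"

lemma soft_sq: "(soft t y)\<^sup>2 = (max 0 (\<bar>y\<bar> - t))\<^sup>2" if "0 \<le> t"
  using that unfolding soft_def by (auto simp: power_mult_distrib sgn_if)

lemma abs_diff_soft_le: "\<bar>y - soft t y\<bar> \<le> t" if "0 \<le> t"
  using that unfolding soft_def by (auto simp: sgn_if max_def abs_if)

text \<open>The unnormalized Haar functions of level \<open>l\<close>, for all blocks of length
  \<open>2 ^ Suc l\<close> at once.\<close>

definition haar_sign :: "nat \<Rightarrow> nat \<Rightarrow> real" where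
  "haar_sign l k = (if even (k div 2 ^ l) then 1 else - 1)"

lemma haar_sign_sq [simp]: "(haar_sign l k)\<^sup>2 = 1" "\<bar>haar_sign l k\<bar> = 1"
  unfolding haar_sign_def by auto

lemma sum_lessThan_add: "sum f {..<m + k} = sum f {..<m} + (\<Sum>j<k. f (m + j))" for f :: "nat \<Rightarrow> real"
  by (induction k) (auto simp: add.assoc)

text \<open>The primitive of a Haar function is a tent: it rises to \<open>2 ^ l\<close> at the
  middle of the block and returns to 0.\<close>

lemma sum_haar_sign_lessThan:
  "k \<le> 2 * 2 ^ l \<Longrightarrow> (\<Sum>j<k. haar_sign l j) = (if k \<le> 2 ^ l then real k else 2 * 2 ^ l - real k)"
proof (induction k)
  case (Suc k)
  have "k div 2 ^ l = (if k < 2 ^ l then 0 else 1)"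
    using Suc.prems by (auto simp: div_nat_eqI)
  thus ?case using Suc by (auto simp: haar_sign_def)
qed simp

text \<open>Complete blocks cancel; only block \<open>q\<close>, which the end of the prefix cuts,
  contributes.\<close>

lemma haar_prefix_sum:
  assumes "k \<le> 2 * 2 ^ l"
  shows "(\<Sum>i<2 * 2 ^ l * q + k. haar_sign l i * y (i div 2 ^ Suc l))
       = y q * (\<Sum>j<k. haar_sign l j)"
  using assms
proof (induction q arbitrary: k)
  have block: "haar_sign l (2 * 2 ^ l * q + j) * y ((2 * 2 ^ l * q + j) div 2 ^ Suc l) = y q * haar_sign l j"
    if "j < 2 * 2 ^ l" for q j
  proof -
    have "(2 * 2 ^ l * q + j) div 2 ^ Suc l = q"
      using that by (intro div_nat_eqI) (auto simp: algebra_simps)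
    moreover have "(2 * 2 ^ l * q + j) div 2 ^ l = 2 * q + j div 2 ^ l"
      by (metis div_mult_self2 mult.assoc mult.commute power_not_zero zero_neq_numeral add.commute)
    ultimately show ?thesis by (simp add: haar_sign_def)
  qed
  {
    case 0
    have "(\<Sum>j<k. haar_sign l (2 * 2 ^ l * 0 + j) * y ((2 * 2 ^ l * 0 + j) div 2 ^ Suc l))
      = (\<Sum>j<k. y 0 * haar_sign l j)"
      by (intro sum.cong refl block) (use 0 in auto)
    thus ?case by (simp add: sum_distrib_left)
  next
    case (Suc q)
    have "(\<Sum>i<2 * 2 ^ l * Suc q. haar_sign l i * y (i div 2 ^ Suc l)) = 0"
      using Suc.IH[of "2 * 2 ^ l"] sum_haar_sign_lessThan[of "2 * 2 ^ l" l]
      by (simp add: add.commute)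
    moreover have "(\<Sum>j<k. haar_sign l (2 * 2 ^ l * Suc q + j) * y ((2 * 2 ^ l * Suc q + j) div 2 ^ Suc l))
      = (\<Sum>j<k. y (Suc q) * haar_sign l j)"
      by (intro sum.cong refl block) (use Suc.prems in auto)
    ultimately show ?case
      by (subst sum_lessThan_add) (simp only: sum_distrib_left[symmetric] add_0)
  }
qed

text \<open>The reason for Haar functions: a perturbation of all coefficients of one level is felt
  by a prefix in a single block, however many blocks it contains.\<close>

lemma haar_prefix_sum_le:
  assumes "\<And>b. \<bar>y b\<bar> \<le> Y"
  shows "\<bar>\<Sum>k<t. haar_sign l k * y (k div 2 ^ Suc l)\<bar> \<le> 2 ^ l * Y"
proof -
  define q k where "q = t div (2 * 2 ^ l)" and "k = t mod (2 * 2 ^ l)"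
  have t: "t = 2 * 2 ^ l * q + k" unfolding q_def k_def by simp
  have k: "k \<le> 2 * 2 ^ l" unfolding k_def by (simp add: less_imp_le)
  have "\<bar>\<Sum>j<k. haar_sign l j\<bar> \<le> 2 ^ l"
    unfolding sum_haar_sign_lessThan[OF k] using k
    by (auto simp: not_le) (use of_nat_le_iff[of k "2 * 2 ^ l", where 'a=real] of_nat_le_iff[of k "2 ^ l", where 'a=real] of_nat_less_iff[of "2 ^ l" k, where 'a=real] in \<open>auto simp: abs_if\<close>)
  hence "\<bar>y q\<bar> * \<bar>\<Sum>j<k. haar_sign l j\<bar> \<le> Y * 2 ^ l"
    using assms[of q] by (intro mult_mono) auto
  thus ?thesis unfolding t haar_prefix_sum[OF k] by (simp add: abs_mult mult.commute)
qed

definition block_sum :: "'i set \<Rightarrow> ('i \<Rightarrow> nat) \<Rightarrow> nat \<Rightarrow> nat \<Rightarrow> ('i \<Rightarrow> real) \<Rightarrow> real" where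
  "block_sum I r l b \<xi> = (\<Sum>i\<in>I. of_bool (r i div 2 ^ l = b) * \<xi> i)"

text \<open>\<open>r\<close> will be the rank of a point. The inner product is left unnormalized;
  the division by \<open>2 ^ Suc l\<close> appears in the expansion.\<close>

definition haar_coeff :: "'i set \<Rightarrow> ('i \<Rightarrow> nat) \<Rightarrow> nat \<Rightarrow> nat \<Rightarrow> ('i \<Rightarrow> real) \<Rightarrow> real" where
  "haar_coeff I r l b \<xi> = (\<Sum>i\<in>I. of_bool (r i div 2 ^ Suc l = b) * haar_sign l (r i) * \<xi> i)"

text \<open>The average over half a block is the average over the block, plus or minus half the
  difference of the two half averages. Absent ranks count as zeros, so incomplete blocks are no
  exception.\<close>

lemma block_sum_Suc:
  "block_sum I r l c \<xi> / 2 ^ l = block_sum I r (Suc l) (c div 2) \<xi> / 2 ^ Suc l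
     + (if even c then 1 else - 1) * haar_coeff I r l (c div 2) \<xi> / 2 ^ Suc l"
proof -
  have "2 * (of_bool (r i div 2 ^ l = c) * \<xi> i) = of_bool (r i div 2 ^ Suc l = c div 2) * \<xi> i
      + (if even c then 1 else - 1) * (of_bool (r i div 2 ^ Suc l = c div 2) * haar_sign l (r i) * \<xi> i)" for i
  proof -
    have "r i div 2 ^ Suc l = (r i div 2 ^ l) div 2" by (simp only: power_Suc2 div_mult2_eq)
    moreover have "m = c \<longleftrightarrow> m div 2 = c div 2 \<and> (even m \<longleftrightarrow> even c)" for m :: nat
      by presburger
    ultimately show ?thesis unfolding haar_sign_def by auto
  qed
  hence "2 * block_sum I r l c \<xi> = block_sum I r (Suc l) (c div 2) \<xi>
     + (if even c then 1 else - 1) * haar_coeff I r l (c div 2) \<xi>"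
    unfolding block_sum_def haar_coeff_def sum_distrib_left by (simp flip: sum.distrib)
  thus ?thesis by (simp add: field_simps)
qed

text \<open>Telescopes \<open>block_sum_Suc\<close> from blocks of a single rank, where injectivity
  of \<open>r\<close> isolates \<open>i\<close>, up to the one block that holds all ranks.\<close>

lemma haar_expansion:
  assumes "finite I" "inj_on r I" "i \<in> I" "r i < 2 ^ L"
  shows "\<xi> i = block_sum I r L 0 \<xi> / 2 ^ L
    + (\<Sum>l<L. haar_sign l (r i) * haar_coeff I r l (r i div 2 ^ Suc l) \<xi> / 2 ^ Suc l)"
proof -
  have "\<xi> i = block_sum I r m (r i div 2 ^ m) \<xi> / 2 ^ m
    + (\<Sum>l<m. haar_sign l (r i) * haar_coeff I r l (r i div 2 ^ Suc l) \<xi> / 2 ^ Suc l)" for m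
  proof (induction m)
    case 0
    have "block_sum I r 0 (r i) \<xi> = (\<Sum>k\<in>I. if k = i then \<xi> k else 0)"
      unfolding block_sum_def using assms by (intro sum.cong) (auto simp: inj_on_def)
    thus ?case using assms by simp
  next
    case (Suc m)
    have "r i div 2 ^ Suc m = (r i div 2 ^ m) div 2" by (simp only: power_Suc2 div_mult2_eq)
    thus ?case using Suc.IH block_sum_Suc[of I r m "r i div 2 ^ m" \<xi>] by (simp add: haar_sign_def)
  qed
  from this[of L] assms(4) show ?thesis by simp
qed

text \<open>\<open>u\<close>, \<open>v\<close> and \<open>M\<close> may depend on the points and the
  signs. \<open>A\<close> will be multiplied by an empirical norm and \<open>B\<close> by a
  variation. Having \<open>M\<close> as a witness avoids a supremum over all orthants.\<close>

definition sign_split ::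
    "'i set \<Rightarrow> ('i \<Rightarrow> real ^ 'd) \<Rightarrow> ('i \<Rightarrow> real) \<Rightarrow> real \<Rightarrow> real \<Rightarrow> bool" where
  "sign_split I x w A B \<longleftrightarrow> (\<exists>u v M.
     (\<forall>\<epsilon>\<in>signs I. (\<forall>i\<in>I. \<epsilon> i * w i = u \<epsilon> i + v \<epsilon> i) \<and>
        (\<forall>a. \<bar>\<Sum>i\<in>I. of_bool (\<forall>j. a $ j \<le> x i $ j) * v \<epsilon> i\<bar> \<le> M \<epsilon>)) \<and>
     rad_mean I (\<lambda>\<epsilon>. L2_set (u \<epsilon>) I) \<le> A \<and> rad_mean I M \<le> B)"

lemma L2_set_sum_le: "L2_set (\<lambda>i. \<Sum>l<L. f l i) I \<le> (\<Sum>l<L. L2_set (f l) I)" for L :: nat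
proof (induction L)
  case (Suc L)
  have "L2_set (\<lambda>i. (\<Sum>l<L. f l i) + f L i) I \<le> L2_set (\<lambda>i. \<Sum>l<L. f l i) I + L2_set (f L) I"
    by (rule L2_set_triangle_ineq)
  thus ?case using Suc by simp
qed (simp add: L2_set_def)

lemma inv_sqrt2_bounds: "1 / sqrt 2 \<le> (3/4 :: real)" "0 < 1 / sqrt (2::real)" "4/3 \<le> sqrt (2::real)" "sqrt (2::real) \<le> 3/2"
proof -
  show *: "4/3 \<le> sqrt (2::real)" by (rule real_le_rsqrt) (simp add: power2_eq_square)
  thus "1 / sqrt 2 \<le> (3/4 :: real)" by (simp add: field_simps)
  show "sqrt (2::real) \<le> 3/2" by (rule real_le_lsqrt) (auto simp: power2_eq_square)
qed auto

lemma sqrt_2_power: "sqrt (2 ^ l) = sqrt 2 ^ l"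
  by (simp add: real_sqrt_power)

text \<open>Subtraction is truncated, so one of the two exponents is always 0 and the summand is
  \<open>s\<close> to the distance of \<open>l\<close> from \<open>l0\<close>. At
  \<open>s = 3/4\<close> the two sides of the peak sum to at most 3 and 4.\<close>

lemma geometric_peak_sum:
  fixes s :: real
  assumes "0 < s" "s \<le> 3/4"
  shows "(\<Sum>l<L. s ^ (l0 - l) * s ^ (l - l0)) \<le> 7"
proof -
  have up: "(\<Sum>l<m. s ^ (m - l)) \<le> 3" for m
  proof (induction m)
    case (Suc m)
    have "(\<Sum>l<Suc m. s ^ (Suc m - l)) = s * (\<Sum>l<m. s ^ (m - l)) + s"
      by (simp add: sum_distrib_left Suc_diff_le)
    also have "\<dots> \<le> s * 3 + s" using Suc assms by (intro add_mono mult_left_mono) auto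
    also have "\<dots> \<le> 3" using assms by simp
    finally show ?case .
  qed simp
  have down: "(\<Sum>l<m. s ^ l) \<le> 4" for m
  proof -
    have "(\<Sum>l<m. s ^ l) = (1 - s ^ m) / (1 - s)"
      using assms by (subst sum_gp_strict) auto
    also have "\<dots> \<le> 1 / (1 - s)" using assms by (intro divide_right_mono) auto
    also have "\<dots> \<le> 4" using assms by (simp add: field_simps)
    finally show ?thesis .
  qed
  have "(\<Sum>l<L. s ^ (l0 - l) * s ^ (l - l0)) \<le> (\<Sum>l<l0 + L. s ^ (l0 - l) * s ^ (l - l0))"
    using assms by (intro sum_mono2) auto
  also have "\<dots> = (\<Sum>l<l0. s ^ (l0 - l)) + (\<Sum>l<L. s ^ l)"
    by (subst sum_lessThan_add) auto
  also have "\<dots> \<le> 3 + 4" by (intro add_mono up down)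
  finally show ?thesis by simp
qed

text \<open>Truncated subtraction removes the levels from \<open>l0\<close> on. The induction works
  for any constant that is at least \<open>3 * q / (q - 1)\<close>, which is at most 12 for
  \<open>q \<ge> 4/3\<close>.\<close>

lemma arith_geom_sum:
  fixes q :: real
  assumes "4/3 \<le> q" "q \<le> 3/2"
  shows "(\<Sum>l<L. real (l0 - l) * q ^ l) \<le> 14 * q ^ l0"
proof -
  have geo: "(\<Sum>l<Suc m. q ^ l) \<le> 3 * q ^ Suc m" for m
  proof -
    have "(\<Sum>l<Suc m. q ^ l) = (q ^ Suc m - 1) / (q - 1)"
      using assms by (subst geometric_sum) auto
    also have "\<dots> \<le> q ^ Suc m / (1/3)" using assms by (intro frac_le) auto
    finally show ?thesis by simp
  qed
  have main: "(\<Sum>l<m. real (m - l) * q ^ l) \<le> 14 * q ^ m" for m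
  proof (induction m)
    case (Suc m)
    have "(\<Sum>l<Suc m. real (Suc m - l) * q ^ l) = (\<Sum>l<m. real (m - l) * q ^ l) + (\<Sum>l<Suc m. q ^ l)"
      by (simp add: sum.distrib[symmetric] algebra_simps Suc_diff_le of_nat_diff)
    also have "\<dots> \<le> 14 * q ^ m + 3 * q ^ Suc m" by (intro add_mono geo Suc)
    also have "\<dots> = (14 + 3 * q) * q ^ m" by (simp add: algebra_simps)
    also have "\<dots> \<le> (14 * q) * q ^ m" using assms by (intro mult_right_mono) auto
    finally show ?case by simp
  qed simp
  have "(\<Sum>l<L. real (l0 - l) * q ^ l) \<le> (\<Sum>l<l0 + L. real (l0 - l) * q ^ l)"
    using assms by (intro sum_mono2) auto
  also have "\<dots> = (\<Sum>l<l0. real (l0 - l) * q ^ l)" by (subst sum_lessThan_add) auto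
  finally show ?thesis using main[of l0] by simp
qed

lemma rad_mean_L2_set_le:
  assumes "finite I" "0 \<le> B" "\<And>i. i \<in> I \<Longrightarrow> rad_mean I (\<lambda>\<epsilon>. (u \<epsilon> i)\<^sup>2) \<le> B"
  shows "rad_mean I (\<lambda>\<epsilon>. L2_set (u \<epsilon>) I) \<le> sqrt (real (card I) * B)"
  unfolding L2_set_def
proof (rule rad_mean_sqrt_le)
  have "rad_mean I (\<lambda>\<epsilon>. \<Sum>i\<in>I. (u \<epsilon> i)\<^sup>2) \<le> (\<Sum>i\<in>I. B)"
    unfolding rad_mean_sum by (intro sum_mono assms)
  thus "rad_mean I (\<lambda>\<epsilon>. \<Sum>i\<in>I. (u \<epsilon> i)\<^sup>2) \<le> real (card I) * B" by simp
qed (auto simp: assms sum_nonneg)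

text \<open>Injectivity of \<open>r\<close> leaves at most one point for each of the
  \<open>2 ^ l\<close> ranks of a block.\<close>

lemma sum_block_sq_le:
  fixes r :: "'i \<Rightarrow> nat" and w :: "'i \<Rightarrow> real"
  assumes "finite I" "inj_on r I" "\<And>i. i \<in> I \<Longrightarrow> \<bar>w i\<bar> \<le> 1"
  shows "(\<Sum>i\<in>I. (of_bool (r i div 2 ^ l = b) * w i)\<^sup>2) \<le> 2 ^ l"
proof -
  let ?J = "{i \<in> I. r i div 2 ^ l = b}"
  have "(\<Sum>i\<in>I. (of_bool (r i div 2 ^ l = b) * w i)\<^sup>2) \<le> (\<Sum>i\<in>I. of_bool (r i div 2 ^ l = b))"
  proof (rule sum_mono)
    fix i assume "i \<in> I"
    thus "(of_bool (r i div 2 ^ l = b) * w i)\<^sup>2 \<le> of_bool (r i div 2 ^ l = b)"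
      using assms(3)[of i] by (auto simp: abs_square_le_1)
  qed
  also have "\<dots> = real (card ?J)" using assms(1) by (simp add: of_bool_def sum.If_cases Int_def)
  also have "card ?J = card (r ` ?J)"
    using assms(2) by (intro card_image[symmetric]) (auto intro: inj_on_subset)
  also have "card (r ` ?J) \<le> card {b * 2 ^ l..<b * 2 ^ l + 2 ^ l}"
  proof (rule card_mono)
    have "m \<in> {b * 2 ^ l..<b * 2 ^ l + 2 ^ l}" if "m div 2 ^ l = b" for m :: nat
    proof -
      have "b * 2 ^ l + m mod 2 ^ l = m" using that div_mult_mod_eq[of m "2 ^ l"] by simp
      moreover have "m mod 2 ^ l < 2 ^ l" by simp
      ultimately show ?thesis unfolding atLeastLessThan_iff by linarith
    qed
    thus "r ` ?J \<subseteq> {b * 2 ^ l..<b * 2 ^ l + 2 ^ l}" by blast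
  qed simp
  finally show ?thesis by simp
qed

text \<open>\<open>prefix\<close> says that orthants are initial segments in the order of ranks, as
  they are on a line. Coefficients are split level by level, with thresholds instead of a maximum,
  so that no logarithm is lost.\<close>

lemma sign_split_haar:
  fixes x :: "'i \<Rightarrow> real ^ 'd"
  assumes I: "finite I" and r: "bij_betw r I {..<card I}" and L: "card I \<le> 2 ^ L" "l0 \<le> L"
    and w: "\<And>i. i \<in> I \<Longrightarrow> \<bar>w i\<bar> \<le> 1"
    and prefix: "\<And>a. \<exists>t\<le>card I. \<forall>i\<in>I. (\<forall>j. a $ j \<le> x i $ j) \<longleftrightarrow> r i < t"
  shows "sign_split I x w (20 * sqrt (2 ^ L / 2 ^ l0)) (21 * sqrt (2 ^ l0))"
proof -
  have L': "real (card I) \<le> 2 ^ L" using L(1) of_nat_le_iff[of "card I" "2 ^ L", where 'a = real] by simp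
  have inj: "inj_on r I" using r by (simp add: bij_betw_def)
  define \<tau> where "\<tau> l = sqrt 2 ^ Suc l" for l :: nat
  have \<tau>: "\<tau> l > 0" "(\<tau> l)\<^sup>2 = 2 ^ Suc l" for l
    unfolding \<tau>_def by (auto simp del: power_Suc simp flip: sqrt_2_power)
  \<comment> \<open>From level \<open>l0\<close> on the threshold is 0 and everything goes to
    \<open>u\<close>. Below \<open>l0\<close>, linear growth in \<open>l0 - l\<close> suffices: each
    level down, the overshoot gains a factor below 1/4 against a doubling of the number of
    coefficients, while the sum of the thresholds stays of order
    \<open>2 ^ (l0 / 2)\<close>.\<close>
  define t where "t l = 2 * real (l0 - l) * \<tau> l" for l
  have t: "t l \<ge> 0" for l unfolding t_def using \<tau>(1)[of l] by simp
  define \<xi> where "\<xi> \<epsilon> i = \<epsilon> i * w i" for \<epsilon> i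
  define z where "z \<epsilon> l i = haar_coeff I r l (r i div 2 ^ Suc l) (\<xi> \<epsilon>)" for \<epsilon> l i
  define u0 where "u0 \<epsilon> i = block_sum I r L 0 (\<xi> \<epsilon>) / 2 ^ L" for \<epsilon> and i :: 'i
  define ul where "ul \<epsilon> l i = haar_sign l (r i) * soft (t l) (z \<epsilon> l i) / 2 ^ Suc l" for \<epsilon> l i
  \<comment> \<open>A function of the rank \<open>k\<close> rather than of the point, so that it can
    be summed over initial segments of ranks.\<close>
  define vl where "vl \<epsilon> l k = haar_sign l k * (let y = haar_coeff I r l (k div 2 ^ Suc l) (\<xi> \<epsilon>) in y - soft (t l) y) / 2 ^ Suc l" for \<epsilon> l k
  define u where "u \<epsilon> i = u0 \<epsilon> i + (\<Sum>l<L. ul \<epsilon> l i)" for \<epsilon> i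
  define v where "v \<epsilon> i = (\<Sum>l<L. vl \<epsilon> l (r i))" for \<epsilon> i
  \<comment> \<open>Thresholding leaves at most \<open>t l\<close> of a coefficient, and the prefix
    bound \<open>2 ^ l\<close> meets the normalization \<open>2 ^ Suc l\<close>. This bound does not
    depend on the signs.\<close>
  define M where "M = (\<Sum>l<L. t l / 2)"
  have split: "\<epsilon> i * w i = u \<epsilon> i + v \<epsilon> i" if "i \<in> I" for \<epsilon> i
  proof -
    have "r i < card I" using r that by (auto simp: bij_betw_def)
    hence "\<xi> \<epsilon> i = block_sum I r L 0 (\<xi> \<epsilon>) / 2 ^ L
      + (\<Sum>l<L. haar_sign l (r i) * z \<epsilon> l i / 2 ^ Suc l)"
      unfolding z_def using I inj that L by (intro haar_expansion) auto
    also have "\<dots> = u \<epsilon> i + v \<epsilon> i"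
      unfolding u_def v_def u0_def ul_def vl_def z_def Let_def
      by (simp add: sum.distrib[symmetric] algebra_simps add_divide_distrib[symmetric] diff_divide_distrib[symmetric])
    finally show ?thesis by (simp add: \<xi>_def)
  qed
  have vM: "\<bar>\<Sum>i\<in>I. of_bool (\<forall>j. a $ j \<le> x i $ j) * v \<epsilon> i\<bar> \<le> M" for \<epsilon> a
  proof -
    obtain k where k: "k \<le> card I" "\<And>i. i \<in> I \<Longrightarrow> (\<forall>j. a $ j \<le> x i $ j) \<longleftrightarrow> r i < k"
      using prefix by blast
    have "(\<Sum>i\<in>I. of_bool (\<forall>j. a $ j \<le> x i $ j) * v \<epsilon> i) = (\<Sum>i\<in>I. of_bool (r i < k) * (\<Sum>l<L. vl \<epsilon> l (r i)))"
      using k by (simp add: v_def)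
    also have "\<dots> = (\<Sum>m<card I. of_bool (m < k) * (\<Sum>l<L. vl \<epsilon> l m))"
      by (rule sum.reindex_bij_betw[OF r])
    also have "\<dots> = (\<Sum>m<k. \<Sum>l<L. vl \<epsilon> l m)"
      using k(1) by (intro sum.mono_neutral_cong_right) auto
    also have "\<dots> = (\<Sum>l<L. \<Sum>m<k. vl \<epsilon> l m)" by (rule sum.swap)
    finally have "\<bar>\<Sum>i\<in>I. of_bool (\<forall>j. a $ j \<le> x i $ j) * v \<epsilon> i\<bar> \<le> (\<Sum>l<L. \<bar>\<Sum>m<k. vl \<epsilon> l m\<bar>)"
      by (simp add: sum_abs)
    also have "\<dots> \<le> (\<Sum>l<L. t l / 2)"
    proof (rule sum_mono)
      fix l
      define y where "y b = (let y = haar_coeff I r l b (\<xi> \<epsilon>) in (y - soft (t l) y) / 2 ^ Suc l)" for b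
      have "\<bar>\<Sum>m<k. haar_sign l m * y (m div 2 ^ Suc l)\<bar> \<le> 2 ^ l * (t l / 2 ^ Suc l)"
        by (rule haar_prefix_sum_le)
           (auto simp: y_def Let_def abs_diff_soft_le t intro!: divide_right_mono)
      thus "\<bar>\<Sum>m<k. vl \<epsilon> l m\<bar> \<le> t l / 2" by (simp add: y_def vl_def Let_def)
    qed
    finally show ?thesis unfolding M_def .
  qed
  have "M = (\<Sum>l<L. sqrt 2 * (real (l0 - l) * sqrt 2 ^ l))"
    unfolding M_def t_def \<tau>_def by (intro sum.cong) auto
  also have "\<dots> \<le> (3/2) * (14 * sqrt 2 ^ l0)"
    unfolding sum_distrib_left[symmetric]
    by (intro mult_mono arith_geom_sum inv_sqrt2_bounds sum_nonneg) auto
  finally have M: "M \<le> 21 * sqrt (2 ^ l0)" by (simp add: sqrt_2_power)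
  \<comment> \<open>The overall average is a single coefficient and goes to \<open>u\<close> without
    a threshold; its norm is at most \<open>sqrt 7 \<le> 3\<close>.\<close>
  have u0: "rad_mean I (\<lambda>\<epsilon>. L2_set (u0 \<epsilon>) I) \<le> 3"
  proof -
    have "rad_mean I (\<lambda>\<epsilon>. (u0 \<epsilon> i)\<^sup>2) \<le> 7 / 2 ^ L" for i
    proof -
      have "rad_mean I (\<lambda>\<epsilon>. (\<Sum>k\<in>I. \<epsilon> k * (of_bool (r k div 2 ^ L = 0) * w k))\<^sup>2) \<le> 7 * (sqrt 2 ^ L)\<^sup>2"
        using sum_block_sq_le[OF I inj w] by (intro rad_mean_sq_le I) (auto simp flip: sqrt_2_power)
      hence "(1 / 2 ^ L)\<^sup>2 * rad_mean I (\<lambda>\<epsilon>. (\<Sum>k\<in>I. \<epsilon> k * (of_bool (r k div 2 ^ L = 0) * w k))\<^sup>2)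
          \<le> (1 / 2 ^ L)\<^sup>2 * (7 * 2 ^ L)"
        by (intro mult_left_mono) (auto simp flip: sqrt_2_power)
      thus ?thesis unfolding rad_mean_cmult[symmetric]
        by (simp add: u0_def block_sum_def \<xi>_def power_divide power2_eq_square mult.left_commute)
    qed
    hence "rad_mean I (\<lambda>\<epsilon>. L2_set (u0 \<epsilon>) I) \<le> sqrt (real (card I) * (7 / 2 ^ L))"
      by (intro rad_mean_L2_set_le I) auto
    also have "\<dots> \<le> sqrt (3\<^sup>2)"
    proof (rule real_sqrt_le_mono)
      have "real (card I) * (7 / 2 ^ L) \<le> 2 ^ L * (7 / 2 ^ L)" by (intro mult_right_mono L') auto
      thus "real (card I) * (7 / 2 ^ L) \<le> 3\<^sup>2" by simp
    qed
    finally show ?thesis by simp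
  qed
  have ul: "rad_mean I (\<lambda>\<epsilon>. L2_set (ul \<epsilon> l) I)
      \<le> 2 * sqrt (2 ^ L / 2 ^ l0) * ((1 / sqrt 2) ^ (l0 - l) * (1 / sqrt 2) ^ (l - l0))" for l
  proof -
    have "rad_mean I (\<lambda>\<epsilon>. (ul \<epsilon> l i)\<^sup>2) \<le> 7 * exp (- 2 * real (l0 - l)) / 2 ^ Suc l" for i
    proof -
      let ?c = "\<lambda>k. of_bool (r k div 2 ^ Suc l = r i div 2 ^ Suc l) * (haar_sign l (r k) * w k)"
      have "rad_mean I (\<lambda>\<epsilon>. (max 0 (\<bar>\<Sum>k\<in>I. \<epsilon> k * ?c k\<bar> - t l))\<^sup>2) \<le> 7 * (\<tau> l)\<^sup>2 * exp (- t l / \<tau> l)"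
      proof (intro rad_mean_overshoot I \<tau>)
        show "(\<Sum>i\<in>I. (?c i)\<^sup>2) \<le> (\<tau> l)\<^sup>2"
          unfolding \<tau>(2) by (rule sum_block_sq_le[OF I inj]) (simp add: abs_mult w)
      qed
      also have "\<dots> = 7 * 2 ^ Suc l * exp (- 2 * real (l0 - l))"
        using \<tau>(1)[of l] unfolding \<tau>(2) t_def by simp
      finally have "(1 / 2 ^ Suc l)\<^sup>2 * rad_mean I (\<lambda>\<epsilon>. (max 0 (\<bar>\<Sum>k\<in>I. \<epsilon> k * ?c k\<bar> - t l))\<^sup>2)
          \<le> (1 / 2 ^ Suc l)\<^sup>2 * (7 * 2 ^ Suc l * exp (- 2 * real (l0 - l)))"
        by (intro mult_left_mono) auto
      moreover have "(ul \<epsilon> l i)\<^sup>2 = (1 / 2 ^ Suc l)\<^sup>2 * (max 0 (\<bar>\<Sum>k\<in>I. \<epsilon> k * ?c k\<bar> - t l))\<^sup>2" for \<epsilon>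
      proof -
        have "z \<epsilon> l i = (\<Sum>k\<in>I. \<epsilon> k * ?c k)"
          unfolding z_def haar_coeff_def \<xi>_def by (intro sum.cong) auto
        thus ?thesis unfolding ul_def by (simp add: power_divide power_mult_distrib soft_sq[OF t])
      qed
      ultimately show ?thesis unfolding rad_mean_cmult[symmetric] by (simp add: power2_eq_square)
    qed
    hence "rad_mean I (\<lambda>\<epsilon>. L2_set (ul \<epsilon> l) I) \<le> sqrt (real (card I) * (7 * exp (- 2 * real (l0 - l)) / 2 ^ Suc l))"
      by (intro rad_mean_L2_set_le I) auto
    also have "\<dots> \<le> sqrt ((2 * sqrt (2 ^ L / 2 ^ l0) * ((1 / sqrt 2) ^ (l0 - l) * (1 / sqrt 2) ^ (l - l0)))\<^sup>2)"
    proof (rule real_sqrt_le_mono)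
      have e: "exp (- 2 * real m) \<le> (1/4) ^ m" for m
      proof -
        have "exp (2::real) \<ge> 4" using exp_lower_Taylor_quadratic[of 2] by simp
        hence "exp (- 2 :: real) \<le> 1/4" by (simp add: exp_minus field_simps)
        hence "exp (- 2 :: real) ^ m \<le> (1/4) ^ m" by (intro power_mono) auto
        thus ?thesis by (simp add: exp_of_nat_mult[symmetric] mult.commute)
      qed
      have "real (card I) * (7 * exp (- 2 * real (l0 - l)) / 2 ^ Suc l) \<le> 2 ^ L * (7 * (1/4) ^ (l0 - l) / 2 ^ Suc l)"
        using L'
        by (intro mult_mono divide_right_mono mult_left_mono e) auto
      also have "\<dots> = 7/2 * 2 ^ L * ((1/4) ^ (l0 - l) / 2 ^ l)" by simp
      \<comment> \<open>Below \<open>l0\<close> the decay by 1/4 per level beats the doubling of the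
        coefficients; above \<open>l0\<close> their number decays by itself.\<close>
      also have "(1/4) ^ (l0 - l) / 2 ^ l = (1/2) ^ (l0 - l) * (1/2) ^ (l - l0) / (2::real) ^ l0"
      proof (cases "l \<le> l0")
        case True
        then obtain m where "l0 = l + m" by (auto simp: le_iff_add)
        thus ?thesis by (simp add: power_add power_divide) (simp add: power_mult_distrib[symmetric])
      next
        case False
        then obtain m where "l = l0 + m" using le_Suc_ex nat_le_linear by blast
        thus ?thesis by (simp add: power_add power_divide)
      qed
      also have "7/2 * 2 ^ L * ((1/2) ^ (l0 - l) * (1/2) ^ (l - l0) / (2::real) ^ l0)
        \<le> 4 * 2 ^ L * ((1/2) ^ (l0 - l) * (1/2) ^ (l - l0) / (2::real) ^ l0)"
        by (intro mult_right_mono) auto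
      also have "\<dots> = (2 * sqrt (2 ^ L / 2 ^ l0) * ((1 / sqrt 2) ^ (l0 - l) * (1 / sqrt 2) ^ (l - l0)))\<^sup>2"
      proof -
        have "((1 / sqrt 2 :: real) ^ m)\<^sup>2 = (1/2) ^ m" for m
          by (metis power_mult mult.commute power_divide power_one real_sqrt_pow2 zero_le_numeral)
        thus ?thesis by (simp add: power_mult_distrib real_sqrt_divide power_divide)
      qed
      finally show "real (card I) * (7 * exp (- 2 * real (l0 - l)) / 2 ^ Suc l)
        \<le> (2 * sqrt (2 ^ L / 2 ^ l0) * ((1 / sqrt 2) ^ (l0 - l) * (1 / sqrt 2) ^ (l - l0)))\<^sup>2" .
    qed
    also have "\<dots> = 2 * sqrt (2 ^ L / 2 ^ l0) * ((1 / sqrt 2) ^ (l0 - l) * (1 / sqrt 2) ^ (l - l0))"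
      by (rule real_sqrt_unique[OF refl]) auto
    finally show ?thesis .
  qed
  have "rad_mean I (\<lambda>\<epsilon>. L2_set (u \<epsilon>) I) \<le> rad_mean I (\<lambda>\<epsilon>. L2_set (u0 \<epsilon>) I + (\<Sum>l<L. L2_set (ul \<epsilon> l) I))"
  proof (rule rad_mean_mono)
    fix \<epsilon>
    have "L2_set (u \<epsilon>) I \<le> L2_set (u0 \<epsilon>) I + L2_set (\<lambda>i. \<Sum>l<L. ul \<epsilon> l i) I"
      unfolding u_def by (rule L2_set_triangle_ineq)
    thus "L2_set (u \<epsilon>) I \<le> L2_set (u0 \<epsilon>) I + (\<Sum>l<L. L2_set (ul \<epsilon> l) I)"
      using L2_set_sum_le[of "ul \<epsilon>" L I] by linarith
  qed
  also have "\<dots> = rad_mean I (\<lambda>\<epsilon>. L2_set (u0 \<epsilon>) I) + (\<Sum>l<L. rad_mean I (\<lambda>\<epsilon>. L2_set (ul \<epsilon> l) I))"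
    unfolding rad_mean_add rad_mean_sum ..
  also have "\<dots> \<le> 3 + (\<Sum>l<L. 2 * sqrt (2 ^ L / 2 ^ l0) * ((1 / sqrt 2) ^ (l0 - l) * (1 / sqrt 2) ^ (l - l0)))"
    by (intro add_mono u0 sum_mono ul)
  also have "\<dots> = 3 + 2 * sqrt (2 ^ L / 2 ^ l0) * (\<Sum>l<L. (1 / sqrt 2) ^ (l0 - l) * (1 / sqrt 2) ^ (l - l0))"
    by (simp add: sum_distrib_left)
  \<comment> \<open>\<open>l0 \<le> L\<close> makes the square root at least 1, which absorbs the
    term 3; then 3 + 2 * 7 is below 20.\<close>
  also have "\<dots> \<le> 3 * sqrt (2 ^ L / 2 ^ l0) + 2 * sqrt (2 ^ L / 2 ^ l0) * 7"
  proof -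
    have "1 \<le> sqrt (2 ^ L / 2 ^ l0)" using L(2) by simp
    thus ?thesis by (intro add_mono mult_left_mono geometric_peak_sum inv_sqrt2_bounds) auto
  qed
  also have "\<dots> \<le> 20 * sqrt (2 ^ L / 2 ^ l0)" by simp
  finally have u: "rad_mean I (\<lambda>\<epsilon>. L2_set (u \<epsilon>) I) \<le> 20 * sqrt (2 ^ L / 2 ^ l0)" .
  show ?thesis unfolding sign_split_def
    using split vM u M rad_mean_const[OF I, of M]
    by (intro exI[of _ u] exI[of _ v] exI[of _ "\<lambda>_. M"]) auto
qed

section \<open>Dyadic cells and projection in dimension at least two\<close>

text \<open>The blocks on the right are those of the binary expansion of \<open>t\<close>.\<close>

lemma prefix_dyadic_decomp:
  fixes t r :: nat
  shows "t < 2 ^ L \<Longrightarrow> (of_bool (r < t) :: real)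
     = (\<Sum>l<L. of_bool (odd (t div 2 ^ l) \<and> r div 2 ^ l = t div 2 ^ l - 1))"
proof (induction L arbitrary: r t)
  case (Suc L)
  have "t div 2 < 2 ^ L" using Suc.prems by (simp add: less_mult_imp_div_less mult.commute)
  from Suc.IH[OF this, of "r div 2"]
  have "(\<Sum>l<L. of_bool (odd (t div 2 ^ Suc l) \<and> r div 2 ^ Suc l = t div 2 ^ Suc l - 1)) = (of_bool (r div 2 < t div 2) :: real)"
    by (simp add: div_mult2_eq)
  \<comment> \<open>The last binary digit of an odd \<open>t\<close> contributes the single rank
    \<open>t - 1\<close>; the higher digits are those of \<open>t div 2\<close>.\<close>
  moreover have "(r < t) \<longleftrightarrow> r div 2 < t div 2 \<or> odd t \<and> r = t - 1"
    by presburger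
  moreover have "\<not> (r div 2 < t div 2 \<and> odd t \<and> r = t - 1)" by presburger
  ultimately show ?case
    by (subst sum.lessThan_Suc_shift) auto
qed simp

section \<open>Ranks and cells\<close>

definition rank_in :: "('i \<Rightarrow> nat) \<Rightarrow> 'i set \<Rightarrow> 'i \<Rightarrow> nat" where
  "rank_in p B i = card {k \<in> B. p k < p i}"

lemma bij_betw_rank_in:
  assumes "finite B" "inj_on p B"
  shows "bij_betw (rank_in p B) B {..<card B}"
proof -
  have less: "rank_in p B i < rank_in p B k" if "i \<in> B" "p i < p k" for i k
    unfolding rank_in_def using that assms(1) by (intro psubset_card_mono) auto
  have inj: "inj_on (rank_in p B) B"
  proof (rule inj_onI)
    fix i k assume "i \<in> B" "k \<in> B" "rank_in p B i = rank_in p B k"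
    hence "p i = p k" using less[of i k] less[of k i] by (metis linorder_neqE_nat less_irrefl)
    thus "i = k" using assms(2) \<open>i \<in> B\<close> \<open>k \<in> B\<close> by (auto simp: inj_on_def)
  qed
  moreover have "rank_in p B ` B \<subseteq> {..<card B}"
    unfolding rank_in_def using assms(1) by (auto intro!: psubset_card_mono)
  moreover have "card (rank_in p B ` B) = card {..<card B}" using inj by (simp add: card_image)
  ultimately show ?thesis unfolding bij_betw_def by (simp add: card_subset_eq)
qed

text \<open>The last hypothesis makes \<open>Q\<close> an initial segment of \<open>B\<close>, and a
  segment is recognized by the ranks below its size. This converts the condition on the remaining
  coordinate into a prefix inside a slab.\<close>

lemma rank_in_less_iff:
  assumes "finite B" "inj_on p B" "i \<in> B" "Q \<subseteq> B"
    and "\<And>i k. i \<in> B \<Longrightarrow> k \<in> Q \<Longrightarrow> p i < p k \<Longrightarrow> i \<in> Q"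
  shows "rank_in p B i < card Q \<longleftrightarrow> i \<in> Q"
proof
  have fQ: "finite Q" using assms finite_subset by blast
  show "rank_in p B i < card Q" if "i \<in> Q"
    unfolding rank_in_def using that assms fQ by (intro psubset_card_mono) auto
  show "i \<in> Q" if "rank_in p B i < card Q"
  proof (rule ccontr)
    assume "i \<notin> Q"
    have "Q \<subseteq> {k \<in> B. p k < p i}"
    proof
      fix k assume k: "k \<in> Q"
      hence "p k \<noteq> p i" using assms(2,3,4) \<open>i \<notin> Q\<close> by (auto simp: inj_on_def)
      moreover have "\<not> p i < p k" using assms(3,5) k \<open>i \<notin> Q\<close> by blast
      ultimately show "k \<in> {k \<in> B. p k < p i}" using k assms(4) by auto
    qed
    hence "card Q \<le> rank_in p B i"
      unfolding rank_in_def using assms(1) by (intro card_mono) auto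
    thus False using that by simp
  qed
qed

text \<open>Decreasing, because an orthant contains the points with large coordinates, which must
  come first to form a prefix. Only strict inequalities constrain \<open>p\<close>, so ties are
  broken and \<open>p\<close> stays injective.\<close>

lemma exists_decreasing_order:
  fixes y :: "'i \<Rightarrow> real"
  assumes "finite I"
  shows "\<exists>p :: 'i \<Rightarrow> nat. bij_betw p I {..<card I} \<and> (\<forall>i\<in>I. \<forall>k\<in>I. y k < y i \<longrightarrow> p i < p k)"
proof -
  define xs where "xs = sort_key (\<lambda>i. - y i) (SOME xs. set xs = I \<and> distinct xs)"
  have xs0: "set (SOME xs. set xs = I \<and> distinct xs) = I \<and> distinct (SOME xs. set xs = I \<and> distinct xs)"
    by (rule someI_ex) (use finite_distinct_list[OF assms] in auto)
  have xs: "set xs = I" "distinct xs" "sorted (map (\<lambda>i. - y i) xs)"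
    unfolding xs_def using xs0 by auto
  have len: "length xs = card I" using xs distinct_card by fastforce
  have bij: "bij_betw ((!) xs) {..<card I} I"
    using bij_betw_nth[OF xs(2) refl, of I] xs(1) len by auto
  define p where "p = the_inv_into {..<card I} ((!) xs)"
  have p: "bij_betw p I {..<card I}" unfolding p_def by (rule bij_betw_the_inv_into[OF bij])
  have nth: "xs ! p i = i" if "i \<in> I" for i
    unfolding p_def using bij that by (intro f_the_inv_into_f) (auto simp: bij_betw_def)
  have "p i < p k" if ik: "i \<in> I" "k \<in> I" "y k < y i" for i k
  proof (rule ccontr)
    assume "\<not> p i < p k"
    hence "p k \<le> p i" "p i < length xs" using p ik len by (auto simp: bij_betw_def)
    hence "map (\<lambda>i. - y i) xs ! p k \<le> map (\<lambda>i. - y i) xs ! p i"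
      using sorted_nth_mono[OF xs(3), of "p k" "p i"] by simp
    thus False using nth ik \<open>p k \<le> p i\<close> \<open>p i < length xs\<close> by auto
  qed
  thus ?thesis using p by blast
qed

text \<open>Dyadic blocks of ranks in the coordinates other than \<open>j0\<close> cut the points into slabs; inside
  each slab the points are ranked afresh along \<open>j0\<close>, so that a cell at level \<open>l\<close> has exactly
  \<open>2\<^sup>l\<close> points, whatever the joint position of the points.\<close>

lemma orthant_cells:
  fixes x :: "'i \<Rightarrow> real ^ 'd" and j0 :: 'd
  assumes I: "finite I" "card I < 2 ^ L"
  defines "K \<equiv> PiE (UNIV - {j0}) (\<lambda>_. {..<L})"
  obtains \<C> :: "('d \<Rightarrow> nat) \<Rightarrow> nat \<Rightarrow> 'i set set" where
    "\<And>\<kappa> l C. C \<in> \<C> \<kappa> l \<Longrightarrow> C \<subseteq> I \<and> card C = 2 ^ l"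
    "\<And>\<kappa> l. disjoint (\<C> \<kappa> l)"
    "\<And>a. \<exists>D. (\<forall>\<kappa>\<in>K. \<forall>l<L. D \<kappa> l \<in> insert {} (\<C> \<kappa> l)) \<and>
       (\<forall>i\<in>I. of_bool (\<forall>j. a $ j \<le> x i $ j) = (\<Sum>\<kappa>\<in>K. \<Sum>l<L. of_bool (i \<in> D \<kappa> l) :: real))"
proof -
  obtain p where p: "bij_betw p I {..<card I}" "\<And>i k. i \<in> I \<Longrightarrow> k \<in> I \<Longrightarrow> x k $ j0 < x i $ j0 \<Longrightarrow> p i < p k"
    using exists_decreasing_order[OF I(1), of "\<lambda>i. x i $ j0"] by blast
  have injp: "inj_on p I" using p by (simp add: bij_betw_def)
  \<comment> \<open>Tied points share this rank, so a slab may have any size. That is harmless: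
    sizes are controlled only along \<open>j0\<close>, where \<open>p\<close> is injective.\<close>
  define q where "q j i = card {k \<in> I. x i $ j < x k $ j}" for j i
  define slab where "slab \<kappa> b = {i \<in> I. \<forall>j. j \<noteq> j0 \<longrightarrow> q j i div 2 ^ \<kappa> j = b j}" for \<kappa> b :: "'d \<Rightarrow> nat"
  have slab: "slab \<kappa> b \<subseteq> I" "finite (slab \<kappa> b)" "inj_on p (slab \<kappa> b)" for \<kappa> b
    using I(1) injp unfolding slab_def by (auto intro: inj_on_subset)
  define cell where "cell l B c = {i \<in> B. rank_in p B i div 2 ^ l = c}" for l B c
  \<comment> \<open>Only full cells are kept. The incomplete last block of a slab never occurs in a
    decomposition, since the blocks used come from the digits of a number that is at most the size
    of the slab.\<close>
  define \<C> where "\<C> \<kappa> l = {C. card C = 2 ^ l \<and> (\<exists>b c. C = cell l (slab \<kappa> b) c)}" for \<kappa> l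
  have 1: "C \<subseteq> I \<and> card C = 2 ^ l" if "C \<in> \<C> \<kappa> l" for \<kappa> l C
    using that slab unfolding \<C>_def cell_def by blast
  have 2: "disjoint (\<C> \<kappa> l)" for \<kappa> l
  proof (rule disjointI)
    fix C C' assume CC: "C \<in> \<C> \<kappa> l" "C' \<in> \<C> \<kappa> l" "C \<noteq> C'"
    obtain b c where C: "C = cell l (slab \<kappa> b) c" using CC(1) unfolding \<C>_def by blast
    obtain b' c' where C': "C' = cell l (slab \<kappa> b') c'" using CC(2) unfolding \<C>_def by blast
    show "C \<inter> C' = {}"
    proof (rule ccontr)
      assume "C \<inter> C' \<noteq> {}"
      then obtain i where i: "i \<in> C" "i \<in> C'" by blast
      hence "slab \<kappa> b = slab \<kappa> b'" unfolding C C' cell_def slab_def by auto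
      moreover from this have "c = c'" using i unfolding C C' cell_def by auto
      ultimately show False using CC(3) C C' by simp
    qed
  qed
  have 3: "\<exists>D. (\<forall>\<kappa>\<in>K. \<forall>l<L. D \<kappa> l \<in> insert {} (\<C> \<kappa> l)) \<and>
       (\<forall>i\<in>I. of_bool (\<forall>j. a $ j \<le> x i $ j) = (\<Sum>\<kappa>\<in>K. \<Sum>l<L. of_bool (i \<in> D \<kappa> l) :: real))" for a
  proof -
    define t where "t j = card {k \<in> I. a $ j \<le> x k $ j}" for j
    have tL: "t j < 2 ^ L" for j
    proof -
      have "t j \<le> card I" unfolding t_def using I(1) by (intro card_mono) auto
      thus ?thesis using I(2) by simp
    qed
    have q_iff: "a $ j \<le> x i $ j \<longleftrightarrow> q j i < t j" if "i \<in> I" for i j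
    proof
      assume "a $ j \<le> x i $ j"
      thus "q j i < t j" unfolding q_def t_def using I(1) that by (intro psubset_card_mono) auto
    next
      assume *: "q j i < t j"
      show "a $ j \<le> x i $ j"
      proof (rule ccontr)
        assume "\<not> a $ j \<le> x i $ j"
        hence "t j \<le> q j i" unfolding q_def t_def using I(1) by (intro card_mono) auto
        thus False using * by simp
      qed
    qed
    \<comment> \<open>The subtraction is never truncated where it matters, because
      \<open>odds\<close> asks for an odd and hence positive quotient.\<close>
    define b where "b \<kappa> j = t j div 2 ^ \<kappa> j - 1" for \<kappa> :: "'d \<Rightarrow> nat" and j
    define odds where "odds \<kappa> \<longleftrightarrow> (\<forall>j. j \<noteq> j0 \<longrightarrow> odd (t j div 2 ^ \<kappa> j))" for \<kappa> :: "'d \<Rightarrow> nat"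
    define B where "B \<kappa> = slab \<kappa> (b \<kappa>)" for \<kappa>
    define T where "T \<kappa> = card {i \<in> B \<kappa>. a $ j0 \<le> x i $ j0}" for \<kappa>
    define D where "D \<kappa> l = (if odds \<kappa> \<and> odd (T \<kappa> div 2 ^ l) then cell l (B \<kappa>) (T \<kappa> div 2 ^ l - 1) else {})" for \<kappa> l
    have TB: "T \<kappa> \<le> card (B \<kappa>)" for \<kappa>
      unfolding T_def B_def using slab by (intro card_mono) auto
    have "D \<kappa> l \<in> insert {} (\<C> \<kappa> l)" for \<kappa> l
    proof (cases "odds \<kappa> \<and> odd (T \<kappa> div 2 ^ l)")
      case True
      define c where "c = T \<kappa> div 2 ^ l - 1"
      have "T \<kappa> div 2 ^ l = Suc c" using True unfolding c_def by (metis Suc_pred' odd_pos)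
      moreover have "T \<kappa> div 2 ^ l * 2 ^ l \<le> T \<kappa>" by simp
      ultimately have c: "(c + 1) * 2 ^ l \<le> card (B \<kappa>)" using TB[of \<kappa>] by simp
      have bij: "bij_betw (rank_in p (B \<kappa>)) (B \<kappa>) {..<card (B \<kappa>)}"
        unfolding B_def by (rule bij_betw_rank_in) (use slab in auto)
      have "rank_in p (B \<kappa>) ` cell l (B \<kappa>) c = {m \<in> {..<card (B \<kappa>)}. m div 2 ^ l = c}"
        unfolding cell_def using bij unfolding bij_betw_def by auto
      also have "\<dots> = {c * 2 ^ l..<c * 2 ^ l + 2 ^ l}"
      proof (intro set_eqI iffI)
        fix m assume "m \<in> {m \<in> {..<card (B \<kappa>)}. m div 2 ^ l = c}"
        hence "c * 2 ^ l + m mod 2 ^ l = m" using div_mult_mod_eq[of m "2 ^ l"] by simp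
        moreover have "m mod 2 ^ l < 2 ^ l" by simp
        ultimately show "m \<in> {c * 2 ^ l..<c * 2 ^ l + 2 ^ l}" unfolding atLeastLessThan_iff by linarith
      next
        fix m assume m: "m \<in> {c * 2 ^ l..<c * 2 ^ l + 2 ^ l}"
        hence "m div 2 ^ l = c" by (intro div_nat_eqI) (auto simp: algebra_simps)
        thus "m \<in> {m \<in> {..<card (B \<kappa>)}. m div 2 ^ l = c}" using m c by (auto simp: algebra_simps)
      qed
      finally have "card (rank_in p (B \<kappa>) ` cell l (B \<kappa>) c) = 2 ^ l" by simp
      moreover have "inj_on (rank_in p (B \<kappa>)) (cell l (B \<kappa>) c)"
        using bij unfolding bij_betw_def cell_def by (auto intro: inj_on_subset)
      ultimately have "card (cell l (B \<kappa>) c) = 2 ^ l" by (simp add: card_image)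
      thus ?thesis using True unfolding D_def \<C>_def c_def B_def by auto
    next
      case False
      thus ?thesis unfolding D_def by (simp only: if_False) simp
    qed
    moreover have "of_bool (\<forall>j. a $ j \<le> x i $ j) = (\<Sum>\<kappa>\<in>K. \<Sum>l<L. of_bool (i \<in> D \<kappa> l) :: real)" if i: "i \<in> I" for i
    proof -
      have "(\<forall>j. a $ j \<le> x i $ j) \<longleftrightarrow> (\<forall>j\<in>UNIV - {j0}. q j i < t j) \<and> a $ j0 \<le> x i $ j0"
        using q_iff[OF i] by (metis DiffI UNIV_I singletonD)
      hence "of_bool (\<forall>j. a $ j \<le> x i $ j) = (\<Prod>j\<in>UNIV - {j0}. of_bool (q j i < t j)) * (of_bool (a $ j0 \<le> x i $ j0) :: real)"
        by (auto simp: prod_zero_iff intro!: prod.neutral)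
      \<comment> \<open>Each of the \<open>d - 1\<close> conditions is decomposed along the digits
        of \<open>t j\<close>. Multiplying out leaves one slab for each \<open>\<kappa>\<close>,
        hence the count \<open>L ^ (d - 1)\<close>.\<close>
      also have "(\<Prod>j\<in>UNIV - {j0}. of_bool (q j i < t j) :: real)
        = (\<Prod>j\<in>UNIV - {j0}. \<Sum>k\<in>{..<L}. of_bool (odd (t j div 2 ^ k) \<and> q j i div 2 ^ k = t j div 2 ^ k - 1))"
        by (intro prod.cong refl prefix_dyadic_decomp tL)
      also have "\<dots> = (\<Sum>\<kappa>\<in>K. \<Prod>j\<in>UNIV - {j0}. of_bool (odd (t j div 2 ^ \<kappa> j) \<and> q j i div 2 ^ \<kappa> j = t j div 2 ^ \<kappa> j - 1))"
        unfolding K_def by (rule prod_sum_PiE) auto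
      also have "\<dots> = (\<Sum>\<kappa>\<in>K. of_bool (odds \<kappa> \<and> i \<in> B \<kappa>))"
      proof (rule sum.cong[OF refl])
        fix \<kappa>
        have "odds \<kappa> \<and> i \<in> B \<kappa> \<longleftrightarrow> (\<forall>j\<in>UNIV - {j0}. odd (t j div 2 ^ \<kappa> j) \<and> q j i div 2 ^ \<kappa> j = t j div 2 ^ \<kappa> j - 1)"
          using i unfolding odds_def B_def slab_def b_def by auto
        thus "(\<Prod>j\<in>UNIV - {j0}. of_bool (odd (t j div 2 ^ \<kappa> j) \<and> q j i div 2 ^ \<kappa> j = t j div 2 ^ \<kappa> j - 1) :: real)
            = of_bool (odds \<kappa> \<and> i \<in> B \<kappa>)"
          by (auto simp: prod_zero_iff intro!: prod.neutral)
      qed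
      also have "\<dots> * of_bool (a $ j0 \<le> x i $ j0) = (\<Sum>\<kappa>\<in>K. \<Sum>l<L. of_bool (i \<in> D \<kappa> l) :: real)"
        unfolding sum_distrib_right
      proof (rule sum.cong[OF refl])
        fix \<kappa>
        show "of_bool (odds \<kappa> \<and> i \<in> B \<kappa>) * of_bool (a $ j0 \<le> x i $ j0) = (\<Sum>l<L. of_bool (i \<in> D \<kappa> l) :: real)"
        proof (cases "odds \<kappa> \<and> i \<in> B \<kappa>")
          case True
          have "rank_in p (B \<kappa>) i < T \<kappa> \<longleftrightarrow> i \<in> {i \<in> B \<kappa>. a $ j0 \<le> x i $ j0}"
            unfolding T_def
          proof (rule rank_in_less_iff)
            fix i k assume *: "i \<in> B \<kappa>" "k \<in> {i \<in> B \<kappa>. a $ j0 \<le> x i $ j0}" "p i < p k"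
            hence "i \<in> I" "k \<in> I" using slab unfolding B_def by auto
            hence "\<not> x i $ j0 < x k $ j0" using p(2)[of k i] *(3) by auto
            thus "i \<in> {i \<in> B \<kappa>. a $ j0 \<le> x i $ j0}" using * by auto
          qed (use True slab in \<open>auto simp: B_def\<close>)
          hence "a $ j0 \<le> x i $ j0 \<longleftrightarrow> rank_in p (B \<kappa>) i < T \<kappa>" using True by simp
          moreover have "T \<kappa> < 2 ^ L"
          proof -
            have "card (B \<kappa>) \<le> card I" unfolding B_def using I(1) slab by (intro card_mono) auto
            thus ?thesis using TB[of \<kappa>] I(2) by simp
          qed
          moreover have "i \<in> D \<kappa> l \<longleftrightarrow> odd (T \<kappa> div 2 ^ l) \<and> rank_in p (B \<kappa>) i div 2 ^ l = T \<kappa> div 2 ^ l - 1" for l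
            using True by (auto simp: D_def cell_def)
          ultimately show ?thesis
            using True prefix_dyadic_decomp[of "T \<kappa>" L "rank_in p (B \<kappa>) i"] by simp
        qed (auto simp: D_def cell_def)
      qed
      finally show ?thesis .
    qed
    ultimately show ?thesis by (intro exI[of _ D]) auto
  qed
  show thesis using that[of \<C>] 1 2 3 by blast
qed

section \<open>Projections in the functions on a finite set\<close>

lemma sum_lincomb_mult:
  fixes c :: "('i \<Rightarrow> real) \<Rightarrow> real"
  shows "(\<Sum>k\<in>I. (\<Sum>e\<in>E. c e * e k) * h k) = (\<Sum>e\<in>E. c e * (\<Sum>k\<in>I. h k * e k))"
proof -
  have "(\<Sum>k\<in>I. (\<Sum>e\<in>E. c e * e k) * h k) = (\<Sum>k\<in>I. \<Sum>e\<in>E. c e * (h k * e k))"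
    unfolding sum_distrib_right by (intro sum.cong) auto
  also have "\<dots> = (\<Sum>e\<in>E. \<Sum>k\<in>I. c e * (h k * e k))" by (rule sum.swap)
  finally show ?thesis by (simp add: sum_distrib_left)
qed

text \<open>Gram-Schmidt, with functions compared on \<open>I\<close> only. The bound on
  \<open>card E\<close> matters most: it is the dimension that will bound the mean squared norm of
  the projected signs.\<close>

lemma finite_orthonormal_span:
  fixes F :: "('i \<Rightarrow> real) set"
  assumes "finite I" "finite F"
  shows "\<exists>E. finite E \<and> card E \<le> card F \<and>
    (\<forall>e\<in>E. \<forall>e'\<in>E. (\<Sum>i\<in>I. e i * e' i) = of_bool (e = e')) \<and>
    (\<forall>f\<in>F. \<forall>i\<in>I. f i = (\<Sum>e\<in>E. (\<Sum>k\<in>I. f k * e k) * e i))"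
  using assms(2)
proof (induction F rule: finite_induct)
  case empty
  show ?case by (intro exI[of _ "{}"]) auto
next
  case (insert f F)
  then obtain E where E: "finite E" "card E \<le> card F"
    and on: "\<And>e e'. e \<in> E \<Longrightarrow> e' \<in> E \<Longrightarrow> (\<Sum>i\<in>I. e i * e' i) = of_bool (e = e')"
    and sp: "\<And>f i. f \<in> F \<Longrightarrow> i \<in> I \<Longrightarrow> f i = (\<Sum>e\<in>E. (\<Sum>k\<in>I. f k * e k) * e i)" by blast
  define g where "g i = f i - (\<Sum>e\<in>E. (\<Sum>k\<in>I. f k * e k) * e i)" for i
  have g: "(\<Sum>i\<in>I. g i * e i) = 0" if "e \<in> E" for e
  proof -
    have "(\<Sum>i\<in>I. (\<Sum>e'\<in>E. (\<Sum>k\<in>I. f k * e' k) * e' i) * e i) = (\<Sum>e'\<in>E. (\<Sum>k\<in>I. f k * e' k) * (\<Sum>i\<in>I. e i * e' i))"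
      by (rule sum_lincomb_mult)
    also have "\<dots> = (\<Sum>e'\<in>E. if e' = e then (\<Sum>k\<in>I. f k * e' k) else 0)"
      by (intro sum.cong) (auto simp: on[OF that])
    also have "\<dots> = (\<Sum>k\<in>I. f k * e k)" using that E(1) by simp
    finally show ?thesis by (simp add: g_def left_diff_distrib sum_subtractf)
  qed
  show ?case
  proof (cases "\<forall>i\<in>I. g i = 0")
    case True
    have "f i = (\<Sum>e\<in>E. (\<Sum>k\<in>I. f k * e k) * e i)" if "i \<in> I" for i
      using True that by (simp add: g_def)
    hence "h i = (\<Sum>e\<in>E. (\<Sum>k\<in>I. h k * e k) * e i)" if "h \<in> insert f F" "i \<in> I" for h i
      using that(1) sp[OF _ that(2), of h] that(2) by (elim insertE) blast+
    moreover have "card E \<le> card (insert f F)" using E(2) insert.hyps by simp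
    ultimately show ?thesis using E(1) on
      by (intro exI[of _ E] conjI ballI) blast+
  next
    case False
    define N where "N = (\<Sum>i\<in>I. (g i)\<^sup>2)"
    have "N > 0" unfolding N_def
    proof -
      obtain i where i: "i \<in> I" "g i \<noteq> 0" using False by blast
      thus "0 < (\<Sum>i\<in>I. (g i)\<^sup>2)" by (intro sum_pos2[OF assms(1), of i]) auto
    qed
    define e0 where "e0 i = g i / sqrt N" for i
    have e0E: "(\<Sum>i\<in>I. e0 i * e i) = 0" if "e \<in> E" for e
      using g[OF that] unfolding e0_def by (simp flip: sum_divide_distrib)
    have e00: "(\<Sum>i\<in>I. e0 i * e0 i) = 1"
    proof -
      have "(\<Sum>i\<in>I. e0 i * e0 i) = (\<Sum>i\<in>I. (g i)\<^sup>2 / N)"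
        unfolding e0_def using \<open>N > 0\<close> by (intro sum.cong) (auto simp: power2_eq_square)
      thus ?thesis using \<open>N > 0\<close> by (simp add: N_def flip: sum_divide_distrib)
    qed
    have notin: "e0 \<notin> E" using e0E[of e0] e00 by auto
    have fe0: "(\<Sum>k\<in>I. f k * e0 k) = sqrt N"
    proof -
      have "(\<Sum>k\<in>I. f k * e0 k) = (\<Sum>k\<in>I. g k * e0 k) + (\<Sum>k\<in>I. (\<Sum>e\<in>E. (\<Sum>k\<in>I. f k * e k) * e k) * e0 k)"
        unfolding g_def by (simp add: left_diff_distrib sum_subtractf)
      also have "(\<Sum>k\<in>I. (\<Sum>e\<in>E. (\<Sum>k\<in>I. f k * e k) * e k) * e0 k) = (\<Sum>e\<in>E. (\<Sum>k\<in>I. f k * e k) * (\<Sum>i\<in>I. e0 i * e i))"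
        by (rule sum_lincomb_mult)
      also have "\<dots> = 0" by (simp add: e0E)
      also have "(\<Sum>k\<in>I. g k * e0 k) = sqrt N * (\<Sum>k\<in>I. e0 k * e0 k)"
      proof -
        have "g k = sqrt N * e0 k" for k unfolding e0_def using \<open>N > 0\<close> by simp
        thus ?thesis unfolding sum_distrib_left by (simp add: mult.assoc)
      qed
      finally show ?thesis by (simp add: e00)
    qed
    have spf: "f i = (\<Sum>e\<in>insert e0 E. (\<Sum>k\<in>I. f k * e k) * e i)" if "i \<in> I" for i
      using notin E(1) \<open>N > 0\<close> by (simp add: fe0) (simp add: e0_def g_def)
    have spF: "h i = (\<Sum>e\<in>insert e0 E. (\<Sum>k\<in>I. h k * e k) * e i)" if "h \<in> F" "i \<in> I" for h i
    proof -
      have "(\<Sum>k\<in>I. h k * e0 k) = (\<Sum>k\<in>I. (\<Sum>e\<in>E. (\<Sum>k\<in>I. h k * e k) * e k) * e0 k)"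
        using sp[OF that(1)] by (intro sum.cong) auto
      also have "\<dots> = (\<Sum>e\<in>E. (\<Sum>k\<in>I. h k * e k) * (\<Sum>i\<in>I. e0 i * e i))"
        by (rule sum_lincomb_mult)
      finally have "(\<Sum>k\<in>I. h k * e0 k) = 0" by (simp add: e0E)
      thus ?thesis using sp[OF that] notin E(1) by simp
    qed
    have onE: "(\<Sum>i\<in>I. e i * e' i) = of_bool (e = e')" if "e \<in> insert e0 E" "e' \<in> insert e0 E" for e e'
    proof -
      have "(\<Sum>i\<in>I. e i * e0 i) = 0" if "e \<in> E" for e
        using e0E[OF that] by (simp add: mult.commute)
      thus ?thesis using that on e0E e00 notin by auto
    qed
    have "card (insert e0 E) \<le> card (insert f F)"
      using notin E insert.hyps by simp
    moreover have "finite (insert e0 E)" using E(1) by simp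
    moreover have "h i = (\<Sum>e\<in>insert e0 E. (\<Sum>k\<in>I. h k * e k) * e i)" if "h \<in> insert f F" "i \<in> I" for h i
      using that(1) spf[OF that(2)] spF[OF _ that(2), of h] by (elim insertE) blast+
    ultimately show ?thesis using onE
      by (intro exI[of _ "insert e0 E"] conjI ballI) blast+
  qed
qed

definition proj_on :: "'i set \<Rightarrow> ('i \<Rightarrow> real) set \<Rightarrow> ('i \<Rightarrow> real) \<Rightarrow> 'i \<Rightarrow> real" where
  "proj_on I E f i = (\<Sum>e\<in>E. (\<Sum>k\<in>I. f k * e k) * e i)"

text \<open>The right-hand side is symmetric in \<open>f\<close> and \<open>h\<close>, so the
  projection is self-adjoint and can be moved from the signs to the cells.\<close>

lemma sum_proj_on_mult:
  "(\<Sum>i\<in>I. proj_on I E f i * h i) = (\<Sum>e\<in>E. (\<Sum>k\<in>I. f k * e k) * (\<Sum>k\<in>I. h k * e k))"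
  unfolding proj_on_def by (rule sum_lincomb_mult)

text \<open>Parseval and Pythagoras: the projection has the same inner product with \<open>f\<close>
  as with itself, so subtracting it can only shorten \<open>f\<close>.\<close>

lemma
  fixes E :: "('i \<Rightarrow> real) set"
  assumes "finite E" "\<And>e e'. e \<in> E \<Longrightarrow> e' \<in> E \<Longrightarrow> (\<Sum>i\<in>I. e i * e' i) = of_bool (e = e')"
  shows sum_proj_on_sq: "(\<Sum>i\<in>I. (proj_on I E f i)\<^sup>2) = (\<Sum>e\<in>E. (\<Sum>k\<in>I. f k * e k)\<^sup>2)"
    and sum_diff_proj_on_sq_le: "(\<Sum>i\<in>I. (f i - proj_on I E f i)\<^sup>2) \<le> (\<Sum>i\<in>I. (f i)\<^sup>2)"
proof -
  have "(\<Sum>k\<in>I. proj_on I E f k * e k) = (\<Sum>k\<in>I. f k * e k)" if "e \<in> E" for e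
  proof -
    have "(\<Sum>k\<in>I. proj_on I E f k * e k) = (\<Sum>e'\<in>E. (\<Sum>k\<in>I. f k * e' k) * of_bool (e = e'))"
      unfolding sum_proj_on_mult by (intro sum.cong) (auto simp: assms(2)[OF that])
    also have "\<dots> = (\<Sum>e'\<in>E. if e' = e then (\<Sum>k\<in>I. f k * e' k) else 0)"
      by (intro sum.cong) auto
    finally show ?thesis using that assms(1) by simp
  qed
  hence pp: "(\<Sum>i\<in>I. proj_on I E f i * proj_on I E f i) = (\<Sum>e\<in>E. (\<Sum>k\<in>I. f k * e k)\<^sup>2)"
    unfolding sum_proj_on_mult by (simp add: power2_eq_square)
  thus *: "(\<Sum>i\<in>I. (proj_on I E f i)\<^sup>2) = (\<Sum>e\<in>E. (\<Sum>k\<in>I. f k * e k)\<^sup>2)" by (simp add: power2_eq_square)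
  have pf: "(\<Sum>i\<in>I. proj_on I E f i * f i) = (\<Sum>e\<in>E. (\<Sum>k\<in>I. f k * e k)\<^sup>2)"
    unfolding sum_proj_on_mult by (simp add: power2_eq_square)
  have "(\<Sum>i\<in>I. (f i - proj_on I E f i)\<^sup>2) = (\<Sum>i\<in>I. (f i)\<^sup>2) + (\<Sum>i\<in>I. (proj_on I E f i)\<^sup>2) - 2 * (\<Sum>i\<in>I. proj_on I E f i * f i)"
    unfolding sum_distrib_left sum.distrib[symmetric] sum_subtractf[symmetric]
    by (intro sum.cong) (auto simp: power2_diff)
  also have "\<dots> \<le> (\<Sum>i\<in>I. (f i)\<^sup>2)" unfolding * pf by (simp add: sum_nonneg)
  finally show "(\<Sum>i\<in>I. (f i - proj_on I E f i)\<^sup>2) \<le> (\<Sum>i\<in>I. (f i)\<^sup>2)" .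
qed

lemma card_disjoint_blocks:
  assumes "finite I" "disjoint \<C>" "\<And>C. C \<in> \<C> \<Longrightarrow> C \<subseteq> I \<and> card C = b"
  shows "card \<C> * b \<le> card I"
proof -
  have "card (\<Union>\<C>) = (\<Sum>C\<in>\<C>. card C)"
  proof (rule card_Union_disjoint)
    show "pairwise disjnt \<C>" using assms(2) by (auto simp: disjoint_def pairwise_def disjnt_def)
    show "finite C" if "C \<in> \<C>" for C using assms(1,3) that finite_subset by blast
  qed
  also have "\<dots> = card \<C> * b" using assms(3) by simp
  finally show ?thesis using assms by (metis Union_least card_mono)
qed

lemma sum_geometric_half_le: "(\<Sum>l=l0..<L. c / 2 ^ l) \<le> 2 * c / 2 ^ l0" if "0 \<le> c" for c :: real
proof (cases "l0 \<le> L")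
  case True
  have "(\<Sum>l=l0..<L. c / 2 ^ l) = 2 * c / 2 ^ l0 - 2 * c / 2 ^ L"
    using True
  proof (induction L rule: dec_induct)
    case (step n)
    thus ?case by (simp only: sum.atLeastLessThan_Suc) simp
  qed simp
  thus ?thesis using that by simp
qed (use that in auto)

text \<open>The remainder \<open>v\<close> annihilates every cell of level at least
  \<open>l0\<close>, so an orthant meets it in at most \<open>W\<close> small cells per level. The
  maximum over the cells of a level costs one square root of a logarithm, and the levels below
  \<open>l0\<close> sum geometrically.\<close>

lemma sign_split_cells:
  fixes x :: "'i \<Rightarrow> real ^ 'd"
  assumes I: "finite I" "card I < 2 ^ L"
    and w: "\<And>i. i \<in> I \<Longrightarrow> \<bar>w i\<bar> \<le> 1"
  defines "W \<equiv> real (L ^ (CARD('d) - 1))"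
  shows "sign_split I x w (sqrt (14 * W * card I / 2 ^ l0))
    (6 * W * sqrt (2 ^ l0) * sqrt (ln (2 * (2 + W * card I))))"
proof -
  define j0 :: 'd where "j0 = undefined"
  define K where "K = PiE (UNIV - {j0}) (\<lambda>_. {..<L})"
  have K: "finite K" "real (card K) = W"
    unfolding K_def W_def by (auto simp: card_PiE intro!: finite_PiE)
  have "\<exists>\<C> :: ('d \<Rightarrow> nat) \<Rightarrow> nat \<Rightarrow> 'i set set.
      (\<forall>\<kappa> l. \<forall>C\<in>\<C> \<kappa> l. C \<subseteq> I \<and> card C = 2 ^ l) \<and> (\<forall>\<kappa> l. disjoint (\<C> \<kappa> l)) \<and>
      (\<forall>a. \<exists>D. (\<forall>\<kappa>\<in>K. \<forall>l<L. D \<kappa> l \<in> insert {} (\<C> \<kappa> l)) \<and>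
        (\<forall>i\<in>I. of_bool (\<forall>j. a $ j \<le> x i $ j) = (\<Sum>\<kappa>\<in>K. \<Sum>l<L. of_bool (i \<in> D \<kappa> l) :: real)))"
  proof (rule orthant_cells[OF I, of j0 x, folded K_def])
    fix \<C> :: "('d \<Rightarrow> nat) \<Rightarrow> nat \<Rightarrow> 'i set set"
    assume "\<And>\<kappa> l C. C \<in> \<C> \<kappa> l \<Longrightarrow> C \<subseteq> I \<and> card C = 2 ^ l" "\<And>\<kappa> l. disjoint (\<C> \<kappa> l)"
      "\<And>a. \<exists>D. (\<forall>\<kappa>\<in>K. \<forall>l<L. D \<kappa> l \<in> insert {} (\<C> \<kappa> l)) \<and>
        (\<forall>i\<in>I. of_bool (\<forall>j. a $ j \<le> x i $ j) = (\<Sum>\<kappa>\<in>K. \<Sum>l<L. of_bool (i \<in> D \<kappa> l) :: real))"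
    thus ?thesis by (intro exI[of _ \<C>]) simp
  qed
  then obtain \<C> :: "('d \<Rightarrow> nat) \<Rightarrow> nat \<Rightarrow> 'i set set" where
    \<C>: "(\<forall>\<kappa> l. \<forall>C\<in>\<C> \<kappa> l. C \<subseteq> I \<and> card C = 2 ^ l) \<and> (\<forall>\<kappa> l. disjoint (\<C> \<kappa> l)) \<and>
      (\<forall>a. \<exists>D. (\<forall>\<kappa>\<in>K. \<forall>l<L. D \<kappa> l \<in> insert {} (\<C> \<kappa> l)) \<and>
        (\<forall>i\<in>I. of_bool (\<forall>j. a $ j \<le> x i $ j) = (\<Sum>\<kappa>\<in>K. \<Sum>l<L. of_bool (i \<in> D \<kappa> l) :: real)))"
    by (rule exE)
  have C: "C \<subseteq> I \<and> card C = 2 ^ l" if "C \<in> \<C> \<kappa> l" for \<kappa> l C using \<C> that by meson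
  have disj: "disjoint (\<C> \<kappa> l)" for \<kappa> l using \<C> by meson
  note cover = \<C>[THEN conjunct2, THEN conjunct2, rule_format]
  have finC: "finite (\<C> \<kappa> l)" for \<kappa> l
    by (rule finite_subset[of _ "Pow I"]) (use C I in auto)
  have cardC: "real (card (\<C> \<kappa> l)) \<le> card I / 2 ^ l" for \<kappa> l
  proof -
    have "card (\<C> \<kappa> l) * 2 ^ l \<le> card I" using card_disjoint_blocks[OF I(1) disj C] .
    hence "real (card (\<C> \<kappa> l) * 2 ^ l) \<le> real (card I)" by (rule of_nat_mono)
    thus ?thesis by (simp add: field_simps)
  qed
  \<comment> \<open>A level \<open>l\<close> has at most \<open>W * card I / 2 ^ l\<close> cells, so
    level \<open>l0\<close> dominates the count.\<close>
  define F where "F = (\<lambda>C i. of_bool (i \<in> C) :: real) ` (\<Union>\<kappa>\<in>K. \<Union>l\<in>{l0..<L}. \<C> \<kappa> l)"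
  have finF: "finite F" unfolding F_def using K finC by auto
  have cardF: "real (card F) \<le> W * (2 * card I / 2 ^ l0)"
  proof -
    have "card F \<le> card (\<Union>\<kappa>\<in>K. \<Union>l\<in>{l0..<L}. \<C> \<kappa> l)"
      unfolding F_def using K finC by (intro card_image_le) auto
    also have "\<dots> \<le> (\<Sum>\<kappa>\<in>K. card (\<Union>l\<in>{l0..<L}. \<C> \<kappa> l))" by (rule card_UN_le[OF K(1)])
    also have "\<dots> \<le> (\<Sum>\<kappa>\<in>K. \<Sum>l\<in>{l0..<L}. card (\<C> \<kappa> l))" by (intro sum_mono card_UN_le) auto
    finally have "real (card F) \<le> real (\<Sum>\<kappa>\<in>K. \<Sum>l\<in>{l0..<L}. card (\<C> \<kappa> l))" by (rule of_nat_mono)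
    also have "\<dots> \<le> (\<Sum>\<kappa>\<in>K. \<Sum>l\<in>{l0..<L}. card I / 2 ^ l)"
      unfolding of_nat_sum by (intro sum_mono cardC)
    also have "\<dots> \<le> (\<Sum>\<kappa>\<in>K. 2 * card I / 2 ^ l0)"
      using sum_geometric_half_le[of "real (card I)" l0 L] by (intro sum_mono) simp
    finally show ?thesis using K by simp
  qed
  obtain E where E: "finite E" "card E \<le> card F"
    and on: "\<And>e e'. e \<in> E \<Longrightarrow> e' \<in> E \<Longrightarrow> (\<Sum>i\<in>I. e i * e' i) = of_bool (e = e')"
    and sp: "\<And>f i. f \<in> F \<Longrightarrow> i \<in> I \<Longrightarrow> f i = proj_on I E f i"
    using finite_orthonormal_span[OF I(1) finF] unfolding proj_on_def by blast
  define u where "u \<epsilon> = proj_on I E (\<lambda>i. \<epsilon> i * w i)" for \<epsilon>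
  define v where "v \<epsilon> i = \<epsilon> i * w i - u \<epsilon> i" for \<epsilon> i
  \<comment> \<open>By self-adjointness, pairing \<open>v\<close> with a cell is a Rademacher sum
    with these coefficients. They vanish on large cells and are no longer than the indicator on
    small ones.\<close>
  define g where "g C i = w i * (of_bool (i \<in> C) - proj_on I E (\<lambda>i. of_bool (i \<in> C)) i)" for C :: "'i set" and i
  define S where "S l = insert {} (\<Union>\<kappa>\<in>K. \<C> \<kappa> l)" for l
  define mx where "mx \<epsilon> l = (MAX C\<in>S l. \<bar>\<Sum>i\<in>I. \<epsilon> i * g C i\<bar>)" for \<epsilon> l
  define M where "M \<epsilon> = W * (\<Sum>l<l0. mx \<epsilon> l)" for \<epsilon>
  have finS: "finite (S l)" for l unfolding S_def using K finC by auto
  have cardS: "real (card (S l)) \<le> 2 + W * card I" for l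
  proof -
    have "card (S l) \<le> Suc (card (\<Union>\<kappa>\<in>K. \<C> \<kappa> l))" unfolding S_def by (rule card_insert_le_m1) auto
    also have "card (\<Union>\<kappa>\<in>K. \<C> \<kappa> l) \<le> (\<Sum>\<kappa>\<in>K. card (\<C> \<kappa> l))" by (rule card_UN_le[OF K(1)])
    finally have "real (card (S l)) \<le> real (Suc (\<Sum>\<kappa>\<in>K. card (\<C> \<kappa> l)))" by (rule of_nat_mono) simp
    also have "\<dots> = 1 + (\<Sum>\<kappa>\<in>K. real (card (\<C> \<kappa> l)))" by simp
    also have "\<dots> \<le> 1 + (\<Sum>\<kappa>\<in>K. real (card I))"
    proof (intro add_left_mono sum_mono)
      fix \<kappa>
      have "real (card I) / 2 ^ l \<le> card I / 1" by (intro divide_left_mono) auto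
      thus "real (card (\<C> \<kappa> l)) \<le> card I" using cardC[of \<kappa> l] by simp
    qed
    finally show ?thesis using K by simp
  qed
  have vC: "(\<Sum>i\<in>I. of_bool (i \<in> C) * v \<epsilon> i) = (\<Sum>i\<in>I. \<epsilon> i * g C i)" for C \<epsilon>
  proof -
    have "(\<Sum>i\<in>I. u \<epsilon> i * of_bool (i \<in> C)) = (\<Sum>i\<in>I. proj_on I E (\<lambda>i. of_bool (i \<in> C)) i * (\<epsilon> i * w i))"
      unfolding u_def sum_proj_on_mult by (intro sum.cong) auto
    thus ?thesis unfolding v_def g_def
      by (simp add: right_diff_distrib sum_subtractf algebra_simps)
  qed
  have g0: "g C i = 0" if "C \<in> \<C> \<kappa> l" "\<kappa> \<in> K" "l0 \<le> l" "l < L" "i \<in> I" for C \<kappa> l i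
  proof -
    have "(\<lambda>i. of_bool (i \<in> C)) \<in> F" unfolding F_def using that by force
    from sp[OF this that(5)] show ?thesis unfolding g_def by simp
  qed
  have g_sq: "(\<Sum>i\<in>I. (g C i)\<^sup>2) \<le> (sqrt 2 ^ l)\<^sup>2" if "C \<in> S l" for C l
  proof -
    have "(\<Sum>i\<in>I. (g C i)\<^sup>2) \<le> (\<Sum>i\<in>I. (of_bool (i \<in> C) - proj_on I E (\<lambda>i. of_bool (i \<in> C)) i)\<^sup>2)"
    proof (rule sum_mono)
      fix i assume "i \<in> I"
      hence "(w i)\<^sup>2 \<le> 1" using w by (simp add: abs_square_le_1)
      thus "(g C i)\<^sup>2 \<le> (of_bool (i \<in> C) - proj_on I E (\<lambda>i. of_bool (i \<in> C)) i)\<^sup>2"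
        unfolding g_def power_mult_distrib by (intro mult_left_le_one_le) auto
    qed
    also have "\<dots> \<le> (\<Sum>i\<in>I. (of_bool (i \<in> C))\<^sup>2)" by (rule sum_diff_proj_on_sq_le[OF E(1) on])
    also have "\<dots> = real (card (I \<inter> C))" using I(1) by (simp add: of_bool_def if_distrib[of "\<lambda>x. x\<^sup>2"] sum.If_cases Int_def cong: if_cong)
    also have "\<dots> \<le> 2 ^ l"
    proof (cases "C = {}")
      case False
      hence "\<exists>\<kappa>. C \<in> \<C> \<kappa> l" using that unfolding S_def by auto
      then obtain \<kappa> where "C \<in> \<C> \<kappa> l" by blast
      thus ?thesis using C[of C \<kappa> l] by (simp add: Int_absorb1)
    qed simp
    finally show ?thesis by (simp flip: sqrt_2_power)
  qed
  have mx: "rad_mean I (\<lambda>\<epsilon>. mx \<epsilon> l) \<le> 2 * sqrt 2 ^ l * sqrt (ln (2 * (2 + W * card I)))" for l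
    unfolding mx_def using cardS g_sq finS I(1)
    by (intro rad_mean_Max_le) (auto simp: S_def W_def)
  have mx0: "0 \<le> mx \<epsilon> l" for \<epsilon> l
  proof -
    have "\<bar>\<Sum>i\<in>I. \<epsilon> i * g {} i\<bar> \<le> mx \<epsilon> l" unfolding mx_def using finS by (intro Max_ge) (auto simp: S_def)
    thus ?thesis by linarith
  qed
  have vM: "\<bar>\<Sum>i\<in>I. of_bool (\<forall>j. a $ j \<le> x i $ j) * v \<epsilon> i\<bar> \<le> M \<epsilon>" for \<epsilon> a
  proof -
    obtain D where D: "\<And>\<kappa> l. \<kappa> \<in> K \<Longrightarrow> l < L \<Longrightarrow> D \<kappa> l \<in> insert {} (\<C> \<kappa> l)"
      "\<And>i. i \<in> I \<Longrightarrow> of_bool (\<forall>j. a $ j \<le> x i $ j) = (\<Sum>\<kappa>\<in>K. \<Sum>l<L. of_bool (i \<in> D \<kappa> l) :: real)"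
      using cover[of a] by (elim exE conjE) blast
    have "(\<Sum>i\<in>I. of_bool (\<forall>j. a $ j \<le> x i $ j) * v \<epsilon> i) = (\<Sum>i\<in>I. \<Sum>\<kappa>\<in>K. \<Sum>l<L. of_bool (i \<in> D \<kappa> l) * v \<epsilon> i)"
      using D(2) by (intro sum.cong) (auto simp: sum_distrib_right)
    also have "\<dots> = (\<Sum>\<kappa>\<in>K. \<Sum>i\<in>I. \<Sum>l<L. of_bool (i \<in> D \<kappa> l) * v \<epsilon> i)" by (rule sum.swap)
    also have "\<dots> = (\<Sum>\<kappa>\<in>K. \<Sum>l<L. \<Sum>i\<in>I. of_bool (i \<in> D \<kappa> l) * v \<epsilon> i)"
      by (intro sum.cong refl sum.swap)
    also have "\<dots> = (\<Sum>\<kappa>\<in>K. \<Sum>l<L. \<Sum>i\<in>I. \<epsilon> i * g (D \<kappa> l) i)" by (simp only: vC)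
    finally have "\<bar>\<Sum>i\<in>I. of_bool (\<forall>j. a $ j \<le> x i $ j) * v \<epsilon> i\<bar> = \<bar>\<Sum>\<kappa>\<in>K. \<Sum>l<L. \<Sum>i\<in>I. \<epsilon> i * g (D \<kappa> l) i\<bar>" by simp
    also have "\<dots> \<le> (\<Sum>\<kappa>\<in>K. \<bar>\<Sum>l<L. \<Sum>i\<in>I. \<epsilon> i * g (D \<kappa> l) i\<bar>)" by (rule sum_abs)
    also have "\<dots> \<le> (\<Sum>\<kappa>\<in>K. \<Sum>l<L. \<bar>\<Sum>i\<in>I. \<epsilon> i * g (D \<kappa> l) i\<bar>)" by (intro sum_mono sum_abs)
    also have "\<dots> \<le> (\<Sum>\<kappa>\<in>K. \<Sum>l<L. if l \<in> {..<l0} then mx \<epsilon> l else 0)"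
    proof (intro sum_mono)
      fix \<kappa> l assume \<kappa>l: "\<kappa> \<in> K" "l \<in> {..<L}"
      show "\<bar>\<Sum>i\<in>I. \<epsilon> i * g (D \<kappa> l) i\<bar> \<le> (if l \<in> {..<l0} then mx \<epsilon> l else 0)"
      proof (cases "l < l0")
        case True
        have "D \<kappa> l \<in> S l" unfolding S_def using D(1)[of \<kappa> l] \<kappa>l by auto
        thus ?thesis using True finS unfolding mx_def by (auto intro!: Max_ge)
      next
        case False
        have "g (D \<kappa> l) i = 0" if "i \<in> I" for i
        proof (cases "D \<kappa> l = {}")
          case True
          thus ?thesis by (simp add: g_def proj_on_def)
        next
          case False
          thus ?thesis using D(1)[of \<kappa> l] \<kappa>l \<open>\<not> l < l0\<close> that by (intro g0[of _ \<kappa> l]) auto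
        qed
        thus ?thesis using False by simp
      qed
    qed
    also have "\<dots> \<le> (\<Sum>\<kappa>\<in>K. \<Sum>l<l0. mx \<epsilon> l)"
      using mx0 by (intro sum_mono) (auto simp: sum.If_cases intro!: sum_mono2)
    also have "\<dots> = M \<epsilon>" unfolding M_def using K by simp
    finally show ?thesis .
  qed
  have u_sq: "(\<Sum>i\<in>I. (u \<epsilon> i)\<^sup>2) = (\<Sum>e\<in>E. (\<Sum>i\<in>I. \<epsilon> i * w i * e i)\<^sup>2)" for \<epsilon>
    unfolding u_def by (rule sum_proj_on_sq[OF E(1) on])
  have "rad_mean I (\<lambda>\<epsilon>. \<Sum>i\<in>I. (u \<epsilon> i)\<^sup>2) \<le> 14 * W * card I / 2 ^ l0"
  proof -
    \<comment> \<open>By Parseval the mean squared norm of the projected signs is at most 7 times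
      the dimension.\<close>
    have "rad_mean I (\<lambda>\<epsilon>. \<Sum>i\<in>I. (u \<epsilon> i)\<^sup>2) = (\<Sum>e\<in>E. rad_mean I (\<lambda>\<epsilon>. (\<Sum>i\<in>I. \<epsilon> i * (w i * e i))\<^sup>2))"
      unfolding u_sq unfolding rad_mean_sum by (simp add: mult.assoc)
    also have "\<dots> \<le> (\<Sum>e\<in>E. 7 * 1\<^sup>2)"
    proof (intro sum_mono rad_mean_sq_le I)
      fix e assume "e \<in> E"
      have "(\<Sum>i\<in>I. (w i * e i)\<^sup>2) \<le> (\<Sum>i\<in>I. e i * e i)"
      proof (rule sum_mono)
        fix i assume "i \<in> I"
        hence "(w i)\<^sup>2 \<le> 1" using w by (simp add: abs_square_le_1)
        thus "(w i * e i)\<^sup>2 \<le> e i * e i"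
          unfolding power_mult_distrib power2_eq_square[of "e i"] by (intro mult_left_le_one_le) auto
      qed
      thus "(\<Sum>i\<in>I. (w i * e i)\<^sup>2) \<le> 1\<^sup>2" using on[OF \<open>e \<in> E\<close> \<open>e \<in> E\<close>] by simp
    qed auto
    also have "\<dots> \<le> 7 * (W * (2 * card I / 2 ^ l0))" using E(2) cardF by simp
    finally show ?thesis by simp
  qed
  hence u: "rad_mean I (\<lambda>\<epsilon>. L2_set (u \<epsilon>) I) \<le> sqrt (14 * W * card I / 2 ^ l0)"
    unfolding L2_set_def by (intro rad_mean_sqrt_le I) (auto simp: sum_nonneg)
  have "rad_mean I M \<le> W * (\<Sum>l<l0. 2 * sqrt 2 ^ l * sqrt (ln (2 * (2 + W * card I))))"
    unfolding M_def rad_mean_cmult rad_mean_sum by (intro mult_left_mono sum_mono mx) (simp add: W_def)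
  also have "\<dots> = W * (2 * (\<Sum>l<l0. sqrt 2 ^ l) * sqrt (ln (2 * (2 + W * card I))))"
    by (simp add: sum_distrib_left sum_distrib_right)
  also have "\<dots> \<le> W * (2 * (3 * sqrt 2 ^ l0) * sqrt (ln (2 * (2 + W * card I))))"
  proof -
    have "(\<Sum>l<l0. sqrt 2 ^ l) \<le> 3 * (sqrt 2 ^ l0 :: real)"
    proof -
      have "(\<Sum>l<l0. sqrt 2 ^ l) = (sqrt 2 ^ l0 - 1) / (sqrt 2 - 1 :: real)" by (rule geometric_sum) simp
      also have "\<dots> \<le> sqrt 2 ^ l0 / (1/3)" using inv_sqrt2_bounds(3) by (intro frac_le) auto
      finally show ?thesis by simp
    qed
    thus ?thesis by (intro mult_left_mono mult_right_mono) (auto simp: W_def)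
  qed
  finally have M: "rad_mean I M \<le> 6 * W * sqrt (2 ^ l0) * sqrt (ln (2 * (2 + W * card I)))"
    by (simp add: sqrt_2_power mult.assoc)
  show ?thesis unfolding sign_split_def
    by (intro exI[of _ u] exI[of _ v] exI[of _ M] conjI ballI allI u M vM) (simp add: v_def)
qed

lemma sign_split_mono: "sign_split I x w A B \<Longrightarrow> A \<le> A' \<Longrightarrow> B \<le> B' \<Longrightarrow> sign_split I x w A' B'"
  unfolding sign_split_def by (elim exE conjE, intro exI conjI) (assumption | rule order_trans)+

lemma dyadic_scale:
  fixes y :: real
  assumes "1 \<le> y"
  obtains l :: nat where "2 ^ l \<le> y" "y \<le> 2 * 2 ^ l"
proof -
  have "1 \<le> nat \<lfloor>y\<rfloor>" using assms by (simp add: le_nat_iff)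
  then obtain l where l: "2 ^ l \<le> nat \<lfloor>y\<rfloor>" "nat \<lfloor>y\<rfloor> < 2 ^ (l + 1)"
    using ex_power_ivl1[of 2 "nat \<lfloor>y\<rfloor>"] by auto
  have "(2::real) ^ l \<le> real (nat \<lfloor>y\<rfloor>)" using of_nat_mono[OF l(1), where 'a = real] by simp
  moreover have "real (nat \<lfloor>y\<rfloor>) + 1 \<le> 2 * 2 ^ l"
    using of_nat_mono[OF Suc_leI[OF l(2)], where 'a = real] by simp
  moreover have "real (nat \<lfloor>y\<rfloor>) \<le> y" "y \<le> real (nat \<lfloor>y\<rfloor>) + 1" using assms by (auto simp: of_nat_nat)
  ultimately show thesis using that[of l] by linarith
qed

lemma one_le_ln: "1 \<le> ln (real n)" if "3 \<le> n"
proof -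
  have "exp 1 \<le> real n" using exp_le that by linarith
  thus ?thesis using that by (simp add: ln_ge_iff)
qed

text \<open>The scale \<open>l0\<close> is chosen so that the two parts balance at empirical norm
  \<open>sqrt n * R\<close>, where both amount to \<open>c * m * sqrt (n * R)\<close>.\<close>

lemma sign_split_rate:
  fixes x :: "nat \<Rightarrow> real ^ 'd"
  assumes n: "3 \<le> n" and R: "0 < R" "R \<le> 1" "ln (real n) \<le> real n * R"
    and w: "\<And>i. i \<in> {1..n} \<Longrightarrow> \<bar>w i\<bar> \<le> 1"
  defines "c \<equiv> 40 * 3 ^ CARD('d) * (2 * real CARD('d) + 1)"
    and "m \<equiv> ln (real n) ^ (CARD('d) - 1)"
  shows "sign_split {1..n} x w (c * m / sqrt R) (c * m * sqrt (n * R))"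
proof -
  let ?d = "CARD('d)"
  have m1: "1 \<le> ln (real n)" using one_le_ln[OF n] .
  have mpos: "1 \<le> m" unfolding m_def using m1 by simp
  obtain l where l: "(2::real) ^ l \<le> n" "n \<le> 2 * (2::real) ^ l" "n < 2 ^ Suc l"
  proof -
    obtain l where "2 ^ l \<le> n" "n < 2 ^ (l + 1)" using ex_power_ivl1[of 2 n] n by auto
    thus thesis using that[of l] of_nat_mono[of "2 ^ l" n, where 'a = real] of_nat_mono[of n "2 ^ Suc l", where 'a = real] by simp
  qed
  define L where "L = Suc l"
  have nL: "card {1..n} < 2 ^ L" using l by (simp add: L_def)
  have L2: "2 ^ L \<le> 2 * real n" using l by (simp add: L_def)
  \<comment> \<open>\<open>ln 2 \<ge> 2/3\<close> gives \<open>l \<le> 3/2 * ln n\<close>, and the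
    extra level is at most \<open>ln n\<close>. This is the source of the power of 3 in
    \<open>c\<close>.\<close>
  have L3: "real L \<le> 3 * ln (real n)"
  proof -
    have "real l * ln 2 \<le> ln (real n)" using l(1) n by (simp flip: ln_realpow)
    moreover have "real l * (2/3) \<le> real l * ln 2" by (intro mult_left_mono ln2_ge_two_thirds) auto
    ultimately show ?thesis using m1 by (simp add: L_def)
  qed
  show ?thesis
  proof (cases "?d = 1")
    case True
    hence mm: "m = 1" unfolding m_def by simp
    have c: "c \<ge> 40" using True unfolding c_def by simp
    obtain l0 where l0: "2 ^ l0 \<le> n * R" "n * R \<le> 2 * 2 ^ l0" using dyadic_scale[of "n * R"] m1 R by auto
    obtain j0 :: 'd where j0: "UNIV = {j0}" using True by (auto simp: card_1_singleton_iff)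
    hence allj: "(\<forall>j. P j) \<longleftrightarrow> P j0" for P :: "'d \<Rightarrow> bool" by (metis UNIV_I singletonD)
    obtain p where p: "bij_betw p {1..n} {..<card {1..n}}" "\<And>i k. i \<in> {1..n} \<Longrightarrow> k \<in> {1..n} \<Longrightarrow> x k $ j0 < x i $ j0 \<Longrightarrow> p i < p k"
      using exists_decreasing_order[of "{1..n}" "\<lambda>i. x i $ j0"] by auto
    have injp: "inj_on p {1..n}" using p by (simp add: bij_betw_def)
    have "real n * R \<le> real n * 1" using R by (intro mult_left_mono) auto
    also have "\<dots> \<le> 2 ^ L" using l(2) by (simp add: L_def)
    finally have "(2::real) ^ l0 \<le> 2 ^ L" using l0(1) by linarith
    hence l0L: "l0 \<le> L" by (rule power_le_imp_le_exp[rotated]) simp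
    have "sign_split {1..n} x w (20 * sqrt (2 ^ L / 2 ^ l0)) (21 * sqrt (2 ^ l0))"
    proof (rule sign_split_haar[where r = "rank_in p {1..n}"])
      show "bij_betw (rank_in p {1..n}) {1..n} {..<card {1..n}}"
        by (rule bij_betw_rank_in) (use injp in auto)
      fix a :: "real ^ 'd"
      let ?Q = "{i \<in> {1..n}. a $ j0 \<le> x i $ j0}"
      have "rank_in p {1..n} i < card ?Q \<longleftrightarrow> i \<in> ?Q" if "i \<in> {1..n}" for i
      proof (rule rank_in_less_iff)
        fix i k assume *: "i \<in> {1..n}" "k \<in> ?Q" "p i < p k"
        hence "\<not> x i $ j0 < x k $ j0" using p(2)[of k i] by auto
        thus "i \<in> ?Q" using * by auto
      qed (use that injp in auto)
      moreover have "card ?Q \<le> card {1..n}" by (intro card_mono) auto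
      ultimately show "\<exists>t\<le>card {1..n}. \<forall>i\<in>{1..n}. (\<forall>j. a $ j \<le> x i $ j) \<longleftrightarrow> rank_in p {1..n} i < t"
        unfolding allj by (intro exI[of _ "card ?Q"]) auto
    qed (use nL l0L w in auto)
    thus ?thesis
    proof (rule sign_split_mono)
      have "2 ^ L / 2 ^ l0 \<le> (2 * n) / (n * R / 2)" using L2 l0 n R by (intro frac_le) auto
      also have "\<dots> = 2\<^sup>2 * (1 / R)" using n R by (simp add: field_simps)
      finally have "sqrt (2 ^ L / 2 ^ l0) \<le> sqrt (2\<^sup>2 * (1 / R))" by (rule real_sqrt_le_mono)
      also have "\<dots> = 2 / sqrt R" by (simp only: real_sqrt_mult real_sqrt_divide) simp
      finally have "20 * sqrt (2 ^ L / 2 ^ l0) \<le> 40 / sqrt R" by simp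
      also have "\<dots> \<le> c * m / sqrt R" using c R by (simp add: mm divide_right_mono)
      finally show "20 * sqrt (2 ^ L / 2 ^ l0) \<le> c * m / sqrt R" .
      have "21 * sqrt (2 ^ l0) \<le> c * sqrt (n * R)" using c l0 by (intro mult_mono) auto
      thus "21 * sqrt (2 ^ l0) \<le> c * m * sqrt (n * R)" by (simp add: mm)
    qed
  next
    case False
    moreover have "?d > 0" by simp
    ultimately have d: "?d \<ge> 2" by linarith
    define W where "W = real (L ^ (?d - 1))"
    have W: "0 \<le> W" "W \<le> 3 ^ (?d - 1) * m"
    proof -
      have "real L ^ (?d - 1) \<le> (3 * ln (real n)) ^ (?d - 1)" using L3 by (intro power_mono) auto
      thus "W \<le> 3 ^ (?d - 1) * m" unfolding W_def m_def by (simp add: power_mult_distrib)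
    qed (simp add: W_def)
    have lnm: "ln (real n) \<le> m" unfolding m_def using m1 d
      by (metis One_nat_def Suc_le_eq less_eq_real_def power_increasing power_one_right zero_less_diff numeral_2_eq_2)
    have "1 \<le> n * R / ln (real n)" using R m1 by simp
    \<comment> \<open>Lower than for \<open>d = 1\<close> by the factor \<open>ln n\<close>, which
      will cancel the logarithm in \<open>B\<close>. The hypothesis \<open>ln n \<le> n * R\<close>
      keeps the scale at least 1.\<close>
    then obtain l0 where l0: "2 ^ l0 \<le> n * R / ln (real n)" "n * R / ln (real n) \<le> 2 * 2 ^ l0" using dyadic_scale by blast
    have "sign_split {1..n} x w (sqrt (14 * W * card {1..n} / 2 ^ l0))
      (6 * W * sqrt (2 ^ l0) * sqrt (ln (2 * (2 + W * card {1..n}))))"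
      unfolding W_def by (rule sign_split_cells) (use nL w in auto)
    thus ?thesis
    proof (rule sign_split_mono)
      have "14 * W * card {1..n} / 2 ^ l0 \<le> 14 * W * n / (n * R / ln (real n) / 2)"
      proof (rule frac_le)
        show "n * R / ln (real n) / 2 \<le> 2 ^ l0" using divide_right_mono[OF l0(2), of 2] by (simp only: nonzero_mult_div_cancel_left)
        show "0 < n * R / ln (real n) / 2" using n R m1 by simp
      qed (use W in auto)
      also have "\<dots> = 28 * W * ln (real n) / R" using n R m1 by (simp add: field_simps)
      \<comment> \<open>The factor \<open>ln n\<close> lost in \<open>A\<close> is absorbed by a
        second \<open>m\<close>; this is where \<open>d \<ge> 2\<close> enters.\<close>
      also have "\<dots> \<le> 28 * (3 ^ (?d - 1) * m) * m / R"
        using W lnm R m1 mpos by (intro divide_right_mono mult_mono) auto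
      also have "\<dots> \<le> (6 * 3 ^ (?d - 1) * m)\<^sup>2 / R"
      proof -
        have "28 * 3 ^ (?d - 1) \<le> (6 * 3 ^ (?d - 1) * (6 * 3 ^ (?d - 1)) :: real)"
        proof -
          define y :: real where "y = 3 ^ (?d - 1)"
          have y: "1 \<le> y" unfolding y_def by simp
          hence "y * 1 \<le> y * y" by (intro mult_left_mono) auto
          thus ?thesis unfolding y_def[symmetric] using y by simp
        qed
        hence "28 * 3 ^ (?d - 1) * (m * m) \<le> 6 * 3 ^ (?d - 1) * (6 * 3 ^ (?d - 1)) * (m * m)"
          by (intro mult_right_mono) auto
        thus ?thesis using R by (intro divide_right_mono) (auto simp: power2_eq_square mult_ac)
      qed
      finally have "sqrt (14 * W * card {1..n} / 2 ^ l0) \<le> sqrt ((6 * 3 ^ (?d - 1) * m)\<^sup>2 / R)"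
        by (rule real_sqrt_le_mono)
      also have "\<dots> = 6 * 3 ^ (?d - 1) * m / sqrt R" using mpos by (simp add: real_sqrt_divide)
      also have "\<dots> \<le> c * m / sqrt R"
      proof -
        have "6 * 3 ^ (?d - 1) * 1 \<le> 40 * 3 ^ ?d * (2 * real ?d + 1)"
          by (intro mult_mono power_increasing) auto
        thus ?thesis unfolding c_def using mpos R by (intro divide_right_mono mult_right_mono) auto
      qed
      finally show "sqrt (14 * W * card {1..n} / 2 ^ l0) \<le> c * m / sqrt R" .
      \<comment> \<open>Only the logarithm of the number of cells enters, so a crude power of
        \<open>n\<close> will do; its exponent is the factor \<open>2 * d + 1\<close> of
        \<open>c\<close>.\<close>
      have "2 * (2 + W * card {1..n}) \<le> real n ^ (2 * ?d + 1)"
      proof -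
        have n3: "3 \<le> real n" using n by simp
        have "m \<le> real n ^ (?d - 1)"
          unfolding m_def using n m1 ln_le_minus_one[of "real n"] by (intro power_mono) auto
        hence "W \<le> real n ^ (?d - 1) * real n ^ (?d - 1)"
          using n3 mpos by (intro order_trans[OF W(2)] mult_mono power_mono) auto
        hence "2 * (2 + W * card {1..n}) \<le> 4 + 2 * (real n ^ (?d - 1) * real n ^ (?d - 1) * real n)"
          using n3 by simp
        also have "\<dots> \<le> 6 * (real n ^ (?d - 1) * real n ^ (?d - 1) * real n)"
        proof -
          have "1 \<le> real n ^ (?d - 1) * real n ^ (?d - 1) * real n"
            using n3 by (intro mult_ge1_I one_le_power) auto
          thus ?thesis by linarith
        qed
        also have "\<dots> \<le> real n * real n * (real n ^ (?d - 1) * real n ^ (?d - 1) * real n)"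
        proof -
          have "6 \<le> real n * real n" using mult_mono[OF n3 n3] by simp
          thus ?thesis by (intro mult_right_mono) auto
        qed
        also have "\<dots> = real n ^ (2 * ?d + 1)"
        proof -
          obtain k where "?d = Suc k" using d by (cases ?d) auto
          thus ?thesis by (simp add: power_add mult_2)
        qed
        finally show ?thesis .
      qed
      moreover have "0 < 2 * (2 + W * card {1..n})" using W(1) by (simp add: add_pos_nonneg)
      ultimately have "ln (2 * (2 + W * card {1..n})) \<le> ln (real n ^ (2 * ?d + 1))" by (intro ln_mono) auto
      also have "\<dots> = (2 * real ?d + 1) * ln (real n)" using n by (subst ln_realpow) auto
      also have "\<dots> \<le> (2 * real ?d + 1)\<^sup>2 * ln (real n)"
        unfolding power2_eq_square using m1 by (intro mult_right_mono) auto
      finally have "sqrt (2 ^ l0) * sqrt (ln (2 * (2 + W * card {1..n})))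
          \<le> sqrt (n * R / ln (real n)) * sqrt ((2 * real ?d + 1)\<^sup>2 * ln (real n))"
        using l0(1) W(1) R m1 by (intro mult_mono real_sqrt_le_mono real_sqrt_ge_zero ln_ge_zero) auto
      also have "\<dots> = (2 * real ?d + 1) * sqrt (n * R)"
        using m1 by (simp add: real_sqrt_mult real_sqrt_divide)
      finally have s1: "sqrt (2 ^ l0) * sqrt (ln (2 * (2 + W * card {1..n}))) \<le> (2 * real ?d + 1) * sqrt (n * R)" .
      have "6 * W * (sqrt (2 ^ l0) * sqrt (ln (2 * (2 + W * card {1..n}))))
         \<le> (6 * (3 ^ (?d - 1) * m)) * ((2 * real ?d + 1) * sqrt (n * R))"
      proof (rule mult_mono[OF _ s1])
        show "6 * W \<le> 6 * (3 ^ (?d - 1) * m)" using W by simp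
        show "0 \<le> sqrt (2 ^ l0) * sqrt (ln (2 * (2 + W * card {1..n})))"
          using W(1) by (intro mult_nonneg_nonneg real_sqrt_ge_zero ln_ge_zero) auto
      qed (use mpos in auto)
      also have "\<dots> = (6 * 3 ^ (?d - 1)) * ((2 * real ?d + 1) * (m * sqrt (n * R)))" by simp
      also have "\<dots> \<le> (40 * 3 ^ ?d) * ((2 * real ?d + 1) * (m * sqrt (n * R)))"
        using mpos R by (intro mult_right_mono mult_mono power_increasing) auto
      finally show "6 * W * sqrt (2 ^ l0) * sqrt (ln (2 * (2 + W * card {1..n}))) \<le> c * m * sqrt (n * R)"
        by (simp add: c_def mult.assoc)
    qed
  qed
qed

section \<open>Symmetrization\<close>

lemma MAX_leI:
  fixes f :: "'k \<Rightarrow> real"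
  assumes "finite J" "J \<noteq> {}" "\<And>k. k \<in> J \<Longrightarrow> f k \<le> B"
  shows "(MAX k\<in>J. f k) \<le> B"
  using assms by (subst Max_le_iff) auto

lemma le_MAX:
  fixes f :: "'k \<Rightarrow> real"
  assumes "finite J" "k \<in> J"
  shows "f k \<le> (MAX k\<in>J. f k)"
  using assms by (intro Max_ge) auto

context prob_space
begin

lemma distr_PiM_reindex':
  assumes "inj_on f I" "f \<in> I \<rightarrow> K"
  shows "distr (PiM K (\<lambda>_. M)) (PiM I (\<lambda>_. M)) (\<lambda>\<omega>. \<lambda>i\<in>I. \<omega> (f i)) = PiM I (\<lambda>_. M)"
  using distr_PiM_reindex[of K "\<lambda>_. M" f I] assms prob_space_axioms by simp

lemma integral_PiM_reindex:
  fixes F :: "('i \<Rightarrow> 'a) \<Rightarrow> real"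
  assumes "inj_on f I" "f \<in> I \<rightarrow> K" "F \<in> borel_measurable (PiM I (\<lambda>_. M))"
  shows "(\<integral>z. F z \<partial>PiM I (\<lambda>_. M)) = (\<integral>z. F (\<lambda>i\<in>I. z (f i)) \<partial>PiM K (\<lambda>_. M))"
proof -
  have "(\<integral>z. F z \<partial>PiM I (\<lambda>_. M)) = (\<integral>z. F z \<partial>distr (PiM K (\<lambda>_. M)) (PiM I (\<lambda>_. M)) (\<lambda>\<omega>. \<lambda>i\<in>I. \<omega> (f i)))"
    by (simp only: distr_PiM_reindex'[OF assms(1,2)])
  also have "\<dots> = (\<integral>z. F (\<lambda>i\<in>I. z (f i)) \<partial>PiM K (\<lambda>_. M))"
    using assms(2) by (intro integral_distr assms(3) measurable_restrict measurable_component_singleton) auto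
  finally show ?thesis .
qed

lemma integral_PiM_component:
  fixes \<phi> :: "'a \<Rightarrow> real"
  assumes "i \<in> K" "\<phi> \<in> borel_measurable M"
  shows "(\<integral>z. \<phi> (z i) \<partial>PiM K (\<lambda>_. M)) = (\<integral>x. \<phi> x \<partial>M)"
proof -
  interpret P: product_prob_space "\<lambda>_. M" K
    by (simp add: product_prob_space_def product_sigma_finite_def product_prob_space_axioms_def prob_space_axioms sigma_finite_measure_axioms)
  have "(\<integral>x. \<phi> x \<partial>M) = (\<integral>x. \<phi> x \<partial>distr (PiM K (\<lambda>_. M)) M (\<lambda>z. z i))"
    using P.PiM_component[OF assms(1)] by simp
  also have "\<dots> = (\<integral>z. \<phi> (z i) \<partial>PiM K (\<lambda>_. M))"
    using assms by (intro integral_distr) auto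
  finally show ?thesis by simp
qed

text \<open>The ghost sample occupies the coordinates \<open>n+1..2*n\<close> of a single product,
  so that inserting signs is a permutation of coordinates. With finite \<open>J\<close> all maxima
  are measurable.\<close>

lemma
  fixes \<phi> :: "'k \<Rightarrow> 'a \<Rightarrow> real"
  assumes J: "finite J" "J \<noteq> {}"
    and \<phi>: "\<And>k. k \<in> J \<Longrightarrow> \<phi> k \<in> borel_measurable M" "\<And>k x. k \<in> J \<Longrightarrow> x \<in> space M \<Longrightarrow> \<bar>\<phi> k x\<bar> \<le> B"
  shows symmetrization: "(\<integral>z. (MAX k\<in>J. \<bar>(\<Sum>i\<in>{1..n}. \<phi> k (z i)) - real n * (\<integral>x. \<phi> k x \<partial>M)\<bar>) \<partial>PiM {1..n} (\<lambda>_. M))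
    \<le> 2 * (\<integral>z. rad_mean {1..n} (\<lambda>\<epsilon>. MAX k\<in>J. \<bar>\<Sum>i\<in>{1..n}. \<epsilon> i * \<phi> k (z i)\<bar>) \<partial>PiM {1..n} (\<lambda>_. M))"
    and integrable_rad_mean_MAX: "integrable (PiM {1..n} (\<lambda>_. M)) (\<lambda>z. rad_mean {1..n} (\<lambda>\<epsilon>. MAX k\<in>J. \<bar>\<Sum>i\<in>{1..n}. \<epsilon> i * \<phi> k (z i)\<bar>))"
    and integrable_MAX_deviation: "integrable (PiM {1..n} (\<lambda>_. M)) (\<lambda>z. MAX k\<in>J. \<bar>(\<Sum>i\<in>{1..n}. \<phi> k (z i)) - real n * (\<integral>x. \<phi> k x \<partial>M)\<bar>)"
proof -
  let ?I = "{1..n}" and ?I' = "{n+1..2*n}" and ?K = "{1..2*n}"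
  let ?P = "\<lambda>K. PiM K (\<lambda>_. M)"
  interpret P: product_prob_space "\<lambda>_. M" K for K :: "nat set"
    by (simp add: product_prob_space_def product_sigma_finite_def product_prob_space_axioms_def prob_space_axioms sigma_finite_measure_axioms)
  have prob: "prob_space (?P K)" for K :: "nat set" by (rule P.prob_space_axioms)
  have K: "?I \<union> ?I' = ?K" "?I \<inter> ?I' = {}" by auto
  have compM: "z i \<in> space M" if "z \<in> space (?P K)" "i \<in> K" for z i and K :: "nat set"
    using that by (auto simp: space_PiM PiE_iff)
  define F where "F \<epsilon> z = (MAX k\<in>J. \<bar>\<Sum>i\<in>?I. \<epsilon> i * (\<phi> k (z i) - \<phi> k (z (i + n)))\<bar>)" for \<epsilon> :: "nat \<Rightarrow> real" and z :: "nat \<Rightarrow> 'a"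
  define G where "G \<epsilon> z = (MAX k\<in>J. \<bar>\<Sum>i\<in>?I. \<epsilon> i * \<phi> k (z i)\<bar>)" for \<epsilon> :: "nat \<Rightarrow> real" and z :: "nat \<Rightarrow> 'a"
  have phim: "(\<lambda>z. \<phi> k (z i)) \<in> borel_measurable (?P K)" if "i \<in> K" "k \<in> J" for i k and K :: "nat set"
    using measurable_compose[OF measurable_component_singleton[OF that(1), of "\<lambda>_. M"] \<phi>(1)[OF that(2)]] .
  have Fm: "F \<epsilon> \<in> borel_measurable (?P ?K)" for \<epsilon>
    unfolding F_def using J by (intro borel_measurable_Max borel_measurable_abs borel_measurable_sum borel_measurable_times borel_measurable_diff phim) auto
  have Gm: "G \<epsilon> \<in> borel_measurable (?P ?I)" for \<epsilon>
    unfolding G_def using J by (intro borel_measurable_Max borel_measurable_abs borel_measurable_sum borel_measurable_times phim) auto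
  have absMAX: "\<bar>MAX k\<in>J. \<bar>h k\<bar>\<bar> \<le> C" if "\<And>k. k \<in> J \<Longrightarrow> \<bar>h k\<bar> \<le> C" for h :: "'k \<Rightarrow> real" and C
  proof -
    obtain k where "k \<in> J" using J by blast
    hence "0 \<le> (MAX k\<in>J. \<bar>h k\<bar>)" using le_MAX[OF J(1), of k "\<lambda>k. \<bar>h k\<bar>"] by linarith
    thus ?thesis using MAX_leI[OF J, of "\<lambda>k. \<bar>h k\<bar>" C] that by simp
  qed
  have sumB: "\<bar>\<Sum>i\<in>?I. \<epsilon> i * y i\<bar> \<le> n * C" if "\<And>i. i \<in> ?I \<Longrightarrow> \<bar>\<epsilon> i\<bar> \<le> 1" "\<And>i. i \<in> ?I \<Longrightarrow> \<bar>y i\<bar> \<le> C" for \<epsilon> y :: "nat \<Rightarrow> real" and C :: real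
  proof -
    have "\<bar>\<Sum>i\<in>?I. \<epsilon> i * y i\<bar> \<le> (\<Sum>i\<in>?I. \<bar>\<epsilon> i * y i\<bar>)" by (rule sum_abs)
    also have "\<dots> \<le> (\<Sum>i\<in>?I. C)"
    proof (rule sum_mono)
      fix i assume i: "i \<in> ?I"
      have "\<bar>\<epsilon> i\<bar> * \<bar>y i\<bar> \<le> 1 * C" using that i by (intro mult_mono) auto
      thus "\<bar>\<epsilon> i * y i\<bar> \<le> C" by (simp add: abs_mult)
    qed
    finally show ?thesis by simp
  qed
  have diffB: "\<bar>\<phi> k (z i) - \<phi> k (z (i + n))\<bar> \<le> 2 * B" if "z \<in> space (?P ?K)" "k \<in> J" "i \<in> ?I" for z k i
  proof -
    have "\<bar>\<phi> k (z i)\<bar> \<le> B" "\<bar>\<phi> k (z (i + n))\<bar> \<le> B"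
      using that by (auto intro!: \<phi> compM)
    thus ?thesis by linarith
  qed
  have FB: "\<bar>F \<epsilon> z\<bar> \<le> n * (2 * B)" if "z \<in> space (?P ?K)" "\<And>i. i \<in> ?I \<Longrightarrow> \<bar>\<epsilon> i\<bar> \<le> 1" for \<epsilon> z
    unfolding F_def using that by (intro absMAX sumB diffB) auto
  have GB: "\<bar>G \<epsilon> z\<bar> \<le> n * B" if "z \<in> space (?P ?I)" "\<And>i. i \<in> ?I \<Longrightarrow> \<bar>\<epsilon> i\<bar> \<le> 1" for \<epsilon> z
    unfolding G_def using that by (intro absMAX sumB \<phi> compM) auto
  have Fint: "integrable (?P ?K) (F \<epsilon>)" if "\<And>i. i \<in> ?I \<Longrightarrow> \<bar>\<epsilon> i\<bar> \<le> 1" for \<epsilon>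
    using FB[OF _ that] Fm
    by (intro finite_measure.integrable_const_bound[where B = "n * (2 * B)"] prob_space.finite_measure prob) auto
  have Gint: "integrable (?P ?I) (G \<epsilon>)" if "\<And>i. i \<in> ?I \<Longrightarrow> \<bar>\<epsilon> i\<bar> \<le> 1" for \<epsilon>
    using GB[OF _ that] Gm
    by (intro finite_measure.integrable_const_bound[where B = "n * B"] prob_space.finite_measure prob) auto
  let ?T = "\<lambda>z. (MAX k\<in>J. \<bar>(\<Sum>i\<in>?I. \<phi> k (z i)) - real n * (\<integral>x. \<phi> k x \<partial>M)\<bar>)"
  have F1: "(\<integral>z. F (\<lambda>_. 1) z \<partial>?P ?K) = (\<integral>z. (\<integral>z'. F (\<lambda>_. 1) (merge ?I ?I' (z, z')) \<partial>?P ?I') \<partial>?P ?I)"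
    unfolding K(1)[symmetric] by (rule P.product_integral_fold) (use Fint[of "\<lambda>_. 1"] K in auto)
  have mergeI: "merge ?I ?I' (z, z') i = z i" "merge ?I ?I' (z, z') (i + n) = z' (i + n)" if "i \<in> ?I" for z z' i
    using that by (auto simp: merge_def)
  \<comment> \<open>\<open>n\<close> times the expectation is the mean of the ghost sum, and both
    the absolute value and the maximum may be moved inside the integral.\<close>
  have ghost: "?T z \<le> (\<integral>z'. F (\<lambda>_. 1) (merge ?I ?I' (z, z')) \<partial>?P ?I')" if z: "z \<in> space (?P ?I)" for z
  proof (rule MAX_leI[OF J])
    fix k assume k: "k \<in> J"
    have intk: "integrable (?P ?I') (\<lambda>z'. \<phi> k (z' (i + n)))" if "i \<in> ?I" for i
    proof (rule finite_measure.integrable_const_bound[where B = B])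
      show "AE z' in ?P ?I'. norm (\<phi> k (z' (i + n))) \<le> B"
        using that k by (intro AE_I2) (auto intro!: \<phi> compM)
      show "(\<lambda>z'. \<phi> k (z' (i + n))) \<in> borel_measurable (?P ?I')" by (rule phim) (use that k in auto)
    qed (rule prob_space.finite_measure[OF prob])
    have eq: "(\<Sum>i\<in>?I. \<phi> k (z i)) - real n * (\<integral>x. \<phi> k x \<partial>M) = (\<integral>z'. (\<Sum>i\<in>?I. \<phi> k (z i) - \<phi> k (z' (i + n))) \<partial>?P ?I')"
    proof -
      have "(\<integral>z'. (\<Sum>i\<in>?I. \<phi> k (z i) - \<phi> k (z' (i + n))) \<partial>?P ?I') = (\<Sum>i\<in>?I. \<integral>z'. \<phi> k (z i) - \<phi> k (z' (i + n)) \<partial>?P ?I')"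
        using intk by (intro Bochner_Integration.integral_sum Bochner_Integration.integrable_diff finite_measure.integrable_const prob_space.finite_measure prob) auto
      also have "\<dots> = (\<Sum>i\<in>?I. \<phi> k (z i) - (\<integral>x. \<phi> k x \<partial>M))"
      proof (rule sum.cong[OF refl])
        fix i assume i: "i \<in> ?I"
        have "(\<integral>z'. \<phi> k (z i) - \<phi> k (z' (i + n)) \<partial>?P ?I') = (\<integral>z'. \<phi> k (z i) \<partial>?P ?I') - (\<integral>z'. \<phi> k (z' (i + n)) \<partial>?P ?I')"
          using intk[OF i] by (intro Bochner_Integration.integral_diff finite_measure.integrable_const prob_space.finite_measure prob)
        also have "(\<integral>z'. \<phi> k (z' (i + n)) \<partial>?P ?I') = (\<integral>x. \<phi> k x \<partial>M)"
          using i k by (intro integral_PiM_component \<phi>) auto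
        finally show "(\<integral>z'. \<phi> k (z i) - \<phi> k (z' (i + n)) \<partial>?P ?I') = \<phi> k (z i) - (\<integral>x. \<phi> k x \<partial>M)"
          using prob_space.prob_space[OF prob[of ?I']] by simp
      qed
      finally show ?thesis by (simp add: sum_subtractf)
    qed
    have "\<bar>\<integral>z'. (\<Sum>i\<in>?I. \<phi> k (z i) - \<phi> k (z' (i + n))) \<partial>?P ?I'\<bar> \<le> (\<integral>z'. \<bar>\<Sum>i\<in>?I. \<phi> k (z i) - \<phi> k (z' (i + n))\<bar> \<partial>?P ?I')"
      by (rule integral_abs_bound)
    also have "\<dots> \<le> (\<integral>z'. F (\<lambda>_. 1) (merge ?I ?I' (z, z')) \<partial>?P ?I')"
    proof (rule integral_mono)
      show "integrable (?P ?I') (\<lambda>z'. \<bar>\<Sum>i\<in>?I. \<phi> k (z i) - \<phi> k (z' (i + n))\<bar>)"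
        using intk by (intro integrable_abs Bochner_Integration.integrable_sum Bochner_Integration.integrable_diff finite_measure.integrable_const prob_space.finite_measure prob) auto
      have mm: "(\<lambda>z'. merge ?I ?I' (z, z')) \<in> measurable (?P ?I') (?P ?K)"
        unfolding K(1)[symmetric] by (rule measurable_compose[OF measurable_Pair1'[OF z] measurable_merge])
      show "integrable (?P ?I') (\<lambda>z'. F (\<lambda>_. 1) (merge ?I ?I' (z, z')))"
      proof (rule finite_measure.integrable_const_bound[where B = "n * (2 * B)"])
        show "AE z' in ?P ?I'. norm (F (\<lambda>_. 1) (merge ?I ?I' (z, z'))) \<le> n * (2 * B)"
          using measurable_space[OF mm] by (intro AE_I2) (auto intro!: FB)
        show "(\<lambda>z'. F (\<lambda>_. 1) (merge ?I ?I' (z, z'))) \<in> borel_measurable (?P ?I')"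
          by (rule measurable_compose[OF mm Fm])
      qed (rule prob_space.finite_measure[OF prob])
      fix z' assume "z' \<in> space (?P ?I')"
      have "\<bar>\<Sum>i\<in>?I. \<phi> k (z i) - \<phi> k (z' (i + n))\<bar>
          = \<bar>\<Sum>i\<in>?I. 1 * (\<phi> k (merge ?I ?I' (z, z') i) - \<phi> k (merge ?I ?I' (z, z') (i + n)))\<bar>"
        by (rule arg_cong[of _ _ abs], rule sum.cong) (auto simp only: mergeI mult_1)
      also have "\<dots> \<le> F (\<lambda>_. 1) (merge ?I ?I' (z, z'))"
        unfolding F_def using k J(1) by (intro le_MAX[of J k])
      finally show "\<bar>\<Sum>i\<in>?I. \<phi> k (z i) - \<phi> k (z' (i + n))\<bar> \<le> F (\<lambda>_. 1) (merge ?I ?I' (z, z'))" .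
    qed
    finally show "\<bar>(\<Sum>i\<in>?I. \<phi> k (z i)) - real n * (\<integral>x. \<phi> k x \<partial>M)\<bar> \<le> (\<integral>z'. F (\<lambda>_. 1) (merge ?I ?I' (z, z')) \<partial>?P ?I')"
      using eq by simp
  qed
  \<comment> \<open>Exchanging \<open>i\<close> and \<open>i + n\<close> exactly where the sign is
    -1 preserves the product measure and reverses those differences.\<close>
  have flip: "(\<integral>z. F (\<lambda>_. 1) z \<partial>?P ?K) = (\<integral>z. F \<epsilon> z \<partial>?P ?K)" if \<epsilon>: "\<epsilon> \<in> signs ?I" for \<epsilon>
  proof -
    define t where "t i = (if i \<in> ?I \<and> \<epsilon> i = - 1 then i + n else if i \<in> ?I' \<and> \<epsilon> (i - n) = - 1 then i - n else i)" for i
    have t: "inj_on t ?K" "t \<in> ?K \<rightarrow> ?K"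
      unfolding t_def inj_on_def by (auto split: if_splits)
    have "F (\<lambda>_. 1) (\<lambda>i\<in>?K. z (t i)) = F \<epsilon> z" for z
    proof -
      have "\<epsilon> i * (\<phi> k (z i) - \<phi> k (z (i + n))) = \<phi> k (z (t i)) - \<phi> k (z (t (i + n)))" if "i \<in> ?I" for i k
        using signs_sq[OF \<epsilon> that] that by (auto simp: t_def)
      thus ?thesis unfolding F_def by (intro arg_cong[of _ _ Max] image_cong refl arg_cong[of _ _ abs] sum.cong) auto
    qed
    thus ?thesis by (subst integral_PiM_reindex[OF t Fm]) simp
  qed
  \<comment> \<open>The signed differences split into two sums, one per half of the coordinates, and
    each half is distributed like the sample.\<close>
  have FG: "(\<integral>z. F \<epsilon> z \<partial>?P ?K) \<le> 2 * (\<integral>z. G \<epsilon> z \<partial>?P ?I)" if \<epsilon>: "\<epsilon> \<in> signs ?I" for \<epsilon>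
  proof -
    have \<epsilon>1: "\<bar>\<epsilon> i\<bar> \<le> 1" if "i \<in> ?I" for i using signs_sq[OF \<epsilon> that] by auto
    define r where "r f z = (\<lambda>i\<in>?I. z (f i))" for f :: "nat \<Rightarrow> nat" and z :: "nat \<Rightarrow> 'a"
    have re: "integrable (?P ?K) (\<lambda>z. G \<epsilon> (r f z)) \<and> (\<integral>z. G \<epsilon> (r f z) \<partial>?P ?K) = (\<integral>z. G \<epsilon> z \<partial>?P ?I)"
      if f: "inj_on f ?I" "f \<in> ?I \<rightarrow> ?K" for f
    proof
      have rm: "r f \<in> measurable (?P ?K) (?P ?I)"
        unfolding r_def using f(2) by (intro measurable_restrict measurable_component_singleton) auto
      show "integrable (?P ?K) (\<lambda>z. G \<epsilon> (r f z))"
      proof (rule integrable_distr[OF rm])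
        show "integrable (distr (?P ?K) (?P ?I) (r f)) (G \<epsilon>)"
          unfolding r_def distr_PiM_reindex'[OF f] by (rule Gint[OF \<epsilon>1])
      qed
      show "(\<integral>z. G \<epsilon> (r f z) \<partial>?P ?K) = (\<integral>z. G \<epsilon> z \<partial>?P ?I)"
        unfolding r_def by (rule integral_PiM_reindex[OF f Gm, symmetric])
    qed
    note re1 = re[of "\<lambda>i. i"] and re2 = re[of "\<lambda>i. i + n"]
    have ri: "integrable (?P ?K) (\<lambda>z. G \<epsilon> (r (\<lambda>i. i) z))" "(\<integral>z. G \<epsilon> (r (\<lambda>i. i) z) \<partial>?P ?K) = (\<integral>z. G \<epsilon> z \<partial>?P ?I)"
      "integrable (?P ?K) (\<lambda>z. G \<epsilon> (r (\<lambda>i. i + n) z))" "(\<integral>z. G \<epsilon> (r (\<lambda>i. i + n) z) \<partial>?P ?K) = (\<integral>z. G \<epsilon> z \<partial>?P ?I)"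
      using re1 re2 by auto
    have "F \<epsilon> z \<le> G \<epsilon> (r (\<lambda>i. i) z) + G \<epsilon> (r (\<lambda>i. i + n) z)" for z
      unfolding F_def
    proof (rule MAX_leI[OF J])
      fix k assume k: "k \<in> J"
      have "(\<Sum>i\<in>?I. \<epsilon> i * (\<phi> k (z i) - \<phi> k (z (i + n))))
        = (\<Sum>i\<in>?I. \<epsilon> i * \<phi> k (r (\<lambda>i. i) z i)) - (\<Sum>i\<in>?I. \<epsilon> i * \<phi> k (r (\<lambda>i. i + n) z i))"
        by (simp add: r_def right_diff_distrib sum_subtractf)
      moreover have y: "\<bar>\<Sum>i\<in>?I. \<epsilon> i * \<phi> k (y i)\<bar> \<le> G \<epsilon> y" for y
        unfolding G_def using J k by (intro le_MAX[of J k]) 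
      ultimately show "\<bar>\<Sum>i\<in>?I. \<epsilon> i * (\<phi> k (z i) - \<phi> k (z (i + n)))\<bar> \<le> G \<epsilon> (r (\<lambda>i. i) z) + G \<epsilon> (r (\<lambda>i. i + n) z)"
        using y[of "r (\<lambda>i. i) z"] y[of "r (\<lambda>i. i + n) z"] by linarith
    qed
    hence "(\<integral>z. F \<epsilon> z \<partial>?P ?K) \<le> (\<integral>z. G \<epsilon> (r (\<lambda>i. i) z) + G \<epsilon> (r (\<lambda>i. i + n) z) \<partial>?P ?K)"
      using ri(1,3) Fint[OF \<epsilon>1] by (intro integral_mono) auto
    thus ?thesis using ri by simp
  qed
  have nM: "\<bar>\<integral>x. \<phi> k x \<partial>M\<bar> \<le> B" if "k \<in> J" for k
  proof -
    have "\<bar>\<integral>x. \<phi> k x \<partial>M\<bar> \<le> (\<integral>x. \<bar>\<phi> k x\<bar> \<partial>M)" by (rule integral_abs_bound)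
    also have "\<dots> \<le> (\<integral>x. B \<partial>M)"
    proof (rule integral_mono)
      show "integrable M (\<lambda>x. \<bar>\<phi> k x\<bar>)"
        using that \<phi> by (intro integrable_abs integrable_const_bound[where B = B]) auto
    qed (use that \<phi> in auto)
    finally show ?thesis by (simp add: prob_space)
  qed
  show Tint: "integrable (?P ?I) ?T"
  proof (rule finite_measure.integrable_const_bound[where B = "n * B + n * B"])
    show "AE z in ?P ?I. norm (?T z) \<le> n * B + n * B"
    proof (rule AE_I2)
      fix z assume z: "z \<in> space (?P ?I)"
      have "\<bar>(\<Sum>i\<in>?I. \<phi> k (z i)) - real n * (\<integral>x. \<phi> k x \<partial>M)\<bar> \<le> n * B + n * B" if "k \<in> J" for k
      proof -
        have "\<bar>\<Sum>i\<in>?I. 1 * \<phi> k (z i)\<bar> \<le> n * B" using that z by (intro sumB \<phi> compM) auto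
        moreover have "\<bar>real n * (\<integral>x. \<phi> k x \<partial>M)\<bar> \<le> n * B"
          using nM[OF that] by (simp add: abs_mult mult_left_mono)
        ultimately show ?thesis unfolding mult_1 by linarith
      qed
      thus "norm (?T z) \<le> n * B + n * B" unfolding real_norm_def by (intro absMAX)
    qed
    show "?T \<in> borel_measurable (?P ?I)"
      using J by (intro borel_measurable_Max borel_measurable_abs borel_measurable_sum borel_measurable_diff phim) auto
  qed (rule prob_space.finite_measure[OF prob])
  have "(\<integral>z. ?T z \<partial>?P ?I) \<le> (\<integral>z. (\<integral>z'. F (\<lambda>_. 1) (merge ?I ?I' (z, z')) \<partial>?P ?I') \<partial>?P ?I)"
  proof (rule integral_mono)
    show "integrable (?P ?I) (\<lambda>z. \<integral>z'. F (\<lambda>_. 1) (merge ?I ?I' (z, z')) \<partial>?P ?I')"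
    proof -
      interpret pair_sigma_finite "?P ?I" "?P ?I'"
        using prob by (simp add: pair_sigma_finite_def prob_space_imp_sigma_finite)
      have "integrable (distr (?P ?I \<Otimes>\<^sub>M ?P ?I') (?P ?K) (merge ?I ?I')) (F (\<lambda>_. 1))"
        using P.distr_merge[of ?I ?I'] Fint[of "\<lambda>_. 1"] K by simp
      hence "integrable (?P ?I \<Otimes>\<^sub>M ?P ?I') (\<lambda>y. F (\<lambda>_. 1) (merge ?I ?I' y))"
        by (rule integrable_distr[rotated]) (unfold K(1)[symmetric], rule measurable_merge)
      from integrable_fst'[OF this] show ?thesis .
    qed
  qed (rule Tint, rule ghost)
  also have "\<dots> = (\<integral>z. F (\<lambda>_. 1) z \<partial>?P ?K)" using F1 by simp
  finally have *: "(\<integral>z. ?T z \<partial>?P ?I) \<le> (\<integral>z. F (\<lambda>_. 1) z \<partial>?P ?K)" .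
  \<comment> \<open>Nothing on the left depends on the signs, so it equals its own sign average and
    the bounds for the individual signs can be averaged.\<close>
  have "(\<integral>z. ?T z \<partial>?P ?I) = rad_mean ?I (\<lambda>_. \<integral>z. ?T z \<partial>?P ?I)" by (simp add: rad_mean_const)
  also have "\<dots> \<le> rad_mean ?I (\<lambda>\<epsilon>. 2 * (\<integral>z. G \<epsilon> z \<partial>?P ?I))"
    using * flip FG by (intro rad_mean_mono) fastforce
  also have "\<dots> = 2 * (\<integral>z. rad_mean ?I (\<lambda>\<epsilon>. G \<epsilon> z) \<partial>?P ?I)"
  proof -
    have "(\<integral>z. (\<Sum>\<epsilon>\<in>signs ?I. G \<epsilon> z) \<partial>?P ?I) = (\<Sum>\<epsilon>\<in>signs ?I. \<integral>z. G \<epsilon> z \<partial>?P ?I)"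
    proof (rule Bochner_Integration.integral_sum)
      fix \<epsilon> assume "\<epsilon> \<in> signs ?I"
      thus "integrable (?P ?I) (G \<epsilon>)" using signs_sq[of \<epsilon> ?I] by (intro Gint) fastforce
    qed
    thus ?thesis unfolding rad_mean_cmult unfolding rad_mean_def by simp
  qed
  finally show "(\<integral>z. ?T z \<partial>?P ?I) \<le> 2 * (\<integral>z. rad_mean ?I (\<lambda>\<epsilon>. MAX k\<in>J. \<bar>\<Sum>i\<in>?I. \<epsilon> i * \<phi> k (z i)\<bar>) \<partial>?P ?I)"
    unfolding G_def .
  have "integrable (?P ?I) (G \<epsilon>)" if "\<epsilon> \<in> signs ?I" for \<epsilon>
    using signs_sq[OF that] by (intro Gint) fastforce
  thus "integrable (?P ?I) (\<lambda>z. rad_mean ?I (\<lambda>\<epsilon>. MAX k\<in>J. \<bar>\<Sum>i\<in>?I. \<epsilon> i * \<phi> k (z i)\<bar>))"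
    unfolding rad_mean_def G_def by (intro integrable_divide Bochner_Integration.integrable_sum)
qed

end

section \<open>Combinations of orthant indicators\<close>

definition orthant :: "real ^ 'd \<Rightarrow> real ^ 'd \<Rightarrow> real" where
  "orthant p x = of_bool (\<forall>j. p $ j \<le> x $ j)"

definition lincomb :: "(real \<times> (real ^ 'd)) list \<Rightarrow> real ^ 'd \<Rightarrow> real" where
  "lincomb ps x = (\<Sum>(q, p)\<leftarrow>ps. q * orthant p x)"

definition weight :: "(real \<times> (real ^ 'd)) list \<Rightarrow> real" where
  "weight ps = (\<Sum>(q, p)\<leftarrow>ps. \<bar>q\<bar>)"

text \<open>Pointwise limits of finite combinations play the role of mixtures by a signed measure;
  bounds for sums over a finite sample pass to such limits.\<close>

definition orthant_closure :: "real \<Rightarrow> (real ^ 'd \<Rightarrow> real) set" where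
  "orthant_closure V = {f. \<exists>ps. (\<forall>N. weight (ps N) \<le> V) \<and>
     (\<forall>x\<in>unit_cube. (\<lambda>N. lincomb (ps N) x) \<longlonglongrightarrow> f x)}"

lemma lincomb_simps [simp]:
  "lincomb [] x = 0" "lincomb ((q, p) # ps) x = q * orthant p x + lincomb ps x"
  "lincomb (ps @ ps') x = lincomb ps x + lincomb ps' x"
  unfolding lincomb_def by simp_all

lemma weight_simps [simp]:
  "weight [] = 0" "weight ((q, p) # ps) = \<bar>q\<bar> + weight ps"
  "weight (ps @ ps') = weight ps + weight ps'"
  unfolding weight_def by simp_all

lemma weight_nonneg: "0 \<le> weight ps"
  by (induction ps) auto

lemma orthant_closure_weight: "f \<in> orthant_closure V \<Longrightarrow> 0 \<le> V"
  unfolding orthant_closure_def using weight_nonneg order_trans by blast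

definition scale_comb :: "real \<Rightarrow> (real \<times> (real ^ 'd)) list \<Rightarrow> (real \<times> (real ^ 'd)) list" where
  "scale_comb c ps = map (\<lambda>(q, p). (c * q, p)) ps"

lemma scale_comb: "lincomb (scale_comb c ps) x = c * lincomb ps x" "weight (scale_comb c ps) = \<bar>c\<bar> * weight ps"
  unfolding scale_comb_def by (induction ps) (auto simp: algebra_simps abs_mult)

text \<open>The product with \<open>c * orthant a\<close>: two orthants intersect in the orthant at
  the coordinatewise maximum of their corners.\<close>

definition shift_comb :: "real \<Rightarrow> real ^ 'd \<Rightarrow> (real \<times> (real ^ 'd)) list \<Rightarrow> (real \<times> (real ^ 'd)) list" where
  "shift_comb c a ps = map (\<lambda>(q, p). (c * q, \<chi> j. max (a $ j) (p $ j))) ps"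

lemma shift_comb: "lincomb (shift_comb c a ps) x = c * orthant a x * lincomb ps x" "weight (shift_comb c a ps) = \<bar>c\<bar> * weight ps"
proof -
  have "orthant (\<chi> j. max (a $ j) (p $ j)) x = orthant a x * orthant p x" for p
    unfolding orthant_def by auto
  thus "lincomb (shift_comb c a ps) x = c * orthant a x * lincomb ps x"
    unfolding shift_comb_def by (induction ps) (auto simp: algebra_simps)
qed (unfold shift_comb_def, induction ps, auto simp: algebra_simps abs_mult)

definition mult_comb :: "(real \<times> (real ^ 'd)) list \<Rightarrow> (real \<times> (real ^ 'd)) list \<Rightarrow> (real \<times> (real ^ 'd)) list" where
  "mult_comb ps ps' = concat (map (\<lambda>(q, p). shift_comb q p ps') ps)"

lemma mult_comb: "lincomb (mult_comb ps ps') x = lincomb ps x * lincomb ps' x" "weight (mult_comb ps ps') = weight ps * weight ps'"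
  unfolding mult_comb_def by (induction ps) (auto simp: algebra_simps shift_comb)

lemma orthant_closure_add:
  assumes "f \<in> orthant_closure V" "g \<in> orthant_closure W"
  shows "(\<lambda>x. a * f x + b * g x) \<in> orthant_closure (\<bar>a\<bar> * V + \<bar>b\<bar> * W)"
proof -
  obtain ps ps' where ps: "\<And>N. weight (ps N) \<le> V" "\<And>x. x \<in> unit_cube \<Longrightarrow> (\<lambda>N. lincomb (ps N) x) \<longlonglongrightarrow> f x"
    "\<And>N. weight (ps' N) \<le> W" "\<And>x. x \<in> unit_cube \<Longrightarrow> (\<lambda>N. lincomb (ps' N) x) \<longlonglongrightarrow> g x"
    using assms unfolding orthant_closure_def by blast
  have "weight (scale_comb a (ps N) @ scale_comb b (ps' N)) \<le> \<bar>a\<bar> * V + \<bar>b\<bar> * W" for N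
    using ps by (simp add: scale_comb add_mono mult_left_mono)
  moreover have "(\<lambda>N. lincomb (scale_comb a (ps N) @ scale_comb b (ps' N)) x) \<longlonglongrightarrow> a * f x + b * g x" if "x \<in> unit_cube" for x
    unfolding lincomb_simps scale_comb by (intro tendsto_intros ps that)
  ultimately show ?thesis unfolding orthant_closure_def mem_Collect_eq
    by (intro exI[of _ "\<lambda>N. scale_comb a (ps N) @ scale_comb b (ps' N)"]) blast
qed

text \<open>Squares of errors thus belong to a class of the same kind, and one deviation bound also
  serves to compare empirical and population norms.\<close>

lemma orthant_closure_mult:
  assumes "f \<in> orthant_closure V" "g \<in> orthant_closure W"
  shows "(\<lambda>x. f x * g x) \<in> orthant_closure (V * W)"
proof -
  obtain ps ps' where ps: "\<And>N. weight (ps N) \<le> V" "\<And>x. x \<in> unit_cube \<Longrightarrow> (\<lambda>N. lincomb (ps N) x) \<longlonglongrightarrow> f x"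
    "\<And>N. weight (ps' N) \<le> W" "\<And>x. x \<in> unit_cube \<Longrightarrow> (\<lambda>N. lincomb (ps' N) x) \<longlonglongrightarrow> g x"
    using assms unfolding orthant_closure_def by blast
  have "weight (mult_comb (ps N) (ps' N)) \<le> V * W" for N
    unfolding mult_comb using ps(1,3)[of N] weight_nonneg[of "ps N"] weight_nonneg[of "ps' N"]
    by (intro mult_mono) auto
  moreover have "(\<lambda>N. lincomb (mult_comb (ps N) (ps' N)) x) \<longlonglongrightarrow> f x * g x" if "x \<in> unit_cube" for x
    unfolding mult_comb by (intro tendsto_intros ps that)
  ultimately show ?thesis unfolding orthant_closure_def mem_Collect_eq
    by (intro exI[of _ "\<lambda>N. mult_comb (ps N) (ps' N)"]) blast
qed

lemma lincomb_sum_le: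
  assumes "\<And>a. \<bar>\<Sum>i\<in>I. orthant a (x i) * v i\<bar> \<le> M"
  shows "\<bar>\<Sum>i\<in>I. v i * lincomb ps (x i)\<bar> \<le> weight ps * M"
proof (induction ps)
  case (Cons a ps)
  obtain q p where a: "a = (q, p)" by fastforce
  have "(\<Sum>i\<in>I. v i * lincomb (a # ps) (x i)) = q * (\<Sum>i\<in>I. orthant p (x i) * v i) + (\<Sum>i\<in>I. v i * lincomb ps (x i))"
    unfolding a by (simp add: algebra_simps sum.distrib sum_distrib_left)
  also have "\<bar>\<dots>\<bar> \<le> \<bar>q\<bar> * \<bar>\<Sum>i\<in>I. orthant p (x i) * v i\<bar> + \<bar>\<Sum>i\<in>I. v i * lincomb ps (x i)\<bar>"
    unfolding abs_mult[symmetric] by (rule abs_triangle_ineq)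
  also have "\<dots> \<le> \<bar>q\<bar> * M + weight ps * M"
    by (intro add_mono mult_left_mono assms Cons) auto
  finally show ?case unfolding a by (simp add: algebra_simps)
qed simp

text \<open>A linear functional of the sample values need only be bounded on single orthants; the
  weight bounds it on combinations, and then on limits.\<close>

lemma orthant_closure_sum_le:
  assumes f: "f \<in> orthant_closure V" and M: "\<And>a. \<bar>\<Sum>i\<in>I. orthant a (x i) * v i\<bar> \<le> M"
    and x: "\<And>i. i \<in> I \<Longrightarrow> x i \<in> unit_cube"
  shows "\<bar>\<Sum>i\<in>I. v i * f (x i)\<bar> \<le> V * M"
proof -
  obtain ps where ps: "\<And>N. weight (ps N) \<le> V" "\<And>x. x \<in> unit_cube \<Longrightarrow> (\<lambda>N. lincomb (ps N) x) \<longlonglongrightarrow> f x"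
    using f unfolding orthant_closure_def by blast
  have "(\<lambda>N. \<bar>\<Sum>i\<in>I. v i * lincomb (ps N) (x i)\<bar>) \<longlonglongrightarrow> \<bar>\<Sum>i\<in>I. v i * f (x i)\<bar>"
    by (intro tendsto_intros ps x)
  moreover have "\<bar>\<Sum>i\<in>I. v i * lincomb (ps N) (x i)\<bar> \<le> V * M" for N
  proof -
    have "0 \<le> M" using M[of undefined] by linarith
    thus ?thesis using lincomb_sum_le[OF M, of "ps N"] mult_right_mono[OF ps(1)[of N], of M] by linarith
  qed
  ultimately show ?thesis by (intro LIMSEQ_le_const2) auto
qed

text \<open>\<open>orthant_closure_sum_le\<close> for a sample that consists of the one point
  \<open>x\<close>.\<close>

lemma orthant_closure_bound:
  assumes "f \<in> orthant_closure V" "x \<in> unit_cube"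
  shows "\<bar>f x\<bar> \<le> V"
  using orthant_closure_sum_le[OF assms(1), where I = "{()}" and x = "\<lambda>_. x" and v = "\<lambda>_. 1" and M = 1] assms(2)
  by (simp add: orthant_def)

lemma rad_mean_sup_le:
  fixes x :: "'i \<Rightarrow> real ^ 'd"
  assumes split: "sign_split I x w A B" and I: "finite I" and x: "\<And>i. i \<in> I \<Longrightarrow> x i \<in> unit_cube"
    and H: "finite H" "H \<noteq> {}" "\<And>h. h \<in> H \<Longrightarrow> h \<in> orthant_closure V" "\<And>h. h \<in> H \<Longrightarrow> L2_set (\<lambda>i. h (x i)) I \<le> \<delta>"
  shows "rad_mean I (\<lambda>\<epsilon>. MAX h\<in>H. \<bar>\<Sum>i\<in>I. \<epsilon> i * (w i * h (x i))\<bar>) \<le> \<delta> * A + V * B"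
proof -
  obtain u v M where uv: "\<And>\<epsilon> i. \<epsilon> \<in> signs I \<Longrightarrow> i \<in> I \<Longrightarrow> \<epsilon> i * w i = u \<epsilon> i + v \<epsilon> i"
    "\<And>\<epsilon> a. \<epsilon> \<in> signs I \<Longrightarrow> \<bar>\<Sum>i\<in>I. orthant a (x i) * v \<epsilon> i\<bar> \<le> M \<epsilon>"
    "rad_mean I (\<lambda>\<epsilon>. L2_set (u \<epsilon>) I) \<le> A" "rad_mean I M \<le> B"
    using split unfolding sign_split_def orthant_def by blast
  obtain h0 where h0: "h0 \<in> H" using H by blast
  have V: "0 \<le> V" using orthant_closure_weight H(3)[OF h0] by blast
  have \<delta>: "0 \<le> \<delta>" using H(4)[OF h0] L2_set_nonneg order_trans by blast
  have "rad_mean I (\<lambda>\<epsilon>. MAX h\<in>H. \<bar>\<Sum>i\<in>I. \<epsilon> i * (w i * h (x i))\<bar>) \<le> rad_mean I (\<lambda>\<epsilon>. \<delta> * L2_set (u \<epsilon>) I + V * M \<epsilon>)"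
  proof (intro rad_mean_mono MAX_leI H)
    fix \<epsilon> h assume \<epsilon>: "\<epsilon> \<in> signs I" and h: "h \<in> H"
    have "(\<Sum>i\<in>I. \<epsilon> i * (w i * h (x i))) = (\<Sum>i\<in>I. u \<epsilon> i * h (x i)) + (\<Sum>i\<in>I. v \<epsilon> i * h (x i))"
      unfolding sum.distrib[symmetric]
      by (rule sum.cong) (use uv(1)[OF \<epsilon>] in \<open>auto simp: distrib_right[symmetric] mult.assoc[symmetric]\<close>)
    hence "\<bar>\<Sum>i\<in>I. \<epsilon> i * (w i * h (x i))\<bar> \<le> \<bar>\<Sum>i\<in>I. u \<epsilon> i * h (x i)\<bar> + \<bar>\<Sum>i\<in>I. v \<epsilon> i * h (x i)\<bar>"
      by (simp add: abs_triangle_ineq)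
    also have "\<bar>\<Sum>i\<in>I. v \<epsilon> i * h (x i)\<bar> \<le> V * M \<epsilon>"
      by (rule orthant_closure_sum_le[OF H(3)[OF h] uv(2)[OF \<epsilon>] x])
    also have "\<bar>\<Sum>i\<in>I. u \<epsilon> i * h (x i)\<bar> \<le> (\<Sum>i\<in>I. \<bar>u \<epsilon> i\<bar> * \<bar>h (x i)\<bar>)"
      using sum_abs[of "\<lambda>i. u \<epsilon> i * h (x i)" I] by (simp add: abs_mult)
    also have "\<dots> \<le> L2_set (u \<epsilon>) I * L2_set (\<lambda>i. h (x i)) I" by (rule L2_set_mult_ineq)
    also have "\<dots> \<le> L2_set (u \<epsilon>) I * \<delta>" by (intro mult_left_mono H(4) h) auto
    finally show "\<bar>\<Sum>i\<in>I. \<epsilon> i * (w i * h (x i))\<bar> \<le> \<delta> * L2_set (u \<epsilon>) I + V * M \<epsilon>"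
      by (simp add: mult.commute)
  qed
  also have "\<dots> \<le> \<delta> * A + V * B"
    unfolding rad_mean_add rad_mean_cmult by (intro add_mono mult_left_mono uv V \<delta>)
  finally show ?thesis .
qed

section \<open>The localized deviation inequality\<close>

definition rate_const :: "nat \<Rightarrow> real" where
  "rate_const d = 40 * 3 ^ d * (2 * real d + 1)"

lemma rate_const_pos: "0 < rate_const d"
  unfolding rate_const_def by simp

context prob_space
begin

\<comment> \<open>Otherwise \<open>{1..n}\<close> is simplified to \<open>{Suc 0..n}\<close>, and interpreted facts about products over
  \<open>{1..n}\<close> no longer apply.\<close>

context
  notes One_nat_def [simp del]
begin

text \<open>For each sample, \<open>sign_split_rate\<close> and \<open>rad_mean_sup_le\<close> bound
  the sign average. The radius \<open>s\<close> may depend on the sample and only its mean survives,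
  which leaves it free to be estimated later from the same inequality.\<close>

lemma
  fixes X :: "'a \<Rightarrow> real ^ 'd"
  assumes n: "3 \<le> n" and R: "0 < R" "R \<le> 1" "ln (real n) \<le> real n * R"
    and X: "\<And>z. z \<in> space M \<Longrightarrow> X z \<in> unit_cube"
    and G: "finite G" "G \<noteq> {}" "\<And>g. g \<in> G \<Longrightarrow> g \<in> orthant_closure U"
      "\<And>g. g \<in> G \<Longrightarrow> (\<lambda>z. g (X z)) \<in> borel_measurable M"
    and W: "W \<in> borel_measurable M" "\<And>z. z \<in> space M \<Longrightarrow> \<bar>W z\<bar> \<le> 1"
    and s: "integrable (PiM {1..n} (\<lambda>_. M)) s"
      "\<And>z g. z \<in> space (PiM {1..n} (\<lambda>_. M)) \<Longrightarrow> g \<in> G \<Longrightarrow> L2_set (\<lambda>i. g (X (z i))) {1..n} \<le> s z"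
  defines "m \<equiv> ln (real n) ^ (CARD('d) - 1)"
  shows integrable_deviation: "integrable (PiM {1..n} (\<lambda>_. M))
      (\<lambda>z. MAX g\<in>G. \<bar>(\<Sum>i\<in>{1..n}. W (z i) * g (X (z i))) - real n * (\<integral>x. W x * g (X x) \<partial>M)\<bar>)"
    and expected_deviation_le: "(\<integral>z. (MAX g\<in>G. \<bar>(\<Sum>i\<in>{1..n}. W (z i) * g (X (z i))) - real n * (\<integral>x. W x * g (X x) \<partial>M)\<bar>) \<partial>PiM {1..n} (\<lambda>_. M))
      \<le> 2 * (rate_const CARD('d) * m / sqrt R * (\<integral>z. s z \<partial>PiM {1..n} (\<lambda>_. M)) + U * (rate_const CARD('d) * m * sqrt (n * R)))"
proof -
  let ?P = "PiM {1..n} (\<lambda>_. M)"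
  let ?\<phi> = "\<lambda>g z. W z * g (X z)"
  let ?r = "\<lambda>z. rad_mean {1..n} (\<lambda>\<epsilon>. MAX g\<in>G. \<bar>\<Sum>i\<in>{1..n}. \<epsilon> i * ?\<phi> g (z i)\<bar>)"
  interpret P: prob_space ?P by (rule prob_space_PiM) (rule prob_space_axioms)
  have \<phi>: "?\<phi> g \<in> borel_measurable M" if "g \<in> G" for g
    using that by (intro borel_measurable_times W G)
  have \<phi>B: "\<bar>?\<phi> g z\<bar> \<le> U" if "g \<in> G" "z \<in> space M" for g z
  proof -
    have "\<bar>W z\<bar> * \<bar>g (X z)\<bar> \<le> 1 * U"
      by (intro mult_mono W orthant_closure_bound G X that) auto
    thus ?thesis by (simp add: abs_mult)
  qed
  show "integrable ?P (\<lambda>z. MAX g\<in>G. \<bar>(\<Sum>i\<in>{1..n}. ?\<phi> g (z i)) - real n * (\<integral>x. ?\<phi> g x \<partial>M)\<bar>)"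
    by (rule integrable_MAX_deviation[OF G(1,2) \<phi> \<phi>B])
  have "(\<integral>z. (MAX g\<in>G. \<bar>(\<Sum>i\<in>{1..n}. ?\<phi> g (z i)) - real n * (\<integral>x. ?\<phi> g x \<partial>M)\<bar>) \<partial>?P) \<le> 2 * (\<integral>z. ?r z \<partial>?P)"
    by (rule symmetrization[OF G(1,2) \<phi> \<phi>B])
  also have "(\<integral>z. ?r z \<partial>?P) \<le> (\<integral>z. s z * (rate_const CARD('d) * m / sqrt R) + U * (rate_const CARD('d) * m * sqrt (n * R)) \<partial>?P)"
  proof (rule integral_mono)
    show "integrable ?P ?r" by (rule integrable_rad_mean_MAX[OF G(1,2) \<phi> \<phi>B])
    show "integrable ?P (\<lambda>z. s z * (rate_const CARD('d) * m / sqrt R) + U * (rate_const CARD('d) * m * sqrt (n * R)))"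
      using s(1) by auto
    fix z assume z: "z \<in> space ?P"
    hence zM: "z i \<in> space M" if "i \<in> {1..n}" for i using that by (auto simp: space_PiM PiE_iff)
    have "sign_split {1..n} (\<lambda>i. X (z i)) (\<lambda>i. W (z i)) (rate_const CARD('d) * m / sqrt R) (rate_const CARD('d) * m * sqrt (n * R))"
      unfolding m_def rate_const_def using W(2) zM by (intro sign_split_rate n R) auto
    thus "?r z \<le> s z * (rate_const CARD('d) * m / sqrt R) + U * (rate_const CARD('d) * m * sqrt (n * R))"
      by (rule rad_mean_sup_le) (use X zM G s(2)[OF z] in auto)
  qed
  also have "\<dots> = (rate_const CARD('d) * m / sqrt R) * (\<integral>z. s z \<partial>?P) + U * (rate_const CARD('d) * m * sqrt (n * R))"
    using s(1) by (simp add: P.prob_space)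
  finally show "(\<integral>z. (MAX g\<in>G. \<bar>(\<Sum>i\<in>{1..n}. ?\<phi> g (z i)) - real n * (\<integral>x. ?\<phi> g x \<partial>M)\<bar>) \<partial>?P)
      \<le> 2 * (rate_const CARD('d) * m / sqrt R * (\<integral>z. s z \<partial>?P) + U * (rate_const CARD('d) * m * sqrt (n * R)))"
    by simp
qed

text \<open>Jensen's inequality, read off from the nonnegative variance of the square root.\<close>

lemma expectation_sqrt_le:
  assumes "integrable M f" "\<And>x. x \<in> space M \<Longrightarrow> 0 \<le> f x"
  shows "integrable M (\<lambda>x. sqrt (f x))" "expectation (\<lambda>x. sqrt (f x)) \<le> sqrt (expectation f)"
proof -
  show int: "integrable M (\<lambda>x. sqrt (f x))"
  proof (rule Bochner_Integration.integrable_bound)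
    show "integrable M (\<lambda>x. 1 + f x)" using assms(1) by simp
    have "sqrt y \<le> 1 + y" if "0 \<le> y" for y :: real
    proof (rule real_le_lsqrt)
      show "y \<le> (1 + y)\<^sup>2" using that by (simp add: power2_eq_square algebra_simps)
    qed (use that in auto)
    thus "AE x in M. norm (sqrt (f x)) \<le> norm (1 + f x)" using assms(2) by (intro AE_I2) auto
  qed (use assms(1) in measurable)
  have sq: "expectation (\<lambda>x. (sqrt (f x))\<^sup>2) = expectation f"
    using assms(2) by (intro Bochner_Integration.integral_cong) auto
  have "integrable M (\<lambda>x. (sqrt (f x))\<^sup>2) \<longleftrightarrow> integrable M f"
    using assms(2) by (intro Bochner_Integration.integrable_cong) auto
  hence "0 \<le> expectation f - (expectation (\<lambda>x. sqrt (f x)))\<^sup>2"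
    using variance_eq[OF int] variance_positive[of "\<lambda>x. sqrt (f x)"] assms(1) sq by simp
  thus "expectation (\<lambda>x. sqrt (f x)) \<le> sqrt (expectation f)"
    by (intro real_le_rsqrt) simp
qed

text \<open>The population norm of \<open>H\<close> is bounded, but symmetrization needs the
  empirical one. Applied to the squares, the deviation bound yields a quadratic inequality for the
  mean empirical radius, which bounds it by a multiple of \<open>R\<close>; Markov's inequality then
  finishes. \<open>\<kappa>\<close> measures how far the stochastic order lies below
  \<open>n * R^2\<close>.\<close>

lemma deviation_prob_le:
  fixes X :: "'a \<Rightarrow> real ^ 'd"
  assumes n: "3 \<le> n" and R: "0 < R" "R \<le> 1" "ln (real n) \<le> real n * R"
    and \<kappa>: "0 \<le> \<kappa>" "\<kappa> \<le> 1" "ln (real n) ^ (CARD('d) - 1) \<le> \<kappa> * (sqrt n * (R * sqrt R))"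
    and X: "\<And>z. z \<in> space M \<Longrightarrow> X z \<in> unit_cube"
    and H: "finite H" "\<And>h. h \<in> H \<Longrightarrow> h \<in> orthant_closure V"
      "\<And>h. h \<in> H \<Longrightarrow> (\<lambda>z. h (X z)) \<in> borel_measurable M"
      "\<And>h. h \<in> H \<Longrightarrow> (\<integral>z. (h (X z))\<^sup>2 \<partial>M) \<le> (2 * R)\<^sup>2"
    and W: "W \<in> borel_measurable M" "\<And>z. z \<in> space M \<Longrightarrow> \<bar>W z\<bar> \<le> 1"
    and V: "1 \<le> V" and D: "0 \<le> D"
  defines "c \<equiv> rate_const CARD('d)"
  shows "measure (PiM {1..n} (\<lambda>_. M)) {z \<in> space (PiM {1..n} (\<lambda>_. M)). \<exists>h\<in>H. real n * R\<^sup>2 / 2 \<le>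
      D * \<bar>(\<Sum>i\<in>{1..n}. W (z i) * h (X (z i))) - real n * (\<integral>x. W x * h (X x) \<partial>M)\<bar> +
      \<bar>(\<Sum>i\<in>{1..n}. (h (X (z i)))\<^sup>2) - real n * (\<integral>x. (h (X x))\<^sup>2 \<partial>M)\<bar>}
    \<le> 4 * c * (D + V) * (4 + 2 * c * V\<^sup>2 + 2 * c * V + V) * \<kappa>"
proof (cases "H = {}")
  case True
  have "0 < c" unfolding c_def by (rule rate_const_pos)
  thus ?thesis using True V D \<kappa> by simp
next
  case False
  let ?P = "PiM {1..n} (\<lambda>_. M)"
  interpret P: prob_space ?P by (rule prob_space_PiM) (rule prob_space_axioms)
  have c: "0 < c" unfolding c_def by (rule rate_const_pos)
  define m where "m = ln (real n) ^ (CARD('d) - 1)"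
  have sn: "0 < sqrt n" "sqrt n * sqrt n = n" using n by auto
  have sR: "0 < sqrt R" "sqrt R * sqrt R = R" using R by auto
  define \<Delta> where "\<Delta> z = (MAX h\<in>H. \<Sum>i\<in>{1..n}. (h (X (z i)))\<^sup>2)" for z
  define G where "G = (\<lambda>h x. h x * h x) ` H"
  define T1 where "T1 z = (MAX h\<in>H. \<bar>(\<Sum>i\<in>{1..n}. W (z i) * h (X (z i))) - real n * (\<integral>x. W x * h (X x) \<partial>M)\<bar>)" for z
  define T2 where "T2 z = (MAX g\<in>G. \<bar>(\<Sum>i\<in>{1..n}. 1 * g (X (z i))) - real n * (\<integral>x. 1 * g (X x) \<partial>M)\<bar>)" for z
  have zM: "z i \<in> space M" if "z \<in> space ?P" "i \<in> {1..n}" for z i using that by (auto simp: space_PiM PiE_iff)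
  have hm: "(\<lambda>z. h (X (z i))) \<in> borel_measurable ?P" if "h \<in> H" "i \<in> {1..n}" for h i
    using measurable_compose[OF measurable_component_singleton[OF that(2), of "\<lambda>_. M"] H(3)[OF that(1)]] .
  have hB: "\<bar>h (X z)\<bar> \<le> V" if "h \<in> H" "z \<in> space M" for h z
    by (intro orthant_closure_bound H X that)
  have \<Delta>_ge: "(\<Sum>i\<in>{1..n}. (h (X (z i)))\<^sup>2) \<le> \<Delta> z" if "h \<in> H" for h z
    unfolding \<Delta>_def by (rule le_MAX[OF H(1) that])
  have \<Delta>0: "0 \<le> \<Delta> z" for z
  proof -
    obtain h where h: "h \<in> H" using False by blast
    have "0 \<le> (\<Sum>i\<in>{1..n}. (h (X (z i)))\<^sup>2)" by (simp add: sum_nonneg)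
    thus ?thesis using \<Delta>_ge[OF h, of z] by linarith
  qed
  have \<Delta>int: "integrable ?P \<Delta>"
  proof (rule P.integrable_const_bound[where B = "n * V\<^sup>2"])
    show "AE z in ?P. norm (\<Delta> z) \<le> n * V\<^sup>2"
    proof (rule AE_I2)
      fix z assume z: "z \<in> space ?P"
      have "\<Delta> z \<le> n * V\<^sup>2"
        unfolding \<Delta>_def
      proof (rule MAX_leI[OF H(1) False])
        fix h assume h: "h \<in> H"
        have "(\<Sum>i\<in>{1..n}. (h (X (z i)))\<^sup>2) \<le> (\<Sum>i\<in>{1..n}. V\<^sup>2)"
          using hB[OF h zM[OF z]] V by (intro sum_mono abs_le_square_iff[THEN iffD1]) auto
        thus "(\<Sum>i\<in>{1..n}. (h (X (z i)))\<^sup>2) \<le> n * V\<^sup>2" by simp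
      qed
      thus "norm (\<Delta> z) \<le> n * V\<^sup>2" using \<Delta>0 by simp
    qed
    show "\<Delta> \<in> borel_measurable ?P"
      unfolding \<Delta>_def using H(1) by (intro borel_measurable_Max borel_measurable_sum borel_measurable_power hm) auto
  qed
  note sqrt\<Delta> = P.expectation_sqrt_le[OF \<Delta>int \<Delta>0]
  \<comment> \<open>The mean empirical radius per observation; the aim is
    \<open>s \<le> b * R\<close>.\<close>
  define s where "s = sqrt (P.expectation \<Delta>) / sqrt n"
  have E0: "0 \<le> P.expectation \<Delta>" using \<Delta>0 by (intro Bochner_Integration.integral_nonneg) auto
  have s0: "0 \<le> s" unfolding s_def using E0 by simp
  have s: "P.expectation \<Delta> = n * s\<^sup>2" "P.expectation (\<lambda>z. sqrt (\<Delta> z)) \<le> sqrt n * s"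
    using E0 n sqrt\<Delta>(2) unfolding s_def by (auto simp: power_divide)
  have L2h: "L2_set (\<lambda>i. h (X (z i))) {1..n} \<le> sqrt (\<Delta> z)" if "h \<in> H" for h z
    unfolding L2_set_def by (intro real_sqrt_le_mono \<Delta>_ge that)
  \<comment> \<open>Here and in \<open>cmn\<close> the third hypothesis on \<open>\<kappa>\<close>
    replaces \<open>m\<close> by \<open>\<kappa> * sqrt n * R^(3/2)\<close>, so that only powers of
    \<open>R\<close> remain.\<close>
  have cmR: "c * m / sqrt R * t \<le> c * \<kappa> * sqrt n * R * t" if "0 \<le> t" for t
  proof -
    have "m / sqrt R \<le> \<kappa> * sqrt n * R"
      using \<kappa>(3) sR(1) by (simp add: m_def divide_le_eq mult.assoc)
    hence "(c * t) * (m / sqrt R) \<le> (c * t) * (\<kappa> * sqrt n * R)" using that c by (intro mult_left_mono) auto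
    thus ?thesis by (simp add: mult_ac)
  qed
  have cmn: "c * m * sqrt (n * R) \<le> c * \<kappa> * n * R\<^sup>2"
  proof -
    have "c * m * sqrt (n * R) \<le> c * (\<kappa> * (sqrt n * (R * sqrt R))) * sqrt (n * R)"
      using \<kappa>(3) c R by (intro mult_right_mono mult_left_mono) (auto simp: m_def)
    also have "\<dots> = c * \<kappa> * (sqrt n * sqrt n) * R * (sqrt R * sqrt R)" by (simp only: real_sqrt_mult mult_ac)
    also have "\<dots> = c * \<kappa> * n * R\<^sup>2" unfolding sn sR by (simp add: power2_eq_square)
    finally show ?thesis .
  qed
  have T1: "integrable ?P T1" "P.expectation T1 \<le> 2 * (c * \<kappa> * n * R * s + V * (c * \<kappa> * n * R\<^sup>2))"
  proof -
    note asm = n R X H(1) False H(2,3) W sqrt\<Delta>(1) L2h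
    show "integrable ?P T1" unfolding T1_def by (rule integrable_deviation[where X = X and G = H and W = W and s = "\<lambda>z. sqrt (\<Delta> z)" and n = n and R = R and U = V, OF asm])
    have "P.expectation T1 \<le> 2 * (c * m / sqrt R * P.expectation (\<lambda>z. sqrt (\<Delta> z)) + V * (c * m * sqrt (n * R)))"
      unfolding T1_def c_def m_def by (rule expected_deviation_le[where X = X and G = H and W = W and s = "\<lambda>z. sqrt (\<Delta> z)" and n = n and R = R and U = V, OF asm])
    also have "\<dots> \<le> 2 * (c * \<kappa> * sqrt n * R * (sqrt n * s) + V * (c * \<kappa> * n * R\<^sup>2))"
    proof (intro mult_left_mono add_mono cmn)
      have "c * m / sqrt R * P.expectation (\<lambda>z. sqrt (\<Delta> z)) \<le> c * \<kappa> * sqrt n * R * P.expectation (\<lambda>z. sqrt (\<Delta> z))"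
        by (intro cmR Bochner_Integration.integral_nonneg) (simp add: \<Delta>0)
      also have "\<dots> \<le> c * \<kappa> * sqrt n * R * (sqrt n * s)"
        using c \<kappa> R by (intro mult_left_mono s) auto
      finally show "c * m / sqrt R * P.expectation (\<lambda>z. sqrt (\<Delta> z)) \<le> c * \<kappa> * sqrt n * R * (sqrt n * s)" .
    qed (use V in auto)
    also have "\<dots> = 2 * (c * \<kappa> * (sqrt n * sqrt n) * R * s + V * (c * \<kappa> * n * R\<^sup>2))" by (simp add: mult_ac)
    finally show "P.expectation T1 \<le> 2 * (c * \<kappa> * n * R * s + V * (c * \<kappa> * n * R\<^sup>2))" unfolding sn .
  qed
  have T2: "integrable ?P T2" "P.expectation T2 \<le> 2 * (c * \<kappa> * n * R * (V * s) + V\<^sup>2 * (c * \<kappa> * n * R\<^sup>2))"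
  proof -
    have G: "finite G" "G \<noteq> {}" unfolding G_def using H(1) False by auto
    have GV: "g \<in> orthant_closure (V\<^sup>2)" if "g \<in> G" for g
      using that H(2) unfolding G_def power2_eq_square by (auto intro: orthant_closure_mult)
    have Gm: "(\<lambda>z. g (X z)) \<in> borel_measurable M" if "g \<in> G" for g
      using that H(3) unfolding G_def by auto
    \<comment> \<open>Since \<open>h^2 \<le> V * \<bar>h\<bar>\<close>, the empirical norm of a
      square is controlled by that of \<open>h\<close>.\<close>
    have L2g: "L2_set (\<lambda>i. g (X (z i))) {1..n} \<le> V * sqrt (\<Delta> z)" if zP: "z \<in> space ?P" and gG: "g \<in> G" for z g
    proof -
      obtain h where h: "h \<in> H" "g = (\<lambda>x. h x * h x)" using gG unfolding G_def by blast
      have "L2_set (\<lambda>i. g (X (z i))) {1..n} \<le> L2_set (\<lambda>i. V * \<bar>h (X (z i))\<bar>) {1..n}"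
      proof (rule L2_set_mono)
        fix i assume "i \<in> {1..n}"
        hence "\<bar>h (X (z i))\<bar> * \<bar>h (X (z i))\<bar> \<le> V * \<bar>h (X (z i))\<bar>"
          by (intro mult_right_mono hB h zM zP) auto
        thus "g (X (z i)) \<le> V * \<bar>h (X (z i))\<bar>" by (simp add: h)
      qed (simp add: h)
      also have "\<dots> = V * L2_set (\<lambda>i. h (X (z i))) {1..n}"
        using V by (simp add: L2_set_def power_mult_distrib real_sqrt_mult flip: sum_distrib_left)
      also have "\<dots> \<le> V * sqrt (\<Delta> z)" using V L2h[OF h(1), of z] by (intro mult_left_mono) auto
      finally show ?thesis .
    qed
    have one: "(\<lambda>_. 1) \<in> borel_measurable M" "\<And>z. z \<in> space M \<Longrightarrow> \<bar>1 :: real\<bar> \<le> 1" by auto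
    have Vs: "integrable ?P (\<lambda>z. V * sqrt (\<Delta> z))" using sqrt\<Delta>(1) by simp
    note asm = n R X G GV Gm one Vs L2g
    show "integrable ?P T2" unfolding T2_def by (rule integrable_deviation[where X = X and G = G and W = "\<lambda>_. 1" and s = "\<lambda>z. V * sqrt (\<Delta> z)" and n = n and R = R and U = "V\<^sup>2", OF asm])
    have "P.expectation T2 \<le> 2 * (c * m / sqrt R * P.expectation (\<lambda>z. V * sqrt (\<Delta> z)) + V\<^sup>2 * (c * m * sqrt (n * R)))"
      unfolding T2_def c_def m_def by (rule expected_deviation_le[where X = X and G = G and W = "\<lambda>_. 1" and s = "\<lambda>z. V * sqrt (\<Delta> z)" and n = n and R = R and U = "V\<^sup>2", OF asm])
    also have "\<dots> \<le> 2 * (c * \<kappa> * sqrt n * R * (V * (sqrt n * s)) + V\<^sup>2 * (c * \<kappa> * n * R\<^sup>2))"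
    proof (intro mult_left_mono add_mono cmn)
      have "c * m / sqrt R * P.expectation (\<lambda>z. V * sqrt (\<Delta> z)) \<le> c * \<kappa> * sqrt n * R * P.expectation (\<lambda>z. V * sqrt (\<Delta> z))"
        using V by (intro cmR Bochner_Integration.integral_nonneg) (simp add: \<Delta>0)
      also have "\<dots> \<le> c * \<kappa> * sqrt n * R * (V * (sqrt n * s))"
        using c \<kappa> R V s by (intro mult_left_mono) auto
      finally show "c * m / sqrt R * P.expectation (\<lambda>z. V * sqrt (\<Delta> z)) \<le> c * \<kappa> * sqrt n * R * (V * (sqrt n * s))" .
    qed (use V in auto)
    also have "\<dots> = 2 * (c * \<kappa> * (sqrt n * sqrt n) * R * (V * s) + V\<^sup>2 * (c * \<kappa> * n * R\<^sup>2))" by (simp add: mult_ac)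
    finally show "P.expectation T2 \<le> 2 * (c * \<kappa> * n * R * (V * s) + V\<^sup>2 * (c * \<kappa> * n * R\<^sup>2))" unfolding sn .
  qed
  have T2_ge: "\<bar>(\<Sum>i\<in>{1..n}. (h (X (z i)))\<^sup>2) - real n * (\<integral>x. (h (X x))\<^sup>2 \<partial>M)\<bar> \<le> T2 z" if "h \<in> H" for h z
  proof -
    have "(\<lambda>x. h x * h x) \<in> G" "finite G" using that H(1) unfolding G_def by auto
    from le_MAX[OF this(2,1), of "\<lambda>g. \<bar>(\<Sum>i\<in>{1..n}. 1 * g (X (z i))) - real n * (\<integral>x. 1 * g (X x) \<partial>M)\<bar>"]
    show ?thesis unfolding T2_def by (simp add: power2_eq_square)
  qed
  \<comment> \<open>Self-bounding: \<open>\<Delta>\<close> exceeds \<open>n * (2 * R)^2\<close> by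
    at most \<open>T2\<close>, and the mean of \<open>T2\<close> is itself bounded through
    \<open>s\<close>.\<close>
  have "s\<^sup>2 \<le> 4 * R\<^sup>2 + 2 * c * (V * R * s + V\<^sup>2 * R\<^sup>2)"
  proof -
    have "\<Delta> z \<le> 4 * n * R\<^sup>2 + T2 z" for z
      unfolding \<Delta>_def
    proof (rule MAX_leI[OF H(1) False])
      fix h assume h: "h \<in> H"
      have "n * (\<integral>x. (h (X x))\<^sup>2 \<partial>M) \<le> n * (2 * R)\<^sup>2" by (intro mult_left_mono H h) auto
      thus "(\<Sum>i\<in>{1..n}. (h (X (z i)))\<^sup>2) \<le> 4 * n * R\<^sup>2 + T2 z"
        using T2_ge[OF h, of z] by (simp add: power_mult_distrib)
    qed
    hence "P.expectation \<Delta> \<le> P.expectation (\<lambda>z. 4 * n * R\<^sup>2 + T2 z)"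
      using \<Delta>int T2(1) by (intro integral_mono) auto
    also have "\<dots> = 4 * n * R\<^sup>2 + P.expectation T2" using T2(1) by (simp add: P.prob_space)
    also have "\<dots> \<le> 4 * n * R\<^sup>2 + 2 * (c * \<kappa> * n * R * (V * s) + V\<^sup>2 * (c * \<kappa> * n * R\<^sup>2))" using T2(2) by simp
    also have "\<dots> = n * (4 * R\<^sup>2 + 2 * c * \<kappa> * (V * R * s + V\<^sup>2 * R\<^sup>2))" by (simp add: algebra_simps)
    finally have "s\<^sup>2 \<le> 4 * R\<^sup>2 + 2 * c * \<kappa> * (V * R * s + V\<^sup>2 * R\<^sup>2)" using n unfolding s by simp
    also have "\<dots> \<le> 4 * R\<^sup>2 + 2 * c * 1 * (V * R * s + V\<^sup>2 * R\<^sup>2)"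
      using \<kappa> c V R s0 by (intro add_left_mono mult_right_mono mult_left_mono) auto
    finally show ?thesis by simp
  qed
  \<comment> \<open>Chosen so that, once \<open>R \<le> s\<close>, the right-hand side of the
    quadratic inequality is at most \<open>b * R * s\<close>.\<close>
  define b where "b = 4 + 2 * c * V\<^sup>2 + 2 * c * V"
  have b: "1 \<le> b" unfolding b_def using c V by (simp add: add_nonneg_nonneg)
  have sb: "s \<le> b * R"
  proof (rule ccontr)
    assume "\<not> s \<le> b * R"
    hence sb: "b * R < s" by simp
    have "1 * R \<le> b * R" using b R by (intro mult_right_mono) auto
    hence Rs: "R \<le> s" using sb by simp
    have "R * R \<le> R * s" using Rs R by (intro mult_left_mono) auto
    hence R2: "R\<^sup>2 \<le> R * s" by (simp add: power2_eq_square)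
    have "s\<^sup>2 \<le> 4 * R\<^sup>2 + 2 * c * (V * R * s + V\<^sup>2 * R\<^sup>2)" by fact
    also have "\<dots> \<le> 4 * (R * s) + 2 * c * (V * R * s + V\<^sup>2 * (R * s))"
      using R2 c V by (intro add_mono[OF _ mult_left_mono[OF add_mono[OF order_refl]]] mult_left_mono) auto
    also have "\<dots> = (b * R) * s" unfolding b_def by (simp add: algebra_simps)
    finally have "s * s \<le> (b * R) * s" by (simp add: power2_eq_square)
    hence "s \<le> b * R" using Rs R by simp
    thus False using sb by simp
  qed
  have sR2: "c * \<kappa> * n * R * s \<le> c * \<kappa> * n * R\<^sup>2 * b"
  proof -
    have "(c * \<kappa> * n * R) * s \<le> (c * \<kappa> * n * R) * (b * R)" using sb c \<kappa> R by (intro mult_left_mono) auto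
    thus ?thesis by (simp add: power2_eq_square mult_ac)
  qed
  define q where "q = real n * R\<^sup>2 / 2"
  have q: "0 < q" unfolding q_def using n R by simp
  have "P.expectation (\<lambda>z. D * T1 z + T2 z) = D * P.expectation T1 + P.expectation T2"
    using T1 T2 by simp
  also have "\<dots> \<le> D * (2 * (c * \<kappa> * n * R\<^sup>2 * b + V * (c * \<kappa> * n * R\<^sup>2))) + 2 * (V * (c * \<kappa> * n * R\<^sup>2 * b) + V\<^sup>2 * (c * \<kappa> * n * R\<^sup>2))"
  proof (intro add_mono mult_left_mono D)
    show "P.expectation T1 \<le> 2 * (c * \<kappa> * n * R\<^sup>2 * b + V * (c * \<kappa> * n * R\<^sup>2))" using T1(2) sR2 by simp
    have "V * (c * \<kappa> * n * R * s) \<le> V * (c * \<kappa> * n * R\<^sup>2 * b)" using sR2 V by (intro mult_left_mono) auto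
    thus "P.expectation T2 \<le> 2 * (V * (c * \<kappa> * n * R\<^sup>2 * b) + V\<^sup>2 * (c * \<kappa> * n * R\<^sup>2))"
      using T2(2) by (simp add: mult_ac)
  qed
  \<comment> \<open>The four terms factor as
    \<open>2 * c * \<kappa> * n * R^2 * (D + V) * (b + V)\<close>, and \<open>n * R^2\<close> is
    \<open>2 * q\<close>.\<close>
  also have "\<dots> = (4 * c * (D + V) * (b + V) * \<kappa>) * q"
    unfolding q_def by (simp add: algebra_simps power2_eq_square)
  finally have E: "P.expectation (\<lambda>z. D * T1 z + T2 z) \<le> (4 * c * (D + V) * (b + V) * \<kappa>) * q" .
  have T0: "0 \<le> T1 z" "0 \<le> T2 z" for z
  proof -
    obtain h where h: "h \<in> H" using False by blast
    show "0 \<le> T2 z" using T2_ge[OF h, of z] by linarith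
    show "0 \<le> T1 z" unfolding T1_def
      using le_MAX[OF H(1) h, of "\<lambda>h. \<bar>(\<Sum>i\<in>{1..n}. W (z i) * h (X (z i))) - real n * (\<integral>x. W x * h (X x) \<partial>M)\<bar>"] by linarith
  qed
  let ?S = "{z \<in> space ?P. \<exists>h\<in>H. q \<le>
      D * \<bar>(\<Sum>i\<in>{1..n}. W (z i) * h (X (z i))) - real n * (\<integral>x. W x * h (X x) \<partial>M)\<bar> +
      \<bar>(\<Sum>i\<in>{1..n}. (h (X (z i)))\<^sup>2) - real n * (\<integral>x. (h (X x))\<^sup>2 \<partial>M)\<bar>}"
  have [measurable]: "integrable ?P (\<lambda>z. D * T1 z + T2 z)" using T1 T2 by simp
  have "measure ?P ?S \<le> measure ?P {z \<in> space ?P. q \<le> D * T1 z + T2 z}"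
  proof (rule P.finite_measure_mono)
    show "?S \<subseteq> {z \<in> space ?P. q \<le> D * T1 z + T2 z}"
    proof safe
      fix z h assume h: "h \<in> H" and *: "q \<le> D * \<bar>(\<Sum>i\<in>{1..n}. W (z i) * h (X (z i))) - real n * (\<integral>x. W x * h (X x) \<partial>M)\<bar> +
        \<bar>(\<Sum>i\<in>{1..n}. (h (X (z i)))\<^sup>2) - real n * (\<integral>x. (h (X x))\<^sup>2 \<partial>M)\<bar>"
      have "D * \<bar>(\<Sum>i\<in>{1..n}. W (z i) * h (X (z i))) - real n * (\<integral>x. W x * h (X x) \<partial>M)\<bar> \<le> D * T1 z"
        unfolding T1_def by (intro mult_left_mono D le_MAX[OF H(1) h])
      thus "q \<le> D * T1 z + T2 z" using * T2_ge[OF h, of z] by linarith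
    qed
    show "{z \<in> space ?P. q \<le> D * T1 z + T2 z} \<in> sets ?P"
      using T1(1) T2(1) by measurable
  qed
  also have "\<dots> \<le> P.expectation (\<lambda>z. D * T1 z + T2 z) / q"
    by (rule integral_Markov_inequality_measure[where A = "{}"]) (use T1 T2 T0 D q in auto)
  also have "\<dots> \<le> 4 * c * (D + V) * (b + V) * \<kappa>"
    using E q by (simp add: divide_le_eq)
  finally show ?thesis unfolding q_def b_def .
qed

end

end

section \<open>Functions of bounded sectional variation\<close>

lemma signed_measure_Un:
  assumes "signed_measure M \<nu>" "A \<in> sets M" "B \<in> sets M" "A \<inter> B = {}"
  shows "\<nu> (A \<union> B) = \<nu> A + \<nu> B"
proof -
  have 0: "\<nu> {} = 0" using assms(1) unfolding signed_measure_def by blast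
  have "disjoint_family (binaryset A B)"
    using assms(4) by (auto simp: disjoint_family_on_def binaryset_def)
  moreover have "range (binaryset A B) \<subseteq> sets M" using assms by (simp add: range_binaryset_eq)
  ultimately have "(\<lambda>i. \<nu> (binaryset A B i)) sums \<nu> (\<Union>i. binaryset A B i)"
    using assms(1) unfolding signed_measure_def by blast
  thus ?thesis using binaryset_sums[of \<nu> A B, OF 0] sums_unique2 by (simp add: UN_binaryset_eq)
qed

lemma signed_measure_UN:
  assumes "signed_measure M \<nu>" "finite I" "\<And>i. i \<in> I \<Longrightarrow> A i \<in> sets M" "disjoint_family_on A I"
  shows "\<nu> (\<Union>i\<in>I. A i) = (\<Sum>i\<in>I. \<nu> (A i))"
  using assms(2,3,4)
proof (induction I rule: finite_induct)
  case empty
  thus ?case using assms(1) by (simp add: signed_measure_def)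
next
  case (insert i I)
  have "\<nu> (A i \<union> (\<Union>i\<in>I. A i)) = \<nu> (A i) + \<nu> (\<Union>i\<in>I. A i)"
    using insert.prems insert.hyps
    by (intro signed_measure_Un[OF assms(1)]) (auto simp: disjoint_family_on_def)
  thus ?case using insert by (simp add: disjoint_family_on_insert)
qed

text \<open>The differences of consecutive sets fill \<open>A 0\<close> outside the intersection,
  and their values telescope. All values are real, so subtracting them raises no question of
  infinity.\<close>

lemma signed_measure_decseq:
  assumes \<nu>: "signed_measure M \<nu>" and A: "range A \<subseteq> sets M" "decseq A"
  shows "(\<lambda>N. \<nu> (A N)) \<longlonglongrightarrow> \<nu> (\<Inter>N. A N)"
proof -
  define B where "B i = A i - A (Suc i)" for i
  have mono: "A j \<subseteq> A i" if "i \<le> j" for i j using A(2) that by (auto simp: decseq_def)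
  have A_eq: "\<nu> (A i) = \<nu> (A (Suc i)) + \<nu> (B i)" for i
  proof -
    have "\<nu> (A (Suc i) \<union> B i) = \<nu> (A (Suc i)) + \<nu> (B i)"
      unfolding B_def using A by (intro signed_measure_Un[OF \<nu>]) auto
    moreover have "A (Suc i) \<union> B i = A i" unfolding B_def using mono[of i "Suc i"] by auto
    ultimately show ?thesis by simp
  qed
  have "disjoint_family B"
    unfolding disjoint_family_on_def
  proof (intro ballI impI)
    fix i j :: nat assume "i \<noteq> j"
    thus "B i \<inter> B j = {}"
      unfolding B_def using mono[of "Suc i" j] mono[of "Suc j" i] by (cases i j rule: linorder_cases) auto
  qed
  hence "(\<lambda>i. \<nu> (B i)) sums \<nu> (\<Union>i. B i)"
    using \<nu> A(1) unfolding signed_measure_def B_def by (auto simp: image_subset_iff)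
  hence "(\<lambda>N. \<Sum>i<N. \<nu> (B i)) \<longlonglongrightarrow> \<nu> (\<Union>i. B i)" unfolding sums_def .
  moreover have "(\<Sum>i<N. \<nu> (B i)) = \<nu> (A 0) - \<nu> (A N)" for N
  proof (induction N)
    case (Suc N)
    thus ?case using A_eq[of N] by simp
  qed simp
  ultimately have "(\<lambda>N. \<nu> (A 0) - (\<nu> (A 0) - \<nu> (A N))) \<longlonglongrightarrow> \<nu> (A 0) - \<nu> (\<Union>i. B i)"
    by (intro tendsto_diff tendsto_const) simp
  moreover have "\<nu> (A 0) = \<nu> (\<Inter>N. A N) + \<nu> (\<Union>i. B i)"
  proof -
    have "A 0 \<subseteq> (\<Inter>N. A N) \<union> (\<Union>i. B i)"
    proof
      fix x assume x: "x \<in> A 0"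
      show "x \<in> (\<Inter>N. A N) \<union> (\<Union>i. B i)"
      proof (cases "x \<in> (\<Inter>N. A N)")
        case False
        hence ex: "\<exists>N. x \<notin> A N" by blast
        define N where "N = (LEAST N. x \<notin> A N)"
        have "x \<notin> A N" unfolding N_def using ex by (rule LeastI_ex)
        moreover from this x obtain k where "N = Suc k" by (cases N) auto
        moreover from this have "x \<in> A k" using not_less_Least[of k "\<lambda>N. x \<notin> A N"] N_def by auto
        ultimately show ?thesis unfolding B_def by auto
      qed auto
    qed
    hence "A 0 = (\<Inter>N. A N) \<union> (\<Union>i. B i)" unfolding B_def using mono[of 0] by auto
    moreover have "\<nu> ((\<Inter>N. A N) \<union> (\<Union>i. B i)) = \<nu> (\<Inter>N. A N) + \<nu> (\<Union>i. B i)"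
    proof (rule signed_measure_Un[OF \<nu>])
      show "(\<Inter>N. A N) \<in> sets M" using A(1) by (intro sets.countable_INT) auto
      show "(\<Union>i. B i) \<in> sets M" unfolding B_def using A(1) by (intro sets.countable_UN) auto
      show "(\<Inter>N. A N) \<inter> (\<Union>i. B i) = {}" unfolding B_def by auto
    qed
    ultimately show ?thesis by simp
  qed
  ultimately show ?thesis by simp
qed

lemma sum_abs_le_total_variation:
  assumes \<nu>: "\<nu> {} = 0" and I: "finite I" "\<And>i. i \<in> I \<Longrightarrow> E i \<in> sets M" "disjoint_family_on E I" "(\<Union>i\<in>I. E i) = A"
  shows "ennreal (\<Sum>i\<in>I. \<bar>\<nu> (E i)\<bar>) \<le> total_variation M \<nu> A"
proof -
  \<comment> \<open>Empty pieces may coincide under different indices. Without them \<open>E\<close>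
    is injective, so that the sum over indices is a sum over a set of pieces.\<close>
  define J where "J = {i \<in> I. E i \<noteq> {}}"
  have inj: "inj_on E J"
    using I(3) unfolding J_def inj_on_def disjoint_family_on_def by blast
  have "(\<Sum>i\<in>I. \<bar>\<nu> (E i)\<bar>) = (\<Sum>i\<in>J. \<bar>\<nu> (E i)\<bar>)"
    unfolding J_def using I(1) \<nu> by (intro sum.mono_neutral_right) auto
  also have "\<dots> = (\<Sum>B\<in>E ` J. \<bar>\<nu> B\<bar>)" using inj by (simp add: sum.reindex)
  finally have "ennreal (\<Sum>i\<in>I. \<bar>\<nu> (E i)\<bar>) = (\<Sum>B\<in>E ` J. ennreal \<bar>\<nu> B\<bar>)" by simp
  also have "\<dots> \<le> total_variation M \<nu> A"
    unfolding total_variation_def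
  proof (rule SUP_upper, intro CollectI conjI)
    show "finite (E ` J)" unfolding J_def using I(1) by simp
    show "E ` J \<subseteq> sets M" unfolding J_def using I(2) by auto
    show "disjoint (E ` J)"
    proof (rule disjointI)
      fix B B' assume "B \<in> E ` J" "B' \<in> E ` J" "B \<noteq> B'"
      then obtain i i' where "i \<in> I" "i' \<in> I" "B = E i" "B' = E i'" "i \<noteq> i'" unfolding J_def by auto
      thus "B \<inter> B' = {}" using I(3) by (simp add: disjoint_family_on_def)
    qed
    show "\<Union> (E ` J) = A" using I(4) unfolding J_def by auto
  qed
  finally show ?thesis .
qed

text \<open>Rounding down keeps every indicator \<open>a \<le> x\<close> true that was true, and makes the others false
  from some level on; rounding up would fail for \<open>a = x\<close>.\<close>

definition grid_floor :: "nat \<Rightarrow> real ^ 'd \<Rightarrow> real ^ 'd" where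
  "grid_floor N a = (\<chi> j. of_int \<lfloor>2 ^ N * a $ j\<rfloor> / 2 ^ N)"

lemma grid_floor_mono: "grid_floor N a $ j \<le> grid_floor (Suc N) a $ j"
proof -
  have "2 * \<lfloor>2 ^ N * a $ j\<rfloor> \<le> \<lfloor>2 ^ Suc N * a $ j\<rfloor>"
    by (simp add: le_floor_iff)
  hence "2 * of_int \<lfloor>2 ^ N * a $ j\<rfloor> \<le> (of_int \<lfloor>2 ^ Suc N * a $ j\<rfloor> :: real)"
    by (metis of_int_le_iff of_int_mult of_int_numeral)
  thus ?thesis unfolding grid_floor_def by (simp add: field_simps)
qed

lemma grid_floor_le: "grid_floor N a $ j \<le> a $ j"
proof -
  have "of_int \<lfloor>2 ^ N * a $ j\<rfloor> \<le> 2 ^ N * a $ j" by (rule of_int_floor_le)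
  thus ?thesis unfolding grid_floor_def by (simp add: field_simps)
qed

lemma le_of_grid_floor_le:
  assumes "\<And>N. grid_floor N a $ j \<le> y"
  shows "a $ j \<le> y"
proof -
  have "a $ j \<le> y + (1/2) ^ N" for N
  proof -
    have "2 ^ N * a $ j < of_int \<lfloor>2 ^ N * a $ j\<rfloor> + 1" by linarith
    hence "a $ j < grid_floor N a $ j + (1/2) ^ N"
      unfolding grid_floor_def by (simp add: field_simps power_divide)
    thus ?thesis using assms[of N] by linarith
  qed
  moreover have "(\<lambda>N. y + (1/2) ^ N) \<longlonglongrightarrow> y + 0"
    by (intro tendsto_add tendsto_const LIMSEQ_power_zero) auto
  ultimately show ?thesis by (intro LIMSEQ_le_const[of _ y]) auto
qed

definition grid :: "nat \<Rightarrow> (real ^ 'd) set" where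
  "grid N = vec_lambda ` (PiE UNIV (\<lambda>_. (\<lambda>k. real k / 2 ^ N) ` {..2 ^ N}))"

lemma finite_grid: "finite (grid N :: (real ^ 'd) set)"
  unfolding grid_def by (intro finite_imageI finite_PiE) auto

lemma grid_floor_in_grid: "a \<in> unit_cube \<Longrightarrow> grid_floor N a \<in> grid N"
proof -
  assume a: "a \<in> unit_cube"
  have "of_int \<lfloor>2 ^ N * a $ j\<rfloor> / 2 ^ N \<in> (\<lambda>k. real k / 2 ^ N) ` {..2 ^ N}" for j
  proof (intro image_eqI)
    have a01: "0 \<le> a $ j" "a $ j \<le> 1" using a by (auto simp: unit_cube_def)
    thus "of_int \<lfloor>2 ^ N * a $ j\<rfloor> / 2 ^ N = real (nat \<lfloor>2 ^ N * a $ j\<rfloor>) / 2 ^ N" by simp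
    have "2 ^ N * a $ j \<le> 2 ^ N" using a01 by (simp add: mult_left_le)
    from floor_mono[OF this] have "\<lfloor>2 ^ N * a $ j\<rfloor> \<le> 2 ^ N" by simp
    thus "nat \<lfloor>2 ^ N * a $ j\<rfloor> \<in> {..2 ^ N}" by (simp add: nat_le_iff)
  qed
  thus ?thesis unfolding grid_def grid_floor_def by (intro imageI) auto
qed

lemma grid_rational: "p \<in> grid N \<Longrightarrow> p $ j \<in> \<rat>"
proof -
  assume "p \<in> grid N"
  then obtain k :: nat where "p $ j = real k / 2 ^ N" unfolding grid_def by (auto simp: PiE_iff image_iff) metis
  thus ?thesis by simp
qed

lemma face_subset_unit_cube: "face s \<subseteq> unit_cube"
  unfolding face_def unit_cube_def
  by (auto split: if_splits simp: less_imp_le) (metis order.refl less_imp_le zero_le_one)+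

lemma grid_floor_measurable [measurable]: "grid_floor N \<in> borel_measurable borel"
proof -
  have "(\<lambda>a. grid_floor N a $ j) \<in> borel_measurable borel" for j
    unfolding grid_floor_def by simp
  thus ?thesis by (subst borel_measurable_euclidean_space) (auto simp: Basis_vec_def inner_axis)
qed

definition grid_list :: "nat \<Rightarrow> (real ^ 'd) list" where
  "grid_list N = (SOME l. set l = grid N \<and> distinct l)"

lemma grid_list: "set (grid_list N) = (grid N :: (real ^ 'd) set)" "distinct (grid_list N :: (real ^ 'd) list)"
proof -
  have "set (grid_list N) = (grid N :: (real ^ 'd) set) \<and> distinct (grid_list N :: (real ^ 'd) list)"
    unfolding grid_list_def
    by (rule someI_ex[of "\<lambda>l. set l = grid N \<and> distinct l"]) (rule finite_distinct_list[OF finite_grid])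
  thus "set (grid_list N) = (grid N :: (real ^ 'd) set)" "distinct (grid_list N :: (real ^ 'd) list)" by blast+
qed

text \<open>The measure with all its mass rounded down to the grid, written as a combination of
  orthants.\<close>

definition grid_comb :: "'d set \<Rightarrow> ((real ^ 'd) set \<Rightarrow> real) \<Rightarrow> nat \<Rightarrow> (real \<times> (real ^ 'd)) list" where
  "grid_comb s \<nu> N = map (\<lambda>p. (\<nu> {a \<in> face s. grid_floor N a = p}, p)) (grid_list N)"

lemma sum_list_grid: "(\<Sum>p\<leftarrow>grid_list N. g p) = (\<Sum>p\<in>grid N. g p)" for g :: "real ^ 'd \<Rightarrow> real"
  using sum_list_distinct_conv_sum_set[OF grid_list(2), of g N] by (simp add: grid_list)

text \<open>The grid cells partition the face, which bounds the weight by the total variation. The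
  value at \<open>x\<close> is the measure of the points whose rounding is below \<open>x\<close>,
  and these sets decrease to the points below \<open>x\<close>.\<close>

lemma
  assumes \<nu>: "signed_measure (restrict_space borel (face s)) \<nu>"
  shows weight_grid_comb: "ennreal (weight (grid_comb s \<nu> N)) \<le> total_variation (restrict_space borel (face s)) \<nu> (face s)"
    and lincomb_grid_comb: "x \<in> unit_cube \<Longrightarrow> (\<lambda>N. lincomb (grid_comb s \<nu> N) x) \<longlonglongrightarrow> \<nu> {a \<in> face s. \<forall>j. a $ j \<le> x $ j}"
proof -
  let ?M = "restrict_space borel (face s)"
  let ?E = "\<lambda>N p. {a \<in> face s. grid_floor N a = p}"
  have sets: "A \<inter> face s \<in> sets ?M" if "A \<in> sets borel" for A
    using that by (auto simp: sets_restrict_space)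
  have E: "?E N p \<in> sets ?M" for N p
    using sets[of "{a. grid_floor N a = p}"] by (simp add: Int_def conj_commute)
  have disj: "disjoint_family_on (?E N) I" for N I by (auto simp: disjoint_family_on_def)
  have "weight (grid_comb s \<nu> N) = (\<Sum>p\<in>grid N. \<bar>\<nu> (?E N p)\<bar>)"
    unfolding weight_def grid_comb_def by (simp add: comp_def sum_list_grid)
  moreover have "(\<Union>p\<in>grid N. ?E N p) = face s"
    using grid_floor_in_grid face_subset_unit_cube by blast
  ultimately show "ennreal (weight (grid_comb s \<nu> N)) \<le> total_variation ?M \<nu> (face s)"
    using sum_abs_le_total_variation[of \<nu> "grid N" "?E N" ?M "face s"] E disj \<nu>
    by (simp add: signed_measure_def finite_grid)
  assume x: "x \<in> unit_cube"
  define A where "A N = {a \<in> face s. \<forall>j. grid_floor N a $ j \<le> x $ j}" for N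
  have "lincomb (grid_comb s \<nu> N) x = \<nu> (A N)" for N
  proof -
    have "lincomb (grid_comb s \<nu> N) x = (\<Sum>p\<in>grid N. \<nu> (?E N p) * orthant p x)"
      unfolding lincomb_def grid_comb_def by (simp add: comp_def sum_list_grid)
    also have "\<dots> = (\<Sum>p\<in>{p \<in> grid N. \<forall>j. p $ j \<le> x $ j}. \<nu> (?E N p))"
      unfolding orthant_def by (intro sum.mono_neutral_cong_right finite_grid) auto
    also have "\<dots> = \<nu> (\<Union>p\<in>{p \<in> grid N. \<forall>j. p $ j \<le> x $ j}. ?E N p)"
      using E disj by (intro signed_measure_UN[OF \<nu>, symmetric]) (auto simp: finite_grid)
    also have "(\<Union>p\<in>{p \<in> grid N. \<forall>j. p $ j \<le> x $ j}. ?E N p) = A N"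
      unfolding A_def using grid_floor_in_grid face_subset_unit_cube by blast
    finally show ?thesis .
  qed
  moreover have "(\<lambda>N. \<nu> (A N)) \<longlonglongrightarrow> \<nu> (\<Inter>N. A N)"
  proof (rule signed_measure_decseq[OF \<nu>])
    have "A N = (\<Inter>j. {a. grid_floor N a $ j \<le> x $ j}) \<inter> face s" for N unfolding A_def by auto
    moreover have "(\<Inter>j. {a. grid_floor N a $ j \<le> x $ j}) \<in> sets borel" for N
    proof (intro sets.countable_INT' countableI_type image_subsetI)
      fix j show "{a. grid_floor N a $ j \<le> x $ j} \<in> sets (borel :: (real ^ 'a) measure)"
        unfolding grid_floor_def by simp
    qed auto
    ultimately show "range A \<subseteq> sets ?M" using sets by auto
    show "decseq A"
      unfolding decseq_Suc_iff A_def using grid_floor_mono order_trans by blast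
  qed
  moreover have "(\<Inter>N. A N) = {a \<in> face s. \<forall>j. a $ j \<le> x $ j}"
  proof -
    have "(\<forall>N. grid_floor N a $ j \<le> x $ j) \<longleftrightarrow> a $ j \<le> x $ j" for a and j :: 'a
      by (meson grid_floor_le le_of_grid_floor_le order_trans)
    thus ?thesis unfolding A_def by auto
  qed
  ultimately show "(\<lambda>N. lincomb (grid_comb s \<nu> N) x) \<longlonglongrightarrow> \<nu> {a \<in> face s. \<forall>j. a $ j \<le> x $ j}" by simp
qed

text \<open>The box with lower corner 0. Outside \<open>s\<close> the points of the face have
  coordinate 0, so those comparisons with \<open>x\<close> hold automatically.\<close>

lemma generated_orthant_value:
  assumes \<nu>: "generated_by_section s f \<nu>" and x: "x \<in> unit_cube"
  shows "\<nu> {a \<in> face s. \<forall>j. a $ j \<le> x $ j}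
    = (\<Sum>t\<in>Pow s. (-1) ^ card t * f (\<chi> j. if j \<in> s - t then x $ j else 0))"
proof -
  have x01: "0 \<le> x $ j" "x $ j \<le> 1" for j using x by (auto simp: unit_cube_def)
  have "{a \<in> face s. \<forall>j. a $ j \<le> x $ j} = {a \<in> face s. \<forall>j\<in>s. (0 :: real ^ 'a) $ j < a $ j \<and> a $ j \<le> x $ j}"
  proof (intro Collect_cong conj_cong refl)
    fix a assume "a \<in> face s"
    hence "if j \<in> s then 0 < a $ j else a $ j = 0" for j unfolding face_def by (auto split: if_splits)
    thus "(\<forall>j. a $ j \<le> x $ j) \<longleftrightarrow> (\<forall>j\<in>s. (0 :: real ^ 'a) $ j < a $ j \<and> a $ j \<le> x $ j)"
      using x01 by (metis zero_index)
  qed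
  also have "\<nu> \<dots> = (\<Sum>t\<in>Pow s. (-1) ^ card t * section_fun s f (\<chi> j. if j \<in> t then (0 :: real ^ 'a) $ j else x $ j))"
  proof -
    have "(0 :: real ^ 'a) \<in> unit_cube" by (simp add: unit_cube_def)
    moreover have "\<forall>j. (0 :: real ^ 'a) $ j \<le> x $ j" using x01 by simp
    ultimately show ?thesis using \<nu> x unfolding generated_by_section_def by blast
  qed
  also have "\<dots> = (\<Sum>t\<in>Pow s. (-1) ^ card t * f (\<chi> j. if j \<in> s - t then x $ j else 0))"
    unfolding section_fun_def
    by (intro sum.cong refl arg_cong2[of _ _ _ _ "(*)"] arg_cong[of _ _ f]) (auto simp: vec_eq_iff)
  finally show ?thesis .
qed

text \<open>Moebius inversion over the set \<open>u\<close> of coordinates that are not replaced by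
  0. It rebuilds \<open>f\<close> from the increments of its sections; the term for
  \<open>s = {}\<close> is \<open>f 0\<close>.\<close>

lemma section_moebius:
  fixes f :: "real ^ 'd \<Rightarrow> real"
  shows "f x = (\<Sum>s\<in>UNIV. \<Sum>t\<in>Pow s. (-1) ^ card t * f (\<chi> j. if j \<in> s - t then x $ j else 0))"
proof -
  define F where "F u = f (\<chi> j. if j \<in> u then x $ j else 0)" for u
  define g where "g S = (\<Sum>T\<in>Pow S. (-1) ^ card T * F T)" for S
  have "F UNIV = (\<Sum>s\<in>Pow UNIV. (-1) ^ card s * g s)"
    by (rule inclusion_exclusion_symmetric) (auto simp: g_def)
  also have "\<dots> = (\<Sum>s\<in>UNIV. \<Sum>t\<in>Pow s. (-1) ^ card t * F (s - t))"
  proof (intro sum.cong)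
    fix s :: "'d set"
    have "(\<Sum>t\<in>Pow s. (-1) ^ card t * F (s - t)) = (\<Sum>u\<in>Pow s. (-1) ^ card (s - u) * F u)"
      by (rule sum.reindex_bij_witness[of _ "\<lambda>u. s - u" "\<lambda>t. s - t"]) (auto simp: double_diff)
    also have "\<dots> = (\<Sum>u\<in>Pow s. (-1) ^ card s * ((-1) ^ card u * F u))"
    proof (intro sum.cong refl)
      fix u assume "u \<in> Pow s"
      hence "(-1::real) ^ card (s - u) = (-1) ^ (card s + card u)"
        by (simp add: card_Diff_subset finite_subset card_mono neg_one_power_add_eq_neg_one_power_diff)
      thus "(-1) ^ card (s - u) * F u = (-1) ^ card s * ((-1) ^ card u * F u)" by (simp add: power_add)
    qed
    finally show "(-1) ^ card s * g s = (\<Sum>t\<in>Pow s. (-1) ^ card t * F (s - t))"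
      by (simp add: g_def sum_distrib_left)
  qed auto
  finally show ?thesis unfolding F_def by simp
qed

text \<open>Each section is represented by the rounded versions of a generating measure. The factor
  2 leaves room for measures whose variation is only close to the infimum.\<close>

lemma cadlag_ball_approx:
  fixes f :: "real ^ 'd \<Rightarrow> real"
  assumes f: "f \<in> cadlag_ball r" and r: "0 < r"
  shows "\<exists>ps. (\<forall>N. weight (ps N) \<le> 2 * r \<and> (\<forall>p\<in>snd ` set (ps N). \<forall>j. p $ j \<in> \<rat>)) \<and>
    (\<forall>x\<in>unit_cube. (\<lambda>N. lincomb (ps N) x) \<longlonglongrightarrow> f x)"
proof -
  let ?S = "UNIV - {{}} :: 'd set set"
  let ?TV = "\<lambda>s \<nu>. total_variation (restrict_space borel (face s)) \<nu> (face s)"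
  have norm: "ennreal \<bar>f 0\<bar> + (\<Sum>s\<in>?S. section_variation s f) \<le> ennreal r"
    using f unfolding cadlag_ball_def sectional_variation_norm_def by simp
  \<comment> \<open>The extra \<open>r\<close> of weight, shared among the sections.\<close>
  define \<eta> where "\<eta> = r / (1 + real (card ?S))"
  have \<eta>: "0 < \<eta>" "real (card ?S) * \<eta> \<le> r"
    unfolding \<eta>_def using r by (auto simp: field_simps add_pos_nonneg)
  have "\<exists>\<nu>. generated_by_section s f \<nu> \<and> ?TV s \<nu> \<le> section_variation s f + ennreal \<eta>" if "s \<in> ?S" for s
  proof -
    have "section_variation s f \<le> (\<Sum>s\<in>?S. section_variation s f)"
      using that by (intro member_le_sum) auto
    also have "\<dots> \<le> ennreal \<bar>f 0\<bar> + (\<Sum>s\<in>?S. section_variation s f)" by simp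
    also note norm
    finally have "section_variation s f < \<top>" using ennreal_less_top le_less_trans by blast
    hence "section_variation s f < section_variation s f + ennreal \<eta>"
      using \<eta>(1) by (cases "section_variation s f" rule: ennreal_cases) (auto simp: ennreal_less_iff simp flip: ennreal_plus)
    thus ?thesis unfolding section_variation_def INF_less_iff by (auto simp: less_imp_le)
  qed
  then obtain \<nu> where \<nu>: "\<And>s. s \<in> ?S \<Longrightarrow> generated_by_section s f (\<nu> s)"
    "\<And>s. s \<in> ?S \<Longrightarrow> ?TV s (\<nu> s) \<le> section_variation s f + ennreal \<eta>" by metis
  have sm: "signed_measure (restrict_space borel (face s)) (\<nu> s)" if "s \<in> ?S" for s
    using \<nu>(1)[OF that] unfolding generated_by_section_def by blast
  obtain l where l: "set l = ?S" "distinct l" using finite_distinct_list[of ?S] by auto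
  define ps where "ps N = (f 0, 0) # concat (map (\<lambda>s. grid_comb s (\<nu> s) N) l)" for N
  have conc: "weight (concat (map G l)) = (\<Sum>s\<in>?S. weight (G s))" "lincomb (concat (map G l)) x = (\<Sum>s\<in>?S. lincomb (G s) x)" for G x
  proof -
    have "weight (concat (map G l)) = (\<Sum>s\<leftarrow>l. weight (G s))" "lincomb (concat (map G l)) x = (\<Sum>s\<leftarrow>l. lincomb (G s) x)"
      by (induction l) auto
    thus "weight (concat (map G l)) = (\<Sum>s\<in>?S. weight (G s))" "lincomb (concat (map G l)) x = (\<Sum>s\<in>?S. lincomb (G s) x)"
      using sum_list_distinct_conv_sum_set[OF l(2)] l(1) by metis+
  qed
  have "weight (ps N) \<le> 2 * r" for N
  proof -
    have "ennreal (weight (ps N)) = ennreal \<bar>f 0\<bar> + (\<Sum>s\<in>?S. ennreal (weight (grid_comb s (\<nu> s) N)))"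
      unfolding ps_def by (simp add: conc ennreal_plus sum_nonneg weight_nonneg)
    also have "\<dots> \<le> ennreal \<bar>f 0\<bar> + (\<Sum>s\<in>?S. section_variation s f + ennreal \<eta>)"
      using weight_grid_comb[OF sm] \<nu>(2) by (intro add_left_mono sum_mono) (meson order_trans)
    also have "\<dots> = (ennreal \<bar>f 0\<bar> + (\<Sum>s\<in>?S. section_variation s f)) + ennreal (real (card ?S) * \<eta>)"
      using \<eta> by (simp add: sum.distrib add.assoc ennreal_of_nat_eq_real_of_nat ennreal_mult del: card_Diff_insert)
    also have "\<dots> \<le> ennreal r + ennreal r" using norm \<eta>(2) by (intro add_mono ennreal_leI)
    also have "\<dots> = ennreal (2 * r)" using r by (simp flip: ennreal_plus)
    finally show ?thesis using r by simp
  qed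
  moreover have "(\<lambda>N. lincomb (ps N) x) \<longlonglongrightarrow> f x" if x: "x \<in> unit_cube" for x
  proof -
    \<comment> \<open>Every point of the cube lies above 0, so the constant \<open>f 0\<close> is a
      multiple of an orthant.\<close>
    have "orthant 0 x = 1" using x by (simp add: orthant_def unit_cube_def)
    hence "(\<lambda>N. lincomb (ps N) x) = (\<lambda>N. f 0 + (\<Sum>s\<in>?S. lincomb (grid_comb s (\<nu> s) N) x))"
      unfolding ps_def by (simp add: conc)
    moreover have "(\<lambda>N. f 0 + (\<Sum>s\<in>?S. lincomb (grid_comb s (\<nu> s) N) x))
       \<longlonglongrightarrow> f 0 + (\<Sum>s\<in>?S. \<Sum>t\<in>Pow s. (-1) ^ card t * f (\<chi> j. if j \<in> s - t then x $ j else 0))"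
      using lincomb_grid_comb[OF sm x] generated_orthant_value[OF \<nu>(1) x]
      by (intro tendsto_intros) auto
    moreover have "f 0 + (\<Sum>s\<in>?S. \<Sum>t\<in>Pow s. (-1) ^ card t * f (\<chi> j. if j \<in> s - t then x $ j else 0)) = f x"
    proof -
      have "(\<chi> j. 0) = (0 :: real ^ 'd)" by (simp add: vec_eq_iff)
      thus ?thesis by (subst (2) section_moebius) (simp add: sum.remove[of UNIV "{}"])
    qed
    ultimately show ?thesis by simp
  qed
  moreover have "\<forall>p\<in>snd ` set (ps N). \<forall>j. p $ j \<in> \<rat>" for N
    unfolding ps_def grid_comb_def using grid_rational by (auto simp: grid_list)
  ultimately show ?thesis by blast
qed

lemma cadlag_ball_subset_orthant_closure:
  "f \<in> cadlag_ball r \<Longrightarrow> 0 < r \<Longrightarrow> f \<in> orthant_closure (2 * r)"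
  using cadlag_ball_approx[of f r] unfolding orthant_closure_def by blast

section \<open>Convexity of the ball\<close>

lemma signed_measure_lincomb:
  assumes "signed_measure M \<nu>" "signed_measure M \<nu>'"
  shows "signed_measure M (\<lambda>A. a * \<nu> A + b * \<nu>' A)"
  using assms unfolding signed_measure_def by (auto intro!: sums_add sums_mult)

lemma generated_by_section_lincomb:
  assumes "generated_by_section s f \<nu>" "generated_by_section s g \<nu>'"
  shows "generated_by_section s (\<lambda>x. a * f x + b * g x) (\<lambda>A. a * \<nu> A + b * \<nu>' A)"
  using assms unfolding generated_by_section_def section_fun_def
  by (auto intro!: signed_measure_lincomb simp: sum_distrib_left sum.distrib[symmetric] algebra_simps)

lemma total_variation_lincomb:
  assumes "0 \<le> a" "0 \<le> b"
  shows "total_variation M (\<lambda>A. a * \<nu> A + b * \<nu>' A) B \<le> ennreal a * total_variation M \<nu> B + ennreal b * total_variation M \<nu>' B"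
  unfolding total_variation_def[of M "\<lambda>A. a * \<nu> A + b * \<nu>' A"]
proof (rule SUP_least)
  fix \<P> assume \<P>: "\<P> \<in> {\<P>. finite \<P> \<and> \<P> \<subseteq> sets M \<and> disjoint \<P> \<and> \<Union> \<P> = B}"
  have "(\<Sum>E\<in>\<P>. ennreal \<bar>a * \<nu> E + b * \<nu>' E\<bar>) \<le> (\<Sum>E\<in>\<P>. ennreal a * ennreal \<bar>\<nu> E\<bar> + ennreal b * ennreal \<bar>\<nu>' E\<bar>)"
  proof (rule sum_mono)
    fix E
    have "\<bar>a * \<nu> E + b * \<nu>' E\<bar> \<le> a * \<bar>\<nu> E\<bar> + b * \<bar>\<nu>' E\<bar>"
      using assms abs_triangle_ineq[of "a * \<nu> E" "b * \<nu>' E"] by (simp add: abs_mult)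
    hence "ennreal \<bar>a * \<nu> E + b * \<nu>' E\<bar> \<le> ennreal (a * \<bar>\<nu> E\<bar> + b * \<bar>\<nu>' E\<bar>)" by (rule ennreal_leI)
    thus "ennreal \<bar>a * \<nu> E + b * \<nu>' E\<bar> \<le> ennreal a * ennreal \<bar>\<nu> E\<bar> + ennreal b * ennreal \<bar>\<nu>' E\<bar>"
      using assms by (simp add: ennreal_plus ennreal_mult)
  qed
  also have "\<dots> = ennreal a * (\<Sum>E\<in>\<P>. ennreal \<bar>\<nu> E\<bar>) + ennreal b * (\<Sum>E\<in>\<P>. ennreal \<bar>\<nu>' E\<bar>)"
    by (simp only: sum.distrib sum_distrib_left)
  also have "\<dots> \<le> ennreal a * total_variation M \<nu> B + ennreal b * total_variation M \<nu>' B"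
    unfolding total_variation_def by (intro add_mono mult_left_mono SUP_upper \<P>) auto
  finally show "(\<Sum>E\<in>\<P>. ennreal \<bar>a * \<nu> E + b * \<nu>' E\<bar>) \<le> ennreal a * total_variation M \<nu> B + ennreal b * total_variation M \<nu>' B" .
qed

text \<open>Finiteness provides, for each function, a generating measure within \<open>e\<close> of
  its infimum; these are combined and \<open>e\<close> tends to 0.\<close>

lemma section_variation_lincomb:
  assumes ab: "0 \<le> a" "0 \<le> b" "a + b = 1" and fin: "section_variation s f < \<top>" "section_variation s g < \<top>"
  shows "section_variation s (\<lambda>x. a * f x + b * g x) \<le> ennreal a * section_variation s f + ennreal b * section_variation s g"
proof (rule ennreal_le_epsilon)
  fix e :: real assume e: "0 < e"
  let ?TV = "\<lambda>\<nu>. total_variation (restrict_space borel (face s)) \<nu> (face s)"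
  have *: "\<exists>\<nu>. generated_by_section s f \<nu> \<and> ?TV \<nu> \<le> section_variation s f + ennreal e" if "section_variation s f < \<top>" for f
  proof -
    have "section_variation s f < section_variation s f + ennreal e"
      using e that by (cases "section_variation s f" rule: ennreal_cases) (auto simp: ennreal_less_iff simp flip: ennreal_plus)
    thus ?thesis unfolding section_variation_def INF_less_iff by (auto simp: less_imp_le)
  qed
  obtain \<nu> \<nu>' where \<nu>: "generated_by_section s f \<nu>" "?TV \<nu> \<le> section_variation s f + ennreal e"
    "generated_by_section s g \<nu>'" "?TV \<nu>' \<le> section_variation s g + ennreal e"
    using *[OF fin(1)] *[OF fin(2)] by blast
  have "section_variation s (\<lambda>x. a * f x + b * g x) \<le> ?TV (\<lambda>A. a * \<nu> A + b * \<nu>' A)"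
    unfolding section_variation_def by (rule INF_lower) (use \<nu> generated_by_section_lincomb in auto)
  also have "\<dots> \<le> ennreal a * ?TV \<nu> + ennreal b * ?TV \<nu>'" by (rule total_variation_lincomb[OF ab(1,2)])
  also have "\<dots> \<le> ennreal a * (section_variation s f + ennreal e) + ennreal b * (section_variation s g + ennreal e)"
    by (intro add_mono mult_left_mono \<nu>) auto
  also have "\<dots> = ennreal a * section_variation s f + ennreal b * section_variation s g + (ennreal a + ennreal b) * ennreal e"
    by (simp add: distrib_left distrib_right add_ac)
  also have "ennreal a + ennreal b = 1" using ab by (simp flip: ennreal_plus)
  finally show "section_variation s (\<lambda>x. a * f x + b * g x) \<le> ennreal a * section_variation s f + ennreal b * section_variation s g + ennreal e"
    by simp
qed

lemma cadlag_lincomb: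
  assumes "cadlag f" "cadlag g"
  shows "cadlag (\<lambda>x. a * f x + b * g x)"
  unfolding cadlag_def
proof (intro ballI conjI allI)
  fix x :: "real ^ 'a" assume x: "x \<in> unit_cube"
  show "continuous (at x within quadrant x {}) (\<lambda>x. a * f x + b * g x)"
    using assms x unfolding cadlag_def by (intro continuous_intros) auto
  fix s
  obtain l l' where "(f \<longlongrightarrow> l) (at x within quadrant x s)" "(g \<longlongrightarrow> l') (at x within quadrant x s)"
    using assms x unfolding cadlag_def by meson
  hence "((\<lambda>x. a * f x + b * g x) \<longlongrightarrow> a * l + b * l') (at x within quadrant x s)"
    by (intro tendsto_intros)
  thus "\<exists>l. ((\<lambda>x. a * f x + b * g x) \<longlongrightarrow> l) (at x within quadrant x s)" by blast
qed

text \<open>Used twice: for the first-order condition at the population minimizer, and for shrinking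
  the error of the estimator to a prescribed norm inside the ball.\<close>

lemma cadlag_ball_convex:
  fixes f g :: "real ^ 'd \<Rightarrow> real"
  assumes f: "f \<in> cadlag_ball r" and g: "g \<in> cadlag_ball r" and ab: "0 \<le> a" "0 \<le> b" "a + b = 1"
  shows "(\<lambda>x. a * f x + b * g x) \<in> cadlag_ball r"
proof -
  let ?S = "UNIV - {{}} :: 'd set set"
  have norm: "sectional_variation_norm f \<le> ennreal r" "sectional_variation_norm g \<le> ennreal r"
    using f g unfolding cadlag_ball_def by auto
  have fin: "section_variation s f < \<top>" if "sectional_variation_norm f \<le> ennreal r" "s \<in> ?S" for s and f :: "real ^ 'd \<Rightarrow> real"
  proof -
    have "section_variation s f \<le> (\<Sum>s\<in>?S. section_variation s f)" using that(2) by (intro member_le_sum) auto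
    also have "\<dots> \<le> sectional_variation_norm f" unfolding sectional_variation_norm_def by simp
    finally show ?thesis using that(1) ennreal_less_top le_less_trans by (meson order_trans)
  qed
  have "ennreal \<bar>a * f 0 + b * g 0\<bar> \<le> ennreal (a * \<bar>f 0\<bar> + b * \<bar>g 0\<bar>)"
    using ab abs_triangle_ineq[of "a * f 0" "b * g 0"] by (intro ennreal_leI) (simp add: abs_mult)
  also have "\<dots> = ennreal a * ennreal \<bar>f 0\<bar> + ennreal b * ennreal \<bar>g 0\<bar>"
    using ab by (simp add: ennreal_plus ennreal_mult)
  finally have "sectional_variation_norm (\<lambda>x. a * f x + b * g x) \<le> (ennreal a * ennreal \<bar>f 0\<bar> + ennreal b * ennreal \<bar>g 0\<bar>)
      + (\<Sum>s\<in>?S. ennreal a * section_variation s f + ennreal b * section_variation s g)"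
    unfolding sectional_variation_norm_def
    by (intro add_mono sum_mono section_variation_lincomb ab fin norm) auto
  also have "\<dots> = ennreal a * sectional_variation_norm f + ennreal b * sectional_variation_norm g"
    unfolding sectional_variation_norm_def by (simp add: sum.distrib sum_distrib_left distrib_left add_ac)
  also have "\<dots> \<le> ennreal a * ennreal r + ennreal b * ennreal r" by (intro add_mono mult_left_mono norm) auto
  also have "\<dots> = (ennreal a + ennreal b) * ennreal r" by (simp add: distrib_right)
  also have "ennreal a + ennreal b = 1" using ab by (simp flip: ennreal_plus)
  finally show ?thesis using f g cadlag_lincomb unfolding cadlag_ball_def by auto
qed

section \<open>A countable class that approximates the ball\<close>

lemma orthant_measurable [measurable]: "orthant p \<in> borel_measurable borel"
proof -
  have "{x. \<forall>j. p $ j \<le> x $ j} = (\<Inter>j. {x. p $ j \<le> x $ j})" by auto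
  also have "closed \<dots>" by (intro closed_INT ballI closed_Collect_le continuous_intros)
  finally have "{x. \<forall>j. p $ j \<le> x $ j} \<in> sets borel" by simp
  thus ?thesis unfolding orthant_def by simp
qed

lemma lincomb_measurable [measurable]: "lincomb ps \<in> borel_measurable borel"
proof (induction ps)
  case (Cons a ps)
  obtain q p where "a = (q, p)" by fastforce
  hence "lincomb (a # ps) = (\<lambda>x. q * orthant p x + lincomb ps x)" by auto
  thus ?case using Cons by simp
qed (simp add: lincomb_simps(1)[abs_def])

text \<open>Countable, so that an event about some member of the class is a countable union and
  hence measurable.\<close>

definition rational_combs :: "real \<Rightarrow> (real \<times> (real ^ 'd)) list set" where
  "rational_combs V = {ps. weight ps \<le> V \<and> set ps \<subseteq> \<rat> \<times> {p. \<forall>j. p $ j \<in> \<rat>}}"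

lemma countable_rational_combs: "countable (rational_combs V :: (real \<times> (real ^ 'd)) list set)"
proof -
  have "{p :: real ^ 'd. \<forall>j. p $ j \<in> \<rat>} \<subseteq> vec_lambda ` (PiE UNIV (\<lambda>_. \<rat>))"
  proof
    fix p :: "real ^ 'd" assume "p \<in> {p. \<forall>j. p $ j \<in> \<rat>}"
    thus "p \<in> vec_lambda ` (PiE UNIV (\<lambda>_. \<rat>))" by (intro image_eqI[of _ _ "vec_nth p"]) auto
  qed
  moreover have "countable (PiE (UNIV :: 'd set) (\<lambda>_. \<rat> :: real set))"
    by (intro countable_PiE) (auto simp: countable_rat)
  ultimately have "countable {p :: real ^ 'd. \<forall>j. p $ j \<in> \<rat>}"
    by (rule countable_subset[OF _ countable_image])
  hence "countable (lists (\<rat> \<times> {p :: real ^ 'd. \<forall>j. p $ j \<in> \<rat>}) :: (real \<times> (real ^ 'd)) list set)"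
    by (intro countable_lists countable_SIGMA countable_rat)
  moreover have "rational_combs V \<subseteq> lists (\<rat> \<times> {p. \<forall>j. p $ j \<in> \<rat>})"
    unfolding rational_combs_def by (auto simp: lists_eq_set)
  ultimately show ?thesis by (rule countable_subset[rotated])
qed

text \<open>The absolute value must not grow, or else the weight of a combination could exceed its
  bound.\<close>

lemma rational_below:
  fixes q :: real
  assumes "0 < \<delta>"
  shows "\<exists>q'\<in>\<rat>. \<bar>q'\<bar> \<le> \<bar>q\<bar> \<and> \<bar>q - q'\<bar> \<le> \<delta>"
proof -
  have pos: "\<exists>q'\<in>\<rat>. 0 \<le> q' \<and> q' \<le> q \<and> q - q' \<le> \<delta>" if "0 < q" for q :: real
  proof -
    obtain q' where "q' \<in> \<rat>" "max 0 (q - \<delta>) < q'" "q' < q"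
      using Rats_dense_in_real[of "max 0 (q - \<delta>)" q] assms \<open>0 < q\<close> by auto
    thus ?thesis by (intro bexI[of _ q']) auto
  qed
  consider "q = 0" | "0 < q" | "0 < - q" by linarith
  thus ?thesis
  proof cases
    case 1
    thus ?thesis using assms by (intro bexI[of _ 0]) auto
  next
    case 2
    from pos[OF this] show ?thesis by (elim bexE) (rule bexI, auto)
  next
    case 3
    from pos[OF this] obtain q' where "q' \<in> \<rat>" "0 \<le> q'" "q' \<le> - q" "- q - q' \<le> \<delta>" by blast
    thus ?thesis by (intro bexI[of _ "- q'"]) auto
  qed
qed

text \<open>The corners are rational already and only coefficients change; orthants are at most 1,
  so the error is uniform in \<open>x\<close>.\<close>

lemma rational_comb_approx:
  assumes "0 < \<delta>" "\<forall>p\<in>snd ` set ps. \<forall>j. p $ j \<in> \<rat>"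
  shows "\<exists>ps'\<in>rational_combs (weight ps). \<forall>x. \<bar>lincomb ps x - lincomb ps' x\<bar> \<le> \<delta>"
  using assms
proof (induction ps arbitrary: \<delta>)
  case Nil
  thus ?case by (intro bexI[of _ "[]"]) (auto simp: rational_combs_def)
next
  case (Cons a ps)
  obtain q p where a: "a = (q, p)" by fastforce
  obtain ps' where ps': "ps' \<in> rational_combs (weight ps)" "\<And>x. \<bar>lincomb ps x - lincomb ps' x\<bar> \<le> \<delta> / 2"
    using Cons.IH[of "\<delta> / 2"] Cons.prems by auto
  obtain q' where q': "q' \<in> \<rat>" "\<bar>q'\<bar> \<le> \<bar>q\<bar>" "\<bar>q - q'\<bar> \<le> \<delta> / 2"
    using rational_below[of "\<delta> / 2" q] Cons.prems by auto
  have "(q', p) # ps' \<in> rational_combs (weight (a # ps))"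
    using ps'(1) q' Cons.prems(2) unfolding rational_combs_def a by auto
  moreover have "\<bar>lincomb (a # ps) x - lincomb ((q', p) # ps') x\<bar> \<le> \<delta>" for x
  proof -
    have "\<bar>q - q'\<bar> * \<bar>orthant p x\<bar> \<le> \<delta> / 2 * 1"
      using q'(3) Cons.prems(1) by (intro mult_mono) (auto simp: orthant_def)
    hence "\<bar>(q - q') * orthant p x\<bar> \<le> \<delta> / 2" by (simp add: abs_mult)
    moreover have "lincomb (a # ps) x - lincomb ((q', p) # ps') x = (q - q') * orthant p x + (lincomb ps x - lincomb ps' x)"
      by (simp add: a algebra_simps)
    ultimately show ?thesis using ps'(2)[of x] by linarith
  qed
  ultimately show ?case by blast
qed

lemma cadlag_ball_rational_approx:
  assumes "f \<in> cadlag_ball r" "0 < r"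
  shows "\<exists>ps. (\<forall>N. ps N \<in> rational_combs (2 * r)) \<and> (\<forall>x\<in>unit_cube. (\<lambda>N. lincomb (ps N) x) \<longlonglongrightarrow> f x)"
proof -
  obtain ps where ps: "\<And>N. weight (ps N) \<le> 2 * r" "\<And>N. \<forall>p\<in>snd ` set (ps N). \<forall>j. p $ j \<in> \<rat>"
    "\<And>x. x \<in> unit_cube \<Longrightarrow> (\<lambda>N. lincomb (ps N) x) \<longlonglongrightarrow> f x"
    using cadlag_ball_approx[OF assms] by blast
  have "\<forall>N. \<exists>ps'\<in>rational_combs (weight (ps N)). \<forall>x. \<bar>lincomb (ps N) x - lincomb ps' x\<bar> \<le> 1 / real (Suc N)"
    using rational_comb_approx[OF _ ps(2)] by simp
  then obtain ps' where ps': "\<And>N. ps' N \<in> rational_combs (weight (ps N))" "\<And>N x. \<bar>lincomb (ps N) x - lincomb (ps' N) x\<bar> \<le> 1 / real (Suc N)"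
    by metis
  have "ps' N \<in> rational_combs (2 * r)" for N
    using ps'(1)[of N] ps(1)[of N] unfolding rational_combs_def by auto
  moreover have "(\<lambda>N. lincomb (ps' N) x) \<longlonglongrightarrow> f x" if "x \<in> unit_cube" for x
  proof -
    have "(\<lambda>N. lincomb (ps N) x - lincomb (ps' N) x) \<longlonglongrightarrow> 0"
      using LIMSEQ_Suc[OF lim_const_over_n[of 1]]
      by (rule Lim_null_comparison[rotated]) (use ps'(2) in auto)
    from tendsto_diff[OF ps(3)[OF that] this] show ?thesis by simp
  qed
  ultimately show ?thesis by blast
qed

lemma rational_combs_closure: "ps \<in> rational_combs V \<Longrightarrow> lincomb ps \<in> orthant_closure V"
  unfolding rational_combs_def orthant_closure_def by (auto intro!: exI[of _ "\<lambda>_. ps"])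

section \<open>Least squares\<close>

text \<open>Expand the squares around \<open>a\<close>. Scaling by \<open>t\<close> makes the left
  side quadratic and the right side linear in \<open>t\<close>, so \<open>t \<le> 1\<close>
  preserves the inequality.\<close>

lemma empirical_basic_inequality:
  fixes y a b :: "'i \<Rightarrow> real"
  assumes "(\<Sum>i\<in>I. (y i - b i)\<^sup>2) \<le> (\<Sum>i\<in>I. (y i - a i)\<^sup>2)" "0 \<le> t" "t \<le> 1"
  shows "(\<Sum>i\<in>I. (t * (b i - a i))\<^sup>2) \<le> 2 * (\<Sum>i\<in>I. (y i - a i) * (t * (b i - a i)))"
proof -
  have "(\<Sum>i\<in>I. (y i - b i)\<^sup>2) = (\<Sum>i\<in>I. (y i - a i)\<^sup>2) + (\<Sum>i\<in>I. (b i - a i)\<^sup>2) - 2 * (\<Sum>i\<in>I. (y i - a i) * (b i - a i))"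
    unfolding sum_distrib_left sum.distrib[symmetric] sum_subtractf[symmetric]
    by (intro sum.cong) (auto simp: power2_eq_square algebra_simps)
  hence le: "(\<Sum>i\<in>I. (b i - a i)\<^sup>2) \<le> 2 * (\<Sum>i\<in>I. (y i - a i) * (b i - a i))" using assms(1) by linarith
  have "(\<Sum>i\<in>I. (t * (b i - a i))\<^sup>2) = t * (t * (\<Sum>i\<in>I. (b i - a i)\<^sup>2))"
    by (simp add: sum_distrib_left power_mult_distrib power2_eq_square mult_ac)
  also have "\<dots> \<le> t * (1 * (\<Sum>i\<in>I. (b i - a i)\<^sup>2))"
    using assms(2,3) by (intro mult_left_mono mult_right_mono sum_nonneg) auto
  also have "\<dots> \<le> t * (2 * (\<Sum>i\<in>I. (y i - a i) * (b i - a i)))"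
    using le assms(2) by (intro mult_left_mono) auto
  also have "\<dots> = 2 * (\<Sum>i\<in>I. (y i - a i) * (t * (b i - a i)))"
    by (simp add: sum_distrib_left mult_ac)
  finally show ?thesis .
qed

text \<open>The variational inequality at a minimum: if it failed, a short step along
  \<open>d\<close> would decrease the loss.\<close>

lemma (in prob_space) population_first_order:
  fixes e d :: "'a \<Rightarrow> real"
  assumes int: "integrable M (\<lambda>z. (e z)\<^sup>2)" "integrable M (\<lambda>z. e z * d z)" "integrable M (\<lambda>z. (d z)\<^sup>2)"
    and min: "\<And>s. 0 < s \<Longrightarrow> s \<le> 1 \<Longrightarrow> (\<integral>z. (e z)\<^sup>2 \<partial>M) \<le> (\<integral>z. (e z - s * d z)\<^sup>2 \<partial>M)"
  shows "(\<integral>z. e z * d z \<partial>M) \<le> 0"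
proof (rule ccontr)
  define A B where "A = (\<integral>z. e z * d z \<partial>M)" and "B = (\<integral>z. (d z)\<^sup>2 \<partial>M)"
  assume "\<not> ?thesis"
  hence A: "0 < A" unfolding A_def by simp
  have B: "0 \<le> B" unfolding B_def by simp
  \<comment> \<open>Short enough for the quadratic term \<open>s^2 * B\<close> to stay below the
    linear gain \<open>2 * s * A\<close>; the added 1 covers \<open>B = 0\<close>.\<close>
  define s where "s = min 1 (A / (B + 1))"
  have s: "0 < s" "s \<le> 1" unfolding s_def using A B by auto
  have "(\<lambda>z. (e z - s * d z)\<^sup>2) = (\<lambda>z. ((e z)\<^sup>2 - 2 * s * (e z * d z)) + s\<^sup>2 * (d z)\<^sup>2)"
    by (auto simp: power2_eq_square algebra_simps)
  hence "(\<integral>z. (e z - s * d z)\<^sup>2 \<partial>M) = (\<integral>z. (e z)\<^sup>2 \<partial>M) - 2 * s * A + s\<^sup>2 * B"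
    using int by (simp add: A_def B_def)
  hence "2 * s * A \<le> s\<^sup>2 * B" using min[OF s] by linarith
  hence "2 * A \<le> s * B" using s(1) by (simp add: power2_eq_square)
  also have "\<dots> \<le> A / (B + 1) * B" unfolding s_def using B by (intro mult_right_mono) auto
  also have "\<dots> \<le> A" using A B by (simp add: divide_le_eq algebra_simps)
  finally show False using A by simp
qed

text \<open>The constant of \<open>deviation_prob_le\<close> for \<open>D = 6\<close> and
  \<open>V = 4\<close>.\<close>

definition tail_const :: "nat \<Rightarrow> real" where
  "tail_const d = 4 * rate_const d * (6 + 4) * (4 + 2 * rate_const d * 4\<^sup>2 + 2 * rate_const d * 4 + 4)"

lemma space_obs_space: "space (obs_space r) = unit_cube \<times> {- r..r}"
  unfolding obs_space_def by (simp add: space_restrict_space)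

lemma fst_obs_measurable: "g \<in> borel_measurable borel \<Longrightarrow> (\<lambda>z. g (fst z)) \<in> borel_measurable (obs_space r)"
  unfolding obs_space_def by (intro measurable_restrict_space1) (simp flip: borel_prod)

lemma snd_obs_measurable: "snd \<in> borel_measurable (obs_space r)"
  unfolding obs_space_def by (intro measurable_restrict_space1) (simp flip: borel_prod)

lemma cadlag_ball_measurable:
  assumes "f \<in> cadlag_ball r" "0 < r"
  shows "(\<lambda>z. f (fst z)) \<in> borel_measurable (obs_space r)"
proof -
  obtain ps where ps: "\<And>x. x \<in> unit_cube \<Longrightarrow> (\<lambda>N. lincomb (ps N) x) \<longlonglongrightarrow> f x"
    using cadlag_ball_rational_approx[OF assms] by blast
  show ?thesis
    by (rule borel_measurable_LIMSEQ_real[of _ "\<lambda>N z. lincomb (ps N) (fst z)"])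
       (use ps in \<open>auto simp: space_obs_space intro!: fst_obs_measurable\<close>)
qed

text \<open>After division by \<open>r\<close> the constant depends on \<open>d\<close> alone, so
  the law, the range of the responses and the ball may all change with \<open>n\<close>.\<close>

lemma least_squares_tail:
  fixes \<theta>0 :: "real ^ 'd \<Rightarrow> real" and \<theta>hat :: "'w \<Rightarrow> real ^ 'd \<Rightarrow> real"
  assumes \<Omega>: "prob_space \<Omega>" and r: "0 < r"
    and indep: "prob_space.indep_vars \<Omega> (\<lambda>_. obs_space r) (\<lambda>i \<omega>. (X i \<omega>, Y i \<omega>)) {1..n}"
    and distr: "\<And>i. i \<in> {1..n} \<Longrightarrow> distr \<Omega> (obs_space r) (\<lambda>\<omega>. (X i \<omega>, Y i \<omega>)) = P"
    and \<theta>0: "is_arg_min (\<lambda>\<eta>. \<integral>z. square_loss \<eta> z \<partial>P) (\<lambda>\<eta>. \<eta> \<in> cadlag_ball r) \<theta>0"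
    and \<theta>hat: "\<And>\<omega>. \<omega> \<in> space \<Omega> \<Longrightarrow>
      is_arg_min (\<lambda>\<eta>. empirical_mean n (\<lambda>i. (X i \<omega>, Y i \<omega>)) (square_loss \<eta>)) (\<lambda>\<eta>. \<eta> \<in> cadlag_ball r) (\<theta>hat \<omega>)"
    and n: "3 \<le> n" and R: "0 < R" "R \<le> 1" "ln (real n) \<le> real n * R"
    and \<kappa>: "0 \<le> \<kappa>" "\<kappa> \<le> 1" "ln (real n) ^ (CARD('d) - 1) \<le> \<kappa> * (sqrt n * (R * sqrt R))"
  shows "outer_measure_of \<Omega> {\<omega> \<in> space \<Omega>. r * R < \<bar>L2_norm_X P (\<lambda>x. \<theta>hat \<omega> x - \<theta>0 x)\<bar>} \<le> ennreal (tail_const CARD('d) * \<kappa>)"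
proof -
  interpret \<Omega>: prob_space \<Omega> by (rule \<Omega>)
  let ?I = "{1..n}"
  define Z where "Z i \<omega> = (X i \<omega>, Y i \<omega>)" for i \<omega>
  have Zm: "Z i \<in> measurable \<Omega> (obs_space r)" if "i \<in> ?I" for i
    using indep that unfolding \<Omega>.indep_vars_def Z_def by auto
  have distrZ: "distr \<Omega> (obs_space r) (Z i) = P" if "i \<in> ?I" for i
    using distr[OF that] unfolding Z_def .
  have one: "1 \<in> ?I" using n by simp
  interpret P: prob_space P
    using \<Omega>.prob_space_distr[OF Zm[OF one]] unfolding distrZ[OF one] .
  have setsP: "sets P = sets (obs_space r)" unfolding distrZ[OF one, symmetric] by simp
  have spaceP: "space P = unit_cube \<times> {- r..r}" using sets_eq_imp_space_eq[OF setsP] by (simp add: space_obs_space)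
  have measP: "borel_measurable P = borel_measurable (obs_space r)" by (rule measurable_cong_sets[OF setsP refl])
  let ?\<Pi> = "PiM ?I (\<lambda>_. P)"
  interpret \<Pi>: prob_space ?\<Pi> by (rule prob_space_PiM) (rule P.prob_space_axioms)
  have \<theta>0b: "\<theta>0 \<in> cadlag_ball r" using \<theta>0 unfolding is_arg_min_def by blast
  have ballm: "(\<lambda>z. f (fst z)) \<in> borel_measurable P" if "f \<in> cadlag_ball r" for f
    unfolding measP by (rule cadlag_ball_measurable[OF that r])
  have \<theta>0c: "\<theta>0 \<in> orthant_closure (2 * r)" by (rule cadlag_ball_subset_orthant_closure[OF \<theta>0b r])
  have \<theta>0B: "\<bar>\<theta>0 x\<bar> \<le> 2 * r" if "x \<in> unit_cube" for x by (rule orthant_closure_bound[OF \<theta>0c that])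
  \<comment> \<open>Responses are at most \<open>r\<close> and \<open>\<theta>0\<close> at most
    \<open>2 * r\<close> in absolute value, hence the normalization by \<open>3 * r\<close>.\<close>
  define W where "W z = (snd z - \<theta>0 (fst z)) / (3 * r)" for z
  have Wm: "W \<in> borel_measurable P"
    unfolding W_def using ballm[OF \<theta>0b] snd_obs_measurable[of r] by (intro borel_measurable_divide borel_measurable_diff borel_measurable_const) (auto simp: measP)
  have WB: "\<bar>W z\<bar> \<le> 1" if "z \<in> space P" for z
  proof -
    have "\<bar>snd z\<bar> \<le> r" "\<bar>\<theta>0 (fst z)\<bar> \<le> 2 * r" using that \<theta>0B unfolding spaceP by auto
    hence "\<bar>snd z - \<theta>0 (fst z)\<bar> \<le> 3 * r" by linarith
    thus ?thesis unfolding W_def using r by (simp add: abs_divide divide_le_eq)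
  qed
  \<comment> \<open>The 6 is the factor 2 of the basic inequality times the 3 in the normalization
    of \<open>W\<close>.\<close>
  define dev where "dev h z = 6 * \<bar>(\<Sum>i\<in>?I. W (z i) * h (fst (z i))) - real n * (\<integral>x. W x * h (fst x) \<partial>P)\<bar> +
      \<bar>(\<Sum>i\<in>?I. (h (fst (z i)))\<^sup>2) - real n * (\<integral>x. (h (fst x))\<^sup>2 \<partial>P)\<bar>" for h z
  \<comment> \<open>The shrunk error has norm \<open>R\<close> and deviation at least
    \<open>n * R^2\<close>. Norm \<open>2 * R\<close> here and the threshold
    \<open>n * R^2 / 2\<close> in \<open>E\<close> leave room to replace it by a nearby member of
    the countable class.\<close>
  define \<H> where "\<H> = {h \<in> (\<lambda>ps x. (lincomb ps x - \<theta>0 x) / r) ` rational_combs (2 * r). (\<integral>z. (h (fst z))\<^sup>2 \<partial>P) \<le> (2 * R)\<^sup>2}"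
  define E where "E H = {z \<in> space ?\<Pi>. \<exists>h\<in>H. real n * R\<^sup>2 / 2 \<le> dev h z}" for H
  \<comment> \<open>Both functions have weight at most \<open>2 * r\<close>, so their difference
    divided by \<open>r\<close> has weight at most 4.\<close>
  have diffc: "(\<lambda>x. (f x - \<theta>0 x) / r) \<in> orthant_closure 4" if "f \<in> orthant_closure (2 * r)" for f
    using orthant_closure_add[OF that \<theta>0c, of "1 / r" "- 1 / r"] r by (simp add: diff_divide_distrib)
  have \<H>c: "h \<in> orthant_closure 4" if "h \<in> \<H>" for h
    using that diffc rational_combs_closure unfolding \<H>_def by auto
  have \<H>m: "(\<lambda>z. h (fst z)) \<in> borel_measurable P" if h: "h \<in> \<H>" for h
  proof -
    obtain ps where "h = (\<lambda>x. (lincomb ps x - \<theta>0 x) / r)" using h unfolding \<H>_def by auto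
    moreover have "(\<lambda>z. (lincomb ps (fst z) - \<theta>0 (fst z)) / r) \<in> borel_measurable P"
      using ballm[OF \<theta>0b] fst_obs_measurable[OF lincomb_measurable, of ps r]
      by (intro borel_measurable_divide borel_measurable_diff borel_measurable_const) (auto simp: measP)
    ultimately show ?thesis by simp
  qed
  have comp: "(\<lambda>z. g (z i)) \<in> borel_measurable ?\<Pi>" if "i \<in> ?I" "g \<in> borel_measurable P" for i and g :: "_ \<Rightarrow> real"
    using measurable_compose[OF measurable_component_singleton[OF that(1), of "\<lambda>_. P"] that(2)] .
  have devm: "dev h \<in> borel_measurable ?\<Pi>" if "h \<in> \<H>" for h
    unfolding dev_def
    using comp[OF _ Wm] comp[OF _ \<H>m[OF that]]
    by (intro borel_measurable_add borel_measurable_times borel_measurable_power borel_measurable_const borel_measurable_abs borel_measurable_diff borel_measurable_sum) auto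
  have Em: "E H \<in> sets ?\<Pi>" if "H \<subseteq> \<H>" "countable H" for H
  proof -
    have "E H = (\<Union>h\<in>H. {z \<in> space ?\<Pi>. real n * R\<^sup>2 / 2 \<le> dev h z})" unfolding E_def by auto
    moreover have "{z \<in> space ?\<Pi>. real n * R\<^sup>2 / 2 \<le> dev h z} \<in> sets ?\<Pi>" if "h \<in> H" for h
      using devm[of h] \<open>H \<subseteq> \<H>\<close> that by (intro borel_measurable_le) auto
    ultimately show ?thesis using that(2) by auto
  qed
  have tc: "0 \<le> tail_const CARD('d) * \<kappa>"
    unfolding tail_const_def using \<kappa> rate_const_pos[of "CARD('d)"] by (intro mult_nonneg_nonneg add_nonneg_nonneg) auto
  have fin: "emeasure ?\<Pi> (E H) \<le> ennreal (tail_const CARD('d) * \<kappa>)" if H: "finite H" "H \<subseteq> \<H>" for H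
  proof -
    have "measure ?\<Pi> (E H) \<le> tail_const CARD('d) * \<kappa>"
      unfolding E_def dev_def tail_const_def
    proof (rule P.deviation_prob_le[OF n R \<kappa>])
      show "fst z \<in> unit_cube" if "z \<in> space P" for z using that unfolding spaceP by auto
    qed (use H \<H>c \<H>m Wm WB in \<open>auto simp: \<H>_def\<close>)
    thus ?thesis unfolding \<Pi>.emeasure_eq_measure by (rule ennreal_leI)
  qed
  have count: "countable \<H>"
    unfolding \<H>_def by (intro countable_Collect countable_image countable_rational_combs)
  have main: "emeasure ?\<Pi> (E \<H>) \<le> ennreal (tail_const CARD('d) * \<kappa>)"
  proof (cases "\<H> = {}")
    case True
    thus ?thesis using fin[of \<H>] by simp
  next
    case False
    \<comment> \<open>The bound for finite classes does not depend on their size, so it passes to an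
      increasing union along an enumeration.\<close>
    define F where "F k = E (from_nat_into \<H> ` {..k})" for k :: nat
    have sub: "from_nat_into \<H> ` {..k} \<subseteq> \<H>" for k using from_nat_into[OF False] by auto
    have "range (from_nat_into \<H>) = (\<Union>k. from_nat_into \<H> ` {..k})" by (auto simp: image_iff)
    hence "\<H> = (\<Union>k. from_nat_into \<H> ` {..k})" using range_from_nat_into[OF False count] by simp
    hence "E \<H> = (\<Union>k. F k)" unfolding F_def E_def by blast
    moreover have "(SUP k. emeasure ?\<Pi> (F k)) = emeasure ?\<Pi> (\<Union>k. F k)"
    proof (rule SUP_emeasure_incseq)
      show "range F \<subseteq> sets ?\<Pi>" unfolding F_def using Em[OF sub] by auto
      show "incseq F" unfolding incseq_def F_def E_def by fastforce
    qed
    moreover have "emeasure ?\<Pi> (F k) \<le> ennreal (tail_const CARD('d) * \<kappa>)" for k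
      unfolding F_def by (intro fin sub) simp
    ultimately show ?thesis by (metis SUP_least)
  qed
  define T where "T \<omega> = (\<lambda>i\<in>?I. Z i \<omega>)" for \<omega>
  have Tm: "T \<in> measurable \<Omega> (PiM ?I (\<lambda>_. obs_space r))"
    unfolding T_def using Zm by (intro measurable_restrict) auto
  have distrT: "distr \<Omega> (PiM ?I (\<lambda>_. obs_space r)) T = ?\<Pi>"
  proof -
    have "distr \<Omega> (PiM ?I (\<lambda>_. obs_space r)) T = PiM ?I (\<lambda>i. distr \<Omega> (obs_space r) (Z i))"
      unfolding T_def using indep \<Omega>.indep_vars_iff_distr_eq_PiM'[where I = ?I and M' = "\<lambda>_. obs_space r" and X = Z] Zm n
      unfolding Z_def by auto
    also have "\<dots> = ?\<Pi>" using distrZ by (intro PiM_cong) auto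
    finally show ?thesis .
  qed
  have sets\<Pi>: "sets ?\<Pi> = sets (PiM ?I (\<lambda>_. obs_space r))" using setsP by (intro sets_PiM_cong) auto
  have E\<H>: "E \<H> \<in> sets ?\<Pi>" using Em count by blast
  have pre: "T -` E \<H> \<inter> space \<Omega> \<in> sets \<Omega>" using measurable_sets[OF Tm] E\<H> sets\<Pi> by simp
  \<comment> \<open>The bad event may fail to be measurable; it is enclosed in the preimage of the
    measurable event \<open>E \<H>\<close>.\<close>
  have "{\<omega> \<in> space \<Omega>. r * R < \<bar>L2_norm_X P (\<lambda>x. \<theta>hat \<omega> x - \<theta>0 x)\<bar>} \<subseteq> T -` E \<H> \<inter> space \<Omega>"
  proof (intro subsetI)
    fix \<omega> assume "\<omega> \<in> {\<omega> \<in> space \<Omega>. r * R < \<bar>L2_norm_X P (\<lambda>x. \<theta>hat \<omega> x - \<theta>0 x)\<bar>}"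
    hence \<omega>: "\<omega> \<in> space \<Omega>" and bad: "r * R < \<bar>L2_norm_X P (\<lambda>x. \<theta>hat \<omega> x - \<theta>0 x)\<bar>" by auto
    define b where "b = \<theta>hat \<omega>"
    have bb: "b \<in> cadlag_ball r" using \<theta>hat[OF \<omega>] unfolding is_arg_min_def b_def by blast
    have T\<Pi>: "T \<omega> \<in> space ?\<Pi>" using measurable_space[OF Tm \<omega>] sets_eq_imp_space_eq[OF sets\<Pi>] by simp
    have Tcube: "fst (T \<omega> i) \<in> unit_cube" if "i \<in> ?I" for i
    proof -
      have "T \<omega> i \<in> unit_cube \<times> {- r..r}" using T\<Pi> that unfolding space_PiM spaceP PiE_iff by blast
      thus ?thesis by auto
    qed
    define h1 where "h1 x = (b x - \<theta>0 x) / r" for x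
    have h1c: "h1 \<in> orthant_closure 4"
      unfolding h1_def by (rule diffc[OF cadlag_ball_subset_orthant_closure[OF bb r]])
    have h1m: "(\<lambda>z. h1 (fst z)) \<in> borel_measurable P"
      unfolding h1_def using ballm[OF bb] ballm[OF \<theta>0b]
      by (intro borel_measurable_divide borel_measurable_diff borel_measurable_const) (auto simp: measP)
    have h1B: "\<bar>h1 (fst z)\<bar> \<le> 4" if "z \<in> space P" for z
      using that unfolding spaceP by (intro orthant_closure_bound[OF h1c]) auto
    define q where "q = (\<integral>z. (h1 (fst z))\<^sup>2 \<partial>P)"
    have q: "R\<^sup>2 < q"
    proof -
      have "(\<integral>(x, y). (\<theta>hat \<omega> x - \<theta>0 x)\<^sup>2 \<partial>P) = (\<integral>z. r\<^sup>2 * (h1 (fst z))\<^sup>2 \<partial>P)"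
        unfolding h1_def b_def using r by (simp add: case_prod_beta' power_divide)
      also have "\<dots> = r\<^sup>2 * q" unfolding q_def by simp
      finally have "L2_norm_X P (\<lambda>x. \<theta>hat \<omega> x - \<theta>0 x) = r * sqrt q"
        unfolding L2_norm_X_def using r by (simp add: real_sqrt_mult)
      hence "r * R < r * sqrt q" using bad r by (simp add: abs_mult q_def)
      hence "R < sqrt q" using r by simp
      thus ?thesis using R(1) by (metis real_less_rsqrt real_sqrt_less_iff real_sqrt_unique less_imp_le not_less real_le_lsqrt order_less_le)
    qed
    \<comment> \<open>The factor that shrinks the error to norm exactly \<open>R\<close>; it is at
      most 1 because the bad event makes \<open>q\<close> exceed \<open>R^2\<close>.\<close>
    define t where "t = R / sqrt q"
    have q0: "0 < q" using q zero_le_power2[of R] by linarith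
    have t: "0 < t" "t \<le> 1" "t\<^sup>2 * q = R\<^sup>2"
      using q q0 R unfolding t_def by (auto simp: power_divide real_le_rsqrt)
    define f' where "f' x = (1 - t) * \<theta>0 x + t * b x" for x
    have f'b: "f' \<in> cadlag_ball r" unfolding f'_def using t by (intro cadlag_ball_convex \<theta>0b bb) auto
    define h' where "h' x = t * h1 x" for x
    have h'_eq: "h' x = (f' x - \<theta>0 x) / r" for x
      unfolding h'_def h1_def f'_def using r by (simp add: field_simps)
    have h'2: "(\<integral>z. (h' (fst z))\<^sup>2 \<partial>P) = R\<^sup>2"
      unfolding h'_def power_mult_distrib by (simp add: t(3) flip: q_def)
    have W2B: "\<bar>W z * h1 (fst z)\<bar> \<le> 4" if "z \<in> space P" for z
      using mult_mono[OF WB[OF that] h1B[OF that]] by (simp add: abs_mult)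
    have h1sq: "(h1 (fst z))\<^sup>2 \<le> 4\<^sup>2" if "z \<in> space P" for z
      using h1B[OF that] by (intro abs_le_square_iff[THEN iffD1]) simp
    \<comment> \<open>The residual is scaled by \<open>3 * r\<close> and the error by
      \<open>r\<close>, so a step \<open>s\<close> toward \<open>b\<close> subtracts
      \<open>s * h1 / 3\<close> from \<open>W\<close>.\<close>
    have pop: "(\<integral>z. W z * (h1 (fst z) / 3) \<partial>P) \<le> 0"
    proof (rule P.population_first_order)
      show "integrable P (\<lambda>z. (W z)\<^sup>2)"
        using Wm WB by (intro P.integrable_const_bound[where B = 1]) (auto simp: abs_square_le_1)
      have "integrable P (\<lambda>z. W z * h1 (fst z))"
        using Wm h1m W2B by (intro P.integrable_const_bound[where B = 4]) auto
      thus "integrable P (\<lambda>z. W z * (h1 (fst z) / 3))" by simp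
      have "integrable P (\<lambda>z. (h1 (fst z))\<^sup>2)"
        using h1sq h1m by (intro P.integrable_const_bound[where B = "4\<^sup>2"]) auto
      thus "integrable P (\<lambda>z. (h1 (fst z) / 3)\<^sup>2)" by (simp add: power_divide)
      fix s :: real assume s: "0 < s" "s \<le> 1"
      define \<eta> where "\<eta> x = (1 - s) * \<theta>0 x + s * b x" for x
      have "\<eta> \<in> cadlag_ball r" unfolding \<eta>_def using s by (intro cadlag_ball_convex \<theta>0b bb) auto
      hence "(\<integral>z. square_loss \<theta>0 z \<partial>P) \<le> (\<integral>z. square_loss \<eta> z \<partial>P)"
        using \<theta>0 unfolding is_arg_min_def by (meson not_le)
      moreover have "square_loss \<theta>0 z = (3 * r)\<^sup>2 * (W z)\<^sup>2" for z
        using r unfolding square_loss_def W_def by (simp add: case_prod_beta' power_divide)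
      moreover have "square_loss \<eta> z = (3 * r)\<^sup>2 * (W z - s * (h1 (fst z) / 3))\<^sup>2" for z
      proof -
        have "snd z - \<eta> (fst z) = 3 * r * (W z - s * (h1 (fst z) / 3))"
          unfolding \<eta>_def W_def h1_def using r by (simp add: field_simps)
        thus ?thesis unfolding square_loss_def by (simp only: case_prod_beta' power_mult_distrib)
      qed
      ultimately show "(\<integral>z. (W z)\<^sup>2 \<partial>P) \<le> (\<integral>z. (W z - s * (h1 (fst z) / 3))\<^sup>2 \<partial>P)"
        using r by simp
    qed
    have pop': "(\<integral>z. W z * h' (fst z) \<partial>P) \<le> 0"
    proof -
      have "(\<integral>z. W z * h' (fst z) \<partial>P) = (\<integral>z. (3 * t) * (W z * (h1 (fst z) / 3)) \<partial>P)"
        unfolding h'_def by (intro Bochner_Integration.integral_cong) auto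
      also have "\<dots> = (3 * t) * (\<integral>z. W z * (h1 (fst z) / 3) \<partial>P)" by simp
      finally show ?thesis using pop t(1) by (simp add: mult_le_0_iff)
    qed
    let ?z = "T \<omega>"
    have emp: "(\<Sum>i\<in>?I. (h' (fst (?z i)))\<^sup>2) \<le> 6 * (\<Sum>i\<in>?I. W (?z i) * h' (fst (?z i)))"
    proof -
      let ?a = "\<lambda>i. \<theta>0 (fst (?z i))" and ?b = "\<lambda>i. b (fst (?z i))" and ?y = "\<lambda>i. snd (?z i)"
      have "empirical_mean n (\<lambda>i. (X i \<omega>, Y i \<omega>)) (square_loss b) \<le> empirical_mean n (\<lambda>i. (X i \<omega>, Y i \<omega>)) (square_loss \<theta>0)"
        using \<theta>hat[OF \<omega>] \<theta>0b unfolding is_arg_min_def b_def by (meson not_le)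
      hence "(\<Sum>i\<in>?I. (?y i - ?b i)\<^sup>2) \<le> (\<Sum>i\<in>?I. (?y i - ?a i)\<^sup>2)"
        using n unfolding empirical_mean_def square_loss_def by (simp add: divide_le_cancel T_def Z_def)
      from empirical_basic_inequality[OF this, of t] t
      have "(\<Sum>i\<in>?I. (t * (?b i - ?a i))\<^sup>2) \<le> 2 * (\<Sum>i\<in>?I. (?y i - ?a i) * (t * (?b i - ?a i)))" by simp
      moreover have "t * (?b i - ?a i) = r * h' (fst (?z i))" for i
        unfolding h'_def h1_def using r by simp
      moreover have "?y i - ?a i = 3 * r * W (?z i)" for i
        unfolding W_def using r by simp
      ultimately have "r\<^sup>2 * (\<Sum>i\<in>?I. (h' (fst (?z i)))\<^sup>2) \<le> r\<^sup>2 * (6 * (\<Sum>i\<in>?I. W (?z i) * h' (fst (?z i))))"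
        by (simp add: sum_distrib_left power_mult_distrib power2_eq_square mult_ac)
      thus ?thesis using r by simp
    qed
    \<comment> \<open>The population mean of \<open>W * h'\<close> is at most 0, and the empirical
      squares are at most 6 times the empirical sum of \<open>W * h'\<close>. So the population
      square \<open>n * R^2\<close> must be paid for by the deviations.\<close>
    have devh': "real n * R\<^sup>2 \<le> dev h' ?z"
    proof -
      have "real n * (\<integral>z. W z * h' (fst z) \<partial>P) \<le> 0" using pop' by (simp add: mult_nonneg_nonpos)
      moreover have "N \<le> 6 * \<bar>w - p\<bar> + \<bar>s - N\<bar>" if "p \<le> 0" "s \<le> 6 * w" for N p s w :: real
        using that by (auto simp: abs_if)
      ultimately show ?thesis unfolding dev_def h'2 using emp by blast
    qed
    obtain ps where ps: "\<And>N. ps N \<in> rational_combs (2 * r)" "\<And>x. x \<in> unit_cube \<Longrightarrow> (\<lambda>N. lincomb (ps N) x) \<longlonglongrightarrow> f' x"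
      using cadlag_ball_rational_approx[OF f'b r] by blast
    define hN where "hN N x = (lincomb (ps N) x - \<theta>0 x) / r" for N x
    have hNlim: "(\<lambda>N. hN N x) \<longlonglongrightarrow> h' x" if "x \<in> unit_cube" for x
      unfolding hN_def h'_eq using r by (intro tendsto_intros ps that) auto
    have hNc: "hN N \<in> orthant_closure 4" for N
      unfolding hN_def by (intro diffc rational_combs_closure ps)
    have hNB: "\<bar>hN N (fst z)\<bar> \<le> 4" if "z \<in> space P" for N z
      using that unfolding spaceP by (intro orthant_closure_bound[OF hNc]) auto
    have hNm: "(\<lambda>z. hN N (fst z)) \<in> borel_measurable P" for N
      unfolding hN_def using ballm[OF \<theta>0b] fst_obs_measurable[OF lincomb_measurable, of "ps N" r]
      by (intro borel_measurable_divide borel_measurable_diff borel_measurable_const) (auto simp: measP)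
    have h'm: "(\<lambda>z. h' (fst z)) \<in> borel_measurable P" unfolding h'_def using h1m by simp
    have cubeP: "fst z \<in> unit_cube" if "z \<in> space P" for z using that unfolding spaceP by auto
    have lim2: "(\<lambda>N. \<integral>z. (hN N (fst z))\<^sup>2 \<partial>P) \<longlonglongrightarrow> (\<integral>z. (h' (fst z))\<^sup>2 \<partial>P)"
    proof (rule integral_dominated_convergence[where w = "\<lambda>_. 4\<^sup>2"])
      show "AE z in P. (\<lambda>N. (hN N (fst z))\<^sup>2) \<longlonglongrightarrow> (h' (fst z))\<^sup>2"
        by (intro AE_I2 tendsto_power hNlim cubeP)
      show "AE z in P. norm ((hN N (fst z))\<^sup>2) \<le> 4\<^sup>2" for N
      proof (rule AE_I2)
        fix z assume "z \<in> space P"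
        hence "(hN N (fst z))\<^sup>2 \<le> 4\<^sup>2" using hNB[of z N] by (intro abs_le_square_iff[THEN iffD1]) simp
        thus "norm ((hN N (fst z))\<^sup>2) \<le> 4\<^sup>2" by simp
      qed
    qed (use hNm h'm in auto)
    have lim1: "(\<lambda>N. \<integral>z. W z * hN N (fst z) \<partial>P) \<longlonglongrightarrow> (\<integral>z. W z * h' (fst z) \<partial>P)"
    proof (rule integral_dominated_convergence[where w = "\<lambda>_. 4"])
      show "AE z in P. (\<lambda>N. W z * hN N (fst z)) \<longlonglongrightarrow> W z * h' (fst z)"
        by (intro AE_I2 tendsto_intros hNlim cubeP)
      show "AE z in P. norm (W z * hN N (fst z)) \<le> 4" for N
      proof (rule AE_I2)
        fix z assume "z \<in> space P"
        from mult_mono[OF WB[OF this] hNB[OF this, of N]]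
        show "norm (W z * hN N (fst z)) \<le> 4" by (simp add: abs_mult)
      qed
    qed (use hNm h'm Wm in auto)
    \<comment> \<open>For fixed \<open>\<omega>\<close> the deviation involves finitely many sample
      points and two integrals, so pointwise bounded convergence on the cube is enough.\<close>
    have "(\<lambda>N. dev (hN N) ?z) \<longlonglongrightarrow> dev h' ?z"
      unfolding dev_def by (intro tendsto_intros lim1 lim2 hNlim Tcube)
    moreover have "real n * R\<^sup>2 / 2 < dev h' ?z"
    proof -
      have "0 < real n * R\<^sup>2" using n R by simp
      thus ?thesis using devh' by linarith
    qed
    ultimately have "\<forall>\<^sub>F N in sequentially. real n * R\<^sup>2 / 2 < dev (hN N) ?z" by (rule order_tendstoD(1))
    moreover have "\<forall>\<^sub>F N in sequentially. (\<integral>z. (hN N (fst z))\<^sup>2 \<partial>P) < (2 * R)\<^sup>2"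
    proof (rule order_tendstoD(2)[OF lim2])
      show "(\<integral>z. (h' (fst z))\<^sup>2 \<partial>P) < (2 * R)\<^sup>2" unfolding h'2 using R by (simp add: power_mult_distrib)
    qed
    ultimately have "\<forall>\<^sub>F N in sequentially. real n * R\<^sup>2 / 2 < dev (hN N) ?z \<and> (\<integral>z. (hN N (fst z))\<^sup>2 \<partial>P) < (2 * R)\<^sup>2"
      by (rule eventually_conj)
    then obtain N where N: "real n * R\<^sup>2 / 2 < dev (hN N) ?z" "(\<integral>z. (hN N (fst z))\<^sup>2 \<partial>P) < (2 * R)\<^sup>2"
      using eventually_happens'[OF sequentially_bot] by blast
    have "hN N \<in> \<H>"
      unfolding \<H>_def using N(2) ps(1)[of N] by (auto simp: hN_def[abs_def] intro!: image_eqI[of _ _ "ps N"])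
    hence "?z \<in> E \<H>" unfolding E_def using T\<Pi> N(1) by (auto intro!: bexI[of _ "hN N"])
    thus "\<omega> \<in> T -` E \<H> \<inter> space \<Omega>" using \<omega> by simp
  qed
  from outer_measure_of_mono[OF this, of \<Omega>]
  have "outer_measure_of \<Omega> {\<omega> \<in> space \<Omega>. r * R < \<bar>L2_norm_X P (\<lambda>x. \<theta>hat \<omega> x - \<theta>0 x)\<bar>} \<le> emeasure \<Omega> (T -` E \<H> \<inter> space \<Omega>)"
    unfolding outer_measure_of_eq[OF pre] .
  also have "\<dots> = emeasure ?\<Pi> (E \<H>)"
    unfolding distrT[symmetric] using E\<H> sets\<Pi> by (intro emeasure_distr[symmetric] Tm) simp
  also note main
  finally show ?thesis .
qed

theorem mainTheorem6:
  fixes a' a :: "nat \<Rightarrow> real"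
    and \<Omega> :: "nat \<Rightarrow> 'w measure"
    and P0 :: "nat \<Rightarrow> ((real ^ 'd) \<times> real) measure"
    and X :: "nat \<Rightarrow> nat \<Rightarrow> 'w \<Rightarrow> real ^ 'd"
    and Y :: "nat \<Rightarrow> nat \<Rightarrow> 'w \<Rightarrow> real"
    and \<theta> :: "nat \<Rightarrow> real ^ 'd \<Rightarrow> real"
    and \<theta>hat :: "nat \<Rightarrow> 'w \<Rightarrow> real ^ 'd \<Rightarrow> real"
  assumes "mono_on {1..} a'"
    and "\<And>n. n \<ge> 1 \<Longrightarrow> a' n > 0"
    and "\<And>n. n \<ge> 1 \<Longrightarrow> prob_space (\<Omega> n)"
    and "\<And>n. n \<ge> 1 \<Longrightarrow> prob_space.indep_vars (\<Omega> n) (\<lambda>_. obs_space (a' n))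
           (\<lambda>i \<omega>. (X n i \<omega>, Y n i \<omega>)) {1..n}"
    and "\<And>n i. i \<in> {1..n} \<Longrightarrow> distr (\<Omega> n) (obs_space (a' n)) (\<lambda>\<omega>. (X n i \<omega>, Y n i \<omega>)) = P0 n"
    and "\<And>n. n \<ge> 1 \<Longrightarrow> is_arg_min (\<lambda>\<eta>. \<integral>z. square_loss \<eta> z \<partial>P0 n) (\<lambda>\<eta>. \<eta> \<in> cadlag_ball (a' n)) (\<theta> n)"
    and "\<And>n \<omega>. n \<ge> 1 \<Longrightarrow> \<omega> \<in> space (\<Omega> n) \<Longrightarrow>
           is_arg_min (\<lambda>\<eta>. empirical_mean n (\<lambda>i. (X n i \<omega>, Y n i \<omega>)) (square_loss \<eta>))
             (\<lambda>\<eta>. \<eta> \<in> cadlag_ball (a' n)) (\<theta>hat n \<omega>)"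
    and "\<And>n. a n = 4 * a' n"
  shows "big_O_P \<Omega> (\<lambda>n \<omega>. L2_norm_X (P0 n) (\<lambda>x. \<theta>hat n \<omega> x - \<theta> n x))
           (\<lambda>n. a n * real n powr (- 1 / 3) * ln (real n) powr (2 * (real CARD('d) - 1) / 3))"
  unfolding big_O_P_def
proof (intro allI impI)
  fix \<epsilon> :: real assume \<epsilon>: "0 < \<epsilon>"
  let ?d = "CARD('d)"
  define p where "p = 2 * (real ?d - 1) / 3"
  have d1: "1 \<le> real ?d" by simp
  have p: "0 \<le> p" unfolding p_def using d1 by simp
  \<comment> \<open>Large enough to bring the tail bound below \<open>\<epsilon>\<close>; being at
    least 1, it also keeps \<open>R\<close> above \<open>\<delta> n\<close>.\<close>
  define K where "K = max 1 (tail_const ?d / \<epsilon>)"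
  have K: "1 \<le> K" "tail_const ?d \<le> K * \<epsilon>" unfolding K_def using \<epsilon> by (auto simp: max_def field_simps)
  \<comment> \<open>\<open>sqrt n * \<delta>^(3/2)\<close> equals the logarithmic factor exactly, so
    \<open>R = K * \<delta>\<close> leaves the ratio \<open>K^(-3/2)\<close>, which is at most
    \<open>1 / K\<close>.\<close>
  define \<kappa> where "\<kappa> = 1 / (K * sqrt K)"
  have sK: "1 \<le> sqrt K" using K(1) by simp
  have KsK: "K \<le> K * sqrt K" using mult_left_mono[OF sK, of K] K(1) by simp
  have \<kappa>K: "\<kappa> \<le> 1 / K"
    unfolding \<kappa>_def using K(1) KsK by (intro frac_le) auto
  have \<kappa>: "0 \<le> \<kappa>" "\<kappa> \<le> 1"
  proof -
    show "0 \<le> \<kappa>" unfolding \<kappa>_def using K(1) by simp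
    have "1 / K \<le> 1" using K(1) by simp
    thus "\<kappa> \<le> 1" using \<kappa>K by linarith
  qed
  define \<delta> where "\<delta> n = real n powr (- 1 / 3) * ln (real n) powr p" for n
  have ev1: "\<forall>\<^sub>F n in sequentially. K * \<delta> n \<le> 1"
  proof -
    have "(\<lambda>n. K * \<delta> n) \<longlonglongrightarrow> 0" unfolding \<delta>_def using p K(1) by real_asymp
    hence "\<forall>\<^sub>F n in sequentially. K * \<delta> n < 1" by (rule order_tendstoD(2)) simp
    thus ?thesis by eventually_elim simp
  qed
  have ev2: "\<forall>\<^sub>F n in sequentially. ln (real n) \<le> real n * real n powr (- 1 / 3)" by real_asymp
  show "\<exists>C>0. \<forall>\<^sub>F n in sequentially. outer_measure_of (\<Omega> n) {\<omega> \<in> space (\<Omega> n).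
      C * (a n * real n powr (- 1 / 3) * ln (real n) powr (2 * (real ?d - 1) / 3))
      < \<bar>L2_norm_X (P0 n) (\<lambda>x. \<theta>hat n \<omega> x - \<theta> n x)\<bar>} \<le> ennreal \<epsilon>"
  \<comment> \<open>The tail bound is stated relative to \<open>a' n\<close>, whereas the rate
    contains \<open>a n = 4 * a' n\<close>.\<close>
  proof (intro exI[of _ "K / 4"] conjI)
    show "0 < K / 4" using K(1) by simp
    show "\<forall>\<^sub>F n in sequentially. outer_measure_of (\<Omega> n) {\<omega> \<in> space (\<Omega> n).
      K / 4 * (a n * real n powr (- 1 / 3) * ln (real n) powr (2 * (real ?d - 1) / 3))
      < \<bar>L2_norm_X (P0 n) (\<lambda>x. \<theta>hat n \<omega> x - \<theta> n x)\<bar>} \<le> ennreal \<epsilon>"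
      using ev1 ev2 eventually_ge_at_top[of 3]
    proof eventually_elim
      case (elim n)
      have n1: "1 \<le> n" using elim(3) by simp
      have m1: "1 \<le> ln (real n)" by (rule one_le_ln[OF elim(3)])
      define R where "R = K * \<delta> n"
      have lp: "1 \<le> ln (real n) powr p" using m1 p by (simp add: ge_one_powr_ge_zero)
      have npos: "0 < real n powr (- 1 / 3)" using n1 by simp
      have \<delta>_ge: "real n powr (- 1 / 3) \<le> \<delta> n"
        unfolding \<delta>_def using mult_left_mono[OF lp, of "real n powr (- 1 / 3)"] npos by simp
      have \<delta>0: "0 < \<delta> n" using \<delta>_ge npos by linarith
      have R: "0 < R" "R \<le> 1" "ln (real n) \<le> real n * R"
      proof -
        show "0 < R" unfolding R_def using K(1) \<delta>0 by simp
        show "R \<le> 1" unfolding R_def by (rule elim(1))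
        have "\<delta> n \<le> R" unfolding R_def using mult_right_mono[OF K(1), of "\<delta> n"] \<delta>0 by simp
        hence "real n * real n powr (- 1 / 3) \<le> real n * R" using \<delta>_ge by (intro mult_left_mono) auto
        thus "ln (real n) \<le> real n * R" using elim(2) by linarith
      qed
      have rate: "ln (real n) ^ (?d - 1) \<le> \<kappa> * (sqrt n * (R * sqrt R))"
      proof -
        have "\<delta> n * sqrt (\<delta> n) = \<delta> n powr (3/2)"
          using \<delta>0 by (simp add: powr_half_sqrt[symmetric] powr_mult_base)
        also have "\<dots> = real n powr (- 1 / 2) * ln (real n) powr (real ?d - 1)"
        proof -
          have "p * (3/2) = real ?d - 1" unfolding p_def by simp
          moreover have "(ln (real n) powr p) powr (3/2) = ln (real n) powr (p * (3/2))" by (rule powr_powr)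
          moreover have "(real n powr (- 1 / 3)) powr (3/2) = real n powr (- 1 / 2)" by (simp add: powr_powr)
          ultimately show ?thesis unfolding \<delta>_def by (simp only: powr_mult)
        qed
        also have "ln (real n) powr (real ?d - 1) = ln (real n) ^ (?d - 1)"
          using m1 d1 by (simp add: powr_realpow[symmetric] of_nat_diff)
        finally have "sqrt n * (\<delta> n * sqrt (\<delta> n)) = sqrt n * real n powr (- 1 / 2) * ln (real n) ^ (?d - 1)"
          by (simp add: mult.assoc)
        also have "sqrt n * real n powr (- 1 / 2) = 1"
          using n1 by (simp add: powr_half_sqrt[symmetric] powr_add[symmetric])
        finally have "ln (real n) ^ (?d - 1) = sqrt n * (\<delta> n * sqrt (\<delta> n))" by simp
        also have "\<dots> = \<kappa> * (sqrt n * (R * sqrt R))"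
          unfolding \<kappa>_def R_def using K(1) by (simp add: real_sqrt_mult)
        finally show ?thesis by simp
      qed
      have "outer_measure_of (\<Omega> n) {\<omega> \<in> space (\<Omega> n). a' n * R < \<bar>L2_norm_X (P0 n) (\<lambda>x. \<theta>hat n \<omega> x - \<theta> n x)\<bar>}
          \<le> ennreal (tail_const ?d * \<kappa>)"
        by (rule least_squares_tail[OF assms(3)[OF n1] assms(2)[OF n1] assms(4)[OF n1] assms(5) assms(6)[OF n1] assms(7)[OF n1] elim(3) R \<kappa> rate])
      also have "ennreal (tail_const ?d * \<kappa>) \<le> ennreal \<epsilon>"
      proof (rule ennreal_leI)
        have "tail_const ?d * \<kappa> \<le> (K * \<epsilon>) * (1 / K)"
          using K \<kappa> \<kappa>K \<epsilon> by (intro mult_mono) auto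
        thus "tail_const ?d * \<kappa> \<le> \<epsilon>" using K(1) by simp
      qed
      finally have tail: "outer_measure_of (\<Omega> n) {\<omega> \<in> space (\<Omega> n). a' n * R < \<bar>L2_norm_X (P0 n) (\<lambda>x. \<theta>hat n \<omega> x - \<theta> n x)\<bar>} \<le> ennreal \<epsilon>" .
      have eq: "a' n * R = K / 4 * (a n * real n powr (- 1 / 3) * ln (real n) powr (2 * (real ?d - 1) / 3))"
        unfolding R_def \<delta>_def p_def assms(8) by simp
      show ?case using tail unfolding eq .
    qed
  qed
qed

end
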